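(* Let $\Phi$ be a monotone $\sigma$-continuous ID valuation on $\mathcal K^d$ with Lévy measure $\Lambda$. Then $\Phi$ has independent increments if and only if $\Lambda$ is the pushforward of a Borel measure $\nu$ on $\mathcal C\times(0,\infty)$ under the map $(F,r)\mapsto\psi$, where $\psi(K)=r\mathbf 1_{K\cap F\neq\emptyset}$, $K\in\mathcal K^d$. Furthermore, in this case $\Phi$ has the same distribution as $$\tilde\Phi(K)=\phi(K)+\sum_i r_i\mathbf 1_{K\cap F_i\neq\emptyset},\quad K\in\mathcal K^d,$$ where $\{(F_i,r_i),i\ge1\}$ is the Poisson point process on $\mathcal C\times(0,\infty)$ with intensity measure $\nu$ and $\phi$ is a deterministic monotone $\sigma$-continuous valuation. The measure $\nu$ necessarily satisfies $$\int_{\mathcal C\times(0,\infty)}\min(1,r)\mathbf 1_{F\cap K\neq\emptyset}\,\nu(d(F,r))<\infty,\quad K\in\mathcal K^d.$$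
   Context: $\mathcal K^d$ is the family of compact convex subsets of $\mathbb R^d$, including $\emptyset$. A (deterministic) valuation is a map $\phi:\mathcal K^d\to\mathbb R$ with $\phi(\emptyset)=0$ and $\phi(K\cup L)+\phi(K\cap L)=\phi(K)+\phi(L)$ whenever $K,L,K\cup L\in\mathcal K^d$. It is monotone if $\phi(L)\le\phi(K)$ for $L\subset K$, and $\sigma$-continuous if $\phi(K_n)\to\phi(K)$ whenever $K_n\downarrow K$ (decreasing sequence with intersection $K$). All random objects live on a complete probability space. A random valuation $\Phi$ is a real-valued stochastic process indexed by $\mathcal K^d$ with $\Phi(\emptyset)=0$ a.s. and, for each fixed $K,L\in\mathcal K^d$ with $K\cup L\in\mathcal K^d$, $\Phi(K\cup L)+\Phi(K\cap L)=\Phi(K)+\Phi(L)$ a.s. It is called monotone ($\sigma$-continuous, non-negative) if almost all its realisations are. Equality in distribution of random valuations means equality of all finite-dimensional distributions. $\Phi$ is separable if there exist a countable $\mathcal D\subset\mathcal K^d$ and an event $\Omega_0$ of probability one such that for all $K,L\in\mathcal K^d$ with $K\cup L\in\mathcal K^d$ there are $K_n,L_n\in\mathcal D$ with $K_n\cup L_n$ convex, $K_n\downarrow K$, $L_n\downarrow L$ and, on $\Omega_0$, $\Phi(K_n)\to\Phi(K)$, $\Phi(L_n)\to\Phi(L)$, $\Phi(K_n\cup L_n)\to\Phi(K\cup L)$, $\Phi(K_n\cap L_n)\to\Phi(K\cap L)$. $\Phi$ is an ID valuation if it is separable and infinitely divisible, i.e., for each $n\ge2$ it equals in distribution the sum of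 $n$ i.i.d. random valuations. Independent increments: for each $n\ge2$ and each nested sequence $L_1\supset\cdots\supset L_n$ in $\mathcal K^d$, with $L_{n+1}=\emptyset$, the random variables $\Phi(L_i)-\Phi(L_{i+1})$, $i=1,\dots,n$, are jointly independent. Lévy measure: a measure $\Lambda$ on $\mathbb R_+^{\mathcal K^d}$ (all functions $\psi:\mathcal K^d\to[0,\infty)$) with the cylindrical $\sigma$-algebra such that (L1) $\int\min(1,\psi(K))\Lambda(d\psi)<\infty$ for all $K\in\mathcal K^d$, and (L2) $\Lambda(A)=\Lambda_*(A\setminus\{O\})$ for all measurable $A$, where $\Lambda_*$ is the inner measure and $O$ is the zero function. For a non-negative ID valuation $\Phi$, its Lévy measure is the unique such $\Lambda$ for which, with $\phi(K)=\operatorname{ess\,inf}\Phi(K)$ (the deterministic part of $\Phi$), $\mathbf E\exp\{-\sum_ju_j\Phi(K_j)\}=\exp\{-\sum_ju_j\phi(K_j)-\int(1-e^{-\sum_ju_j\psi(K_j)})\Lambda(d\psi)\}$ for all $m\ge1$, $K_1,\dots,K_m\in\mathcal K^d$, $u\in\mathbb R_+^m$. $\mathcal C$ is the family of non-empty closed convex subsets of $\mathbb R^d$ with the Borel $\sigma$-algebra of the Fell topology. *)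

theory Defs
  imports "HOL-Probability.Probability"
begin

section \<open>Convex bodies and deterministic valuations\<close>

text \<open>The space \<open>\<real>\<^sup>d\<close> is an arbitrary type \<open>'a\<close> of class \<^class>\<open>euclidean_space\<close>, with \<open>d = DIM('a)\<close>.
  The empty set is a convex body. Functions of convex bodies have type \<^typ>\<open>'a set \<Rightarrow> real\<close>; only
  their values on \<open>convex_bodies\<close> matter. Monotonicity is \<^const>\<open>mono_on\<close> \<open>convex_bodies\<close>.\<close>

definition convex_bodies :: "'a::euclidean_space set set" where
  "convex_bodies = {K. compact K \<and> convex K}"

definition decreases_to :: "(nat \<Rightarrow> 'a set) \<Rightarrow> 'a set \<Rightarrow> bool" where
  "decreases_to Ks K \<longleftrightarrow> decseq Ks \<and> (\<Inter>n. Ks n) = K"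

definition valuation :: "('a::euclidean_space set \<Rightarrow> real) \<Rightarrow> bool" where
  "valuation \<phi> \<longleftrightarrow> \<phi> {} = 0 \<and>
     (\<forall>K\<in>convex_bodies. \<forall>L\<in>convex_bodies. K \<union> L \<in> convex_bodies \<longrightarrow>
        \<phi> (K \<union> L) + \<phi> (K \<inter> L) = \<phi> K + \<phi> L)"

definition sigma_continuous :: "('a::euclidean_space set \<Rightarrow> real) \<Rightarrow> bool" where
  "sigma_continuous \<phi> \<longleftrightarrow>
     (\<forall>Ks K. range Ks \<subseteq> convex_bodies \<and> K \<in> convex_bodies \<and> decreases_to Ks K \<longrightarrow>
        (\<lambda>n. \<phi> (Ks n)) \<longlonglongrightarrow> \<phi> K)"

section \<open>Random valuations\<close>

definition complete_prob_space :: "'w measure \<Rightarrow> bool" where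
  "complete_prob_space M \<longleftrightarrow> prob_space M \<and> complete_measure M"

text \<open>A process is a map \<open>\<Phi>\<close> with \<open>\<Phi> K w\<close> the value at the body \<open>K\<close> of the realisation \<open>w\<close>. The
  exceptional null set in the valuation property may depend on \<open>K\<close> and \<open>L\<close>.\<close>

definition random_valuation :: "'w measure \<Rightarrow> ('a::euclidean_space set \<Rightarrow> 'w \<Rightarrow> real) \<Rightarrow> bool" where
  "random_valuation M \<Phi> \<longleftrightarrow> complete_prob_space M \<and>
     (\<forall>K\<in>convex_bodies. \<Phi> K \<in> borel_measurable M) \<and>
     (AE w in M. \<Phi> {} w = 0) \<and>
     (\<forall>K\<in>convex_bodies. \<forall>L\<in>convex_bodies. K \<union> L \<in> convex_bodies \<longrightarrow>
        (AE w in M. \<Phi> (K \<union> L) w + \<Phi> (K \<inter> L) w = \<Phi> K w + \<Phi> L w))"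

definition monotone_paths :: "'w measure \<Rightarrow> ('a::euclidean_space set \<Rightarrow> 'w \<Rightarrow> real) \<Rightarrow> bool" where
  "monotone_paths M \<Phi> \<longleftrightarrow> (AE w in M. mono_on convex_bodies (\<lambda>K. \<Phi> K w))"

definition sigma_continuous_paths :: "'w measure \<Rightarrow> ('a::euclidean_space set \<Rightarrow> 'w \<Rightarrow> real) \<Rightarrow> bool" where
  "sigma_continuous_paths M \<Phi> \<longleftrightarrow> (AE w in M. sigma_continuous (\<lambda>K. \<Phi> K w))"

definition same_fdd ::
  "'w measure \<Rightarrow> ('a::euclidean_space set \<Rightarrow> 'w \<Rightarrow> real) \<Rightarrow>
   'v measure \<Rightarrow> ('a set \<Rightarrow> 'v \<Rightarrow> real) \<Rightarrow> bool" where
  "same_fdd M \<Phi> N \<Psi> \<longleftrightarrow>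
     (\<forall>J. finite J \<and> J \<subseteq> convex_bodies \<longrightarrow>
        distr M (PiM J (\<lambda>_. borel)) (\<lambda>w. \<lambda>K\<in>J. \<Phi> K w) =
        distr N (PiM J (\<lambda>_. borel)) (\<lambda>w. \<lambda>K\<in>J. \<Psi> K w))"

definition separable_process :: "'w measure \<Rightarrow> ('a::euclidean_space set \<Rightarrow> 'w \<Rightarrow> real) \<Rightarrow> bool" where
  "separable_process M \<Phi> \<longleftrightarrow>
     (\<exists>D \<Omega>0. countable D \<and> D \<subseteq> convex_bodies \<and> \<Omega>0 \<in> sets M \<and> emeasure M \<Omega>0 = 1 \<and>
        (\<forall>K\<in>convex_bodies. \<forall>L\<in>convex_bodies. K \<union> L \<in> convex_bodies \<longrightarrow>
           (\<exists>Ks Ls. range Ks \<subseteq> D \<and> range Ls \<subseteq> D \<and> (\<forall>n. convex (Ks n \<union> Ls n)) \<and>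
              decreases_to Ks K \<and> decreases_to Ls L \<and>
              (\<forall>w\<in>\<Omega>0.
                 (\<lambda>n. \<Phi> (Ks n) w) \<longlonglongrightarrow> \<Phi> K w \<and>
                 (\<lambda>n. \<Phi> (Ls n) w) \<longlonglongrightarrow> \<Phi> L w \<and>
                 (\<lambda>n. \<Phi> (Ks n \<union> Ls n) w) \<longlonglongrightarrow> \<Phi> (K \<union> L) w \<and>
                 (\<lambda>n. \<Phi> (Ks n \<inter> Ls n) w) \<longlonglongrightarrow> \<Phi> (K \<inter> L) w))))"

definition iid_random_valuations ::
  "'w measure \<Rightarrow> nat \<Rightarrow> (nat \<Rightarrow> 'a::euclidean_space set \<Rightarrow> 'w \<Rightarrow> real) \<Rightarrow> bool" where
  "iid_random_valuations M n \<Psi> \<longleftrightarrow>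
     (\<forall>i<n. random_valuation M (\<Psi> i)) \<and>
     (\<forall>i<n. \<forall>j<n. same_fdd M (\<Psi> i) M (\<Psi> j)) \<and>
     prob_space.indep_vars M (\<lambda>_. PiM convex_bodies (\<lambda>_. borel))
       (\<lambda>i w. \<lambda>K\<in>convex_bodies. \<Psi> i K w) {..<n}"

text \<open>HOL cannot quantify over the type of the sample points inside a formula, so the i.i.d. summands
  live on a space whose points are sequences of functions of bodies. Nothing is lost: \<open>n\<close> random
  valuations on any space can be replaced by the coordinate processes under the completion of their
  joint law.\<close>

definition infinitely_divisible_process ::
  "'w measure \<Rightarrow> ('a::euclidean_space set \<Rightarrow> 'w \<Rightarrow> real) \<Rightarrow> bool" where
  "infinitely_divisible_process M \<Phi> \<longleftrightarrow>
     (\<forall>n\<ge>2. \<exists>(N :: (nat \<Rightarrow> 'a set \<Rightarrow> real) measure) \<Psi>.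
        iid_random_valuations N n \<Psi> \<and> same_fdd M \<Phi> N (\<lambda>K w. \<Sum>i<n. \<Psi> i K w))"

definition ID_valuation :: "'w measure \<Rightarrow> ('a::euclidean_space set \<Rightarrow> 'w \<Rightarrow> real) \<Rightarrow> bool" where
  "ID_valuation M \<Phi> \<longleftrightarrow>
     random_valuation M \<Phi> \<and> separable_process M \<Phi> \<and> infinitely_divisible_process M \<Phi>"

definition independent_increments :: "'w measure \<Rightarrow> ('a::euclidean_space set \<Rightarrow> 'w \<Rightarrow> real) \<Rightarrow> bool" where
  "independent_increments M \<Phi> \<longleftrightarrow>
     (\<forall>n\<ge>2. \<forall>L :: nat \<Rightarrow> 'a set.
        (\<forall>i\<in>{1..n}. L i \<in> convex_bodies) \<and> (\<forall>i\<in>{1..<n}. L (Suc i) \<subseteq> L i) \<and> L (Suc n) = {} \<longrightarrow>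
        prob_space.indep_vars M (\<lambda>_. borel) (\<lambda>i w. \<Phi> (L i) w - \<Phi> (L (Suc i)) w) {1..n})"

section \<open>Deterministic part and Levy measure\<close>

definition ess_inf :: "'w measure \<Rightarrow> ('w \<Rightarrow> real) \<Rightarrow> real" where
  "ess_inf M X = Sup {c. AE w in M. c \<le> X w}"

definition deterministic_part :: "'w measure \<Rightarrow> ('a::euclidean_space set \<Rightarrow> 'w \<Rightarrow> real) \<Rightarrow> 'a set \<Rightarrow> real" where
  "deterministic_part M \<Phi> K = ess_inf M (\<Phi> K)"

text \<open>The measurable space of all functions \<open>convex_bodies \<rightarrow> [0,\<infinity>)\<close> with the cylindrical
  \<open>\<sigma>\<close>-algebra. As usual for \<^const>\<open>PiM\<close>, its points are the functions that are \<^const>\<open>undefined\<close>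
  outside \<open>convex_bodies\<close>.\<close>

definition path_space :: "('a::euclidean_space set \<Rightarrow> real) measure" where
  "path_space = PiM convex_bodies (\<lambda>_. restrict_space borel {0..})"

definition inner_measure :: "'b measure \<Rightarrow> 'b set \<Rightarrow> ennreal" where
  "inner_measure \<mu> B = (SUP C\<in>{C \<in> sets \<mu>. C \<subseteq> B}. emeasure \<mu> C)"

definition levy_measure :: "('a::euclidean_space set \<Rightarrow> real) measure \<Rightarrow> bool" where
  "levy_measure \<Lambda> \<longleftrightarrow> sets \<Lambda> = sets path_space \<and>
     (\<forall>K\<in>convex_bodies. (\<integral>\<^sup>+\<psi>. ennreal (min 1 (\<psi> K)) \<partial>\<Lambda>) < \<infinity>) \<and>
     (\<forall>A\<in>sets \<Lambda>. emeasure \<Lambda> A = inner_measure \<Lambda> (A - {\<lambda>K\<in>convex_bodies. 0}))"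

text \<open>The Bochner integral of \<open>1 - exp (\<dots>)\<close> below is a genuine one: the integrand is at most
  \<open>\<Sum>j<m. max 1 (u j) * min 1 (\<psi> (K j))\<close>, which is integrable for a \<^const>\<open>levy_measure\<close>.\<close>

definition levy_measure_of ::
  "'w measure \<Rightarrow> ('a::euclidean_space set \<Rightarrow> 'w \<Rightarrow> real) \<Rightarrow> ('a set \<Rightarrow> real) measure \<Rightarrow> bool" where
  "levy_measure_of M \<Phi> \<Lambda> \<longleftrightarrow> levy_measure \<Lambda> \<and>
     (\<forall>(m::nat)\<ge>1. \<forall>K u. (\<forall>j<m. K j \<in> convex_bodies \<and> 0 \<le> u j) \<longrightarrow>
        (\<integral>w. exp (- (\<Sum>j<m. u j * \<Phi> (K j) w)) \<partial>M) =
        exp (- (\<Sum>j<m. u j * deterministic_part M \<Phi> (K j))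
             - (\<integral>\<psi>. 1 - exp (- (\<Sum>j<m. u j * \<psi> (K j))) \<partial>\<Lambda>)))"

section \<open>Closed convex sets with the Fell topology\<close>

definition borel_of :: "'b topology \<Rightarrow> 'b measure" where
  "borel_of X = sigma (topspace X) {U. openin X U}"

definition fell_topology :: "'a::euclidean_space set topology" where
  "fell_topology = topology_generated_by
     ({{F. closed F \<and> F \<inter> K = {}} | K. compact K} \<union> {{F. closed F \<and> F \<inter> G \<noteq> {}} | G. open G})"

definition closed_convex_sets :: "'a::euclidean_space set set" where
  "closed_convex_sets = {F. F \<noteq> {} \<and> closed F \<and> convex F}"

text \<open>The space \<open>\<C> \<times> (0,\<infinity>)\<close> of marked closed convex sets.\<close>

definition marked_sets :: "('a::euclidean_space set \<times> real) topology" where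
  "marked_sets = prod_topology (subtopology fell_topology closed_convex_sets) (top_of_set {0<..})"

definition borel_measure_on_marked_sets :: "('a::euclidean_space set \<times> real) measure \<Rightarrow> bool" where
  "borel_measure_on_marked_sets \<nu> \<longleftrightarrow> sets \<nu> = sets (borel_of marked_sets)"

definition hit_function :: "'a::euclidean_space set \<times> real \<Rightarrow> 'a set \<Rightarrow> real" where
  "hit_function = (\<lambda>(F, r). \<lambda>K\<in>convex_bodies. r * of_bool (K \<inter> F \<noteq> {}))"

definition hit_pushforward :: "('a::euclidean_space set \<times> real) measure \<Rightarrow> ('a set \<Rightarrow> real) measure" where
  "hit_pushforward \<nu> = distr \<nu> path_space hit_function"

section \<open>Poisson point processes\<close>

text \<open>A point process is given by its total number \<open>T\<close> of points, possibly infinite, and an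
  enumeration \<open>X\<close> of the points, of which only the \<open>X i\<close> with \<open>i < T\<close> count. Points are listed with
  multiplicity; multiplicities occur if the intensity measure has atoms.\<close>

definition point_count ::
  "('v \<Rightarrow> enat) \<Rightarrow> (nat \<Rightarrow> 'v \<Rightarrow> 'b) \<Rightarrow> 'b set \<Rightarrow> 'v \<Rightarrow> ennreal" where
  "point_count T X B w = emeasure (count_space UNIV) {i. enat i < T w \<and> X i w \<in> B}"

definition poisson_point_process ::
  "'v measure \<Rightarrow> 'b measure \<Rightarrow> ('v \<Rightarrow> enat) \<Rightarrow> (nat \<Rightarrow> 'v \<Rightarrow> 'b) \<Rightarrow> bool" where
  "poisson_point_process P \<nu> T X \<longleftrightarrow> complete_prob_space P \<and>
     T \<in> measurable P (count_space UNIV) \<and> (\<forall>i. X i \<in> measurable P \<nu>) \<and>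
     (\<forall>B\<in>sets \<nu>.
        (emeasure \<nu> B < \<infinity> \<longrightarrow>
           (\<forall>k::nat. measure P {w \<in> space P. point_count T X B w = of_nat k} =
              exp (- measure \<nu> B) * measure \<nu> B ^ k / fact k)) \<and>
        (emeasure \<nu> B = \<infinity> \<longrightarrow> (AE w in P. point_count T X B w = \<infinity>))) \<and>
     (\<forall>(n::nat) B. (\<forall>i<n. B i \<in> sets \<nu>) \<and> disjoint_family_on B {..<n} \<longrightarrow>
        prob_space.indep_vars P (\<lambda>_. borel) (\<lambda>i. point_count T X (B i)) {..<n})"

definition hit_term ::
  "('v \<Rightarrow> enat) \<Rightarrow> (nat \<Rightarrow> 'v \<Rightarrow> 'a::euclidean_space set \<times> real) \<Rightarrow> 'a set \<Rightarrow> 'v \<Rightarrow> nat \<Rightarrow> real" where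
  "hit_term T X K w i =
     (if enat i < T w then snd (X i w) * of_bool (K \<inter> fst (X i w) \<noteq> {}) else 0)"

definition poisson_valuation ::
  "('a::euclidean_space set \<Rightarrow> real) \<Rightarrow> ('v \<Rightarrow> enat) \<Rightarrow> (nat \<Rightarrow> 'v \<Rightarrow> 'a set \<times> real) \<Rightarrow>
   'a set \<Rightarrow> 'v \<Rightarrow> real" where
  "poisson_valuation \<phi> T X K w = \<phi> K + (\<Sum>i. hit_term T X K w i)"

text \<open>Almost sure summability is stated since \<^const>\<open>suminf\<close> is unspecified for divergent series.\<close>

definition poisson_representation ::
  "'w measure \<Rightarrow> ('a::euclidean_space set \<Rightarrow> 'w \<Rightarrow> real) \<Rightarrow> ('a set \<Rightarrow> real) \<Rightarrow>
   'v measure \<Rightarrow> ('v \<Rightarrow> enat) \<Rightarrow> (nat \<Rightarrow> 'v \<Rightarrow> 'a set \<times> real) \<Rightarrow> bool" where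
  "poisson_representation M \<Phi> \<phi> P T X \<longleftrightarrow>
     (AE w in P. \<forall>K\<in>convex_bodies. summable (hit_term T X K w)) \<and>
     same_fdd M \<Phi> P (poisson_valuation \<phi> T X)"

end

theory Submission imports Defs begin

text \<open>
  Write \<open>x = \<psi>(K)\<close>, \<open>y = \<psi>(L)\<close> for bodies \<open>L \<subseteq> K\<close>. If \<open>\<Phi>\<close> has independent increments, then its
  Laplace exponents satisfy an additivity relation which says that
  \<open>\<integral>(e\<^sup>-\<^sup>x - e\<^sup>-\<^sup>y)\<^sup>2 (1 - e\<^sup>-\<^sup>y) d\<Lambda> = 0\<close>. Hence \<open>\<Lambda>\<close>-almost every \<open>\<psi>\<close> takes on any countable family of
  bodies only the values \<open>0\<close> and \<open>r\<close>; in the same way it inherits the valuation property from \<open>\<Phi>\<close>.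
  The points all of whose rational box neighbourhoods are charged by \<open>\<psi>\<close> form a closed convex set
  \<open>F\<close>, and \<open>\<psi>(K) = r\<close> or \<open>0\<close> according to whether \<open>K\<close> hits \<open>F\<close>, almost everywhere for each fixed
  \<open>K\<close>. As measurable sets depend on countably many bodies, the image \<open>\<nu>\<close> of \<open>\<Lambda>\<close> under
  \<open>\<psi> \<mapsto> (F, r)\<close> has pushforward \<open>\<Lambda>\<close>.

  Conversely, if \<open>\<Lambda>\<close> is the pushforward of \<open>\<nu>\<close>, then \<open>\<nu>\<close> is \<open>\<sigma>\<close>-finite and the Laplace functional of
  the Poisson process shows that the Poisson sum has the same finite-dimensional distributions as
  \<open>\<Phi>\<close>. Its increments along a nested sequence are sums over disjoint sets of points.
\<close>

section \<open>Distributions determined by moments\<close>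

text \<open>Why two values: for \<open>L \<subseteq> K\<close> the variables \<Phi>(K) - \<Phi>(L)
  and \<Phi>(L) are independent, and the Levy measure of a vector with independent components lives
  on the axes, so \<psi>(L) = 0 or \<psi>(K) = \<psi>(L). The obstacle is that \<Lambda> lives on
  functions of uncountably many bodies. An almost everywhere statement covers countably many bodies
  at once, so no single \<psi> is known to be a hit function. This is why F is read off rational
  boxes, while each further body K is treated separately, together with its parallel bodies: these
  contain neighbourhoods of the points of K, and the \<sigma>-continuity of \<Phi> carries the
  conclusion back to K. Distributions are compared through moments: for X \<ge> 0 the variable
  exp(-X) lies in [0,1], its moments are the values of the Laplace transform of X at natural
  numbers, and moments determine a measure on a compact interval. Poisson sums first take values in
  [0,\<infinity>], with exp(-\<infinity>) = 0, and are shown to be finite afterwards.\<close>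

lemma (in finite_measure) integral_approx:
  fixes f g :: "'a \<Rightarrow> real"
  assumes f: "integrable M f" and g: "integrable M g" and fg: "AE x in M. \<bar>f x - g x\<bar> \<le> e"
  shows "\<bar>(\<integral>x. f x \<partial>M) - (\<integral>x. g x \<partial>M)\<bar> \<le> e * measure M (space M)"
proof -
  have "\<bar>\<integral>x. f x - g x \<partial>M\<bar> \<le> (\<integral>x. \<bar>f x - g x\<bar> \<partial>M)"
    by (rule integral_abs_bound)
  also have "\<dots> \<le> (\<integral>x. e \<partial>M)"
    using f g fg by (intro integral_mono_AE) auto
  finally show ?thesis using f g by (simp add: mult.commute)
qed

text \<open>Determinacy of the Hausdorff moment problem. By Weierstrass approximation equal moments
  give equal integrals of bounded continuous functions; indicators of half-lines are pointwise
  limits of such functions, and half-lines determine a finite measure.\<close>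

lemma finite_measure_eqI_moments:
  fixes \<mu> \<nu> :: "real measure"
  assumes fin: "finite_measure \<mu>" "finite_measure \<nu>"
    and sets: "sets \<mu> = sets borel" "sets \<nu> = sets borel"
    and supp: "AE x in \<mu>. x \<in> {0..1}" "AE x in \<nu>. x \<in> {0..1}"
    and mom: "\<And>k::nat. (\<integral>x. x ^ k \<partial>\<mu>) = (\<integral>x. x ^ k \<partial>\<nu>)"
  shows "\<mu> = \<nu>"
proof -
  interpret \<mu>: finite_measure \<mu> by fact
  interpret \<nu>: finite_measure \<nu> by fact
  note [measurable_cong] = sets
  have pow: "integrable \<rho> (\<lambda>x. x ^ k)" if "finite_measure \<rho>" "sets \<rho> = sets borel" "AE x in \<rho>. x \<in> {0..1}"
    for \<rho> :: "real measure" and k :: nat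
  proof -
    interpret finite_measure \<rho> by fact
    note [measurable_cong] = that(2)
    have "AE x in \<rho>. norm (x ^ k) \<le> 1"
      using that(3) by (rule eventually_mono) (auto simp: power_le_one)
    then show ?thesis by (rule integrable_const_bound) measurable
  qed
  have cont: "(\<integral>x. f x \<partial>\<mu>) = (\<integral>x. f x \<partial>\<nu>)"
    if f: "continuous_on UNIV f" and b: "\<And>x. \<bar>f x\<bar> \<le> 1" for f :: "real \<Rightarrow> real"
  proof -
    have [measurable]: "f \<in> borel_measurable borel" using f by (rule borel_measurable_continuous_onI)
    have fi: "integrable \<mu> f" "integrable \<nu> f"
      using b by (auto intro!: \<mu>.integrable_const_bound[of _ 1] \<nu>.integrable_const_bound[of _ 1])
    have "\<bar>(\<integral>x. f x \<partial>\<mu>) - (\<integral>x. f x \<partial>\<nu>)\<bar> \<le> e * (measure \<mu> (space \<mu>) + measure \<nu> (space \<nu>))"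
      if e: "e > 0" for e
    proof -
      obtain g where g: "real_polynomial_function g" and fg: "\<And>x. x \<in> {0..1} \<Longrightarrow> \<bar>f x - g x\<bar> < e"
        using Stone_Weierstrass_real_polynomial_function[OF compact_Icc continuous_on_subset[OF f subset_UNIV] e]
        by blast
      obtain a n where ga: "g = (\<lambda>x. \<Sum>i\<le>n. a i * x^i)"
        using g by (auto simp: real_polynomial_function_iff_sum)
      have gi: "integrable \<mu> g" "integrable \<nu> g"
        unfolding ga using pow[OF fin(1) sets(1) supp(1)] pow[OF fin(2) sets(2) supp(2)] by simp_all
      have gg: "(\<integral>x. g x \<partial>\<mu>) = (\<integral>x. g x \<partial>\<nu>)"
        unfolding ga using pow[OF fin(1) sets(1) supp(1)] pow[OF fin(2) sets(2) supp(2)] mom by simp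
      have "\<bar>(\<integral>x. f x \<partial>\<mu>) - (\<integral>x. g x \<partial>\<mu>)\<bar> \<le> e * measure \<mu> (space \<mu>)"
        by (rule \<mu>.integral_approx[OF fi(1) gi(1) eventually_mono[OF supp(1)]]) (rule less_imp_le[OF fg])
      moreover have "\<bar>(\<integral>x. f x \<partial>\<nu>) - (\<integral>x. g x \<partial>\<nu>)\<bar> \<le> e * measure \<nu> (space \<nu>)"
        by (rule \<nu>.integral_approx[OF fi(2) gi(2) eventually_mono[OF supp(2)]]) (rule less_imp_le[OF fg])
      ultimately show ?thesis using gg by (auto simp: algebra_simps)
    qed
    note * = this
    have "(\<integral>x. f x \<partial>\<mu>) - (\<integral>x. f x \<partial>\<nu>) = 0"
    proof -
      let ?d = "\<bar>(\<integral>x. f x \<partial>\<mu>) - (\<integral>x. f x \<partial>\<nu>)\<bar>" and ?m = "measure \<mu> (space \<mu>) + measure \<nu> (space \<nu>)"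
      have m0: "0 \<le> ?m" by simp
      have "?d \<le> 0 + e" if "e > 0" for e
      proof -
        \<comment> \<open>The divisor \<open>?m + 1\<close> instead of \<open>?m\<close> also covers
          total mass zero.\<close>
        have "?d \<le> e / (?m + 1) * ?m" using that m0 by (intro *) (simp add: add_nonneg_pos)
        also have "\<dots> = e * (?m / (?m + 1))" by simp
        also have "\<dots> \<le> e * 1"
        proof (intro mult_left_mono)
          have "0 < ?m + 1" using m0 by linarith
          then show "?m / (?m + 1) \<le> 1" by (subst divide_le_eq_1_pos) auto
        qed (use that in simp)
        finally show ?thesis by simp
      qed
      then show ?thesis using field_le_epsilon[of ?d 0] by simp
    qed
    then show ?thesis by simp
  qed
  have meas: "measure \<mu> {x<..} = measure \<nu> {x<..}" for x
  proof -
    \<comment> \<open>For n > 0 a ramp that is 0 up to x and 1 from x + 1/n on.\<close>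
    define f where "f n y = min 1 (max 0 (real n * (y - x)))" for n y
    have lim: "(\<lambda>n. f n y) \<longlonglongrightarrow> indicator {x<..} y" for y
    proof (cases "x < y")
      case True
      then obtain N where N: "1 < real N * (y - x)" using reals_Archimedean3[of "y - x"] by auto
      have "f n y = 1" if "n \<ge> N" for n
      proof -
        have "real N * (y - x) \<le> real n * (y - x)" using that True by (intro mult_right_mono) auto
        then have "1 \<le> real n * (y - x)" using N by linarith
        then show ?thesis unfolding f_def by simp
      qed
      then have "(\<lambda>n. f n y) \<longlonglongrightarrow> 1"
        by (intro tendsto_eventually eventually_sequentiallyI[of N])
      then show ?thesis using True by simp
    next
      case False
      then have "real n * (y - x) \<le> 0" for n by (intro mult_nonneg_nonpos) auto
      then have "f n y = 0" for n unfolding f_def by (simp add: max_absorb1)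
      then show ?thesis using False by auto
    qed
    have [measurable]: "f n \<in> borel_measurable borel" for n unfolding f_def by measurable
    have fb: "\<bar>f n y\<bar> \<le> 1" for n y by (simp add: f_def)
    have fc: "continuous_on UNIV (f n)" for n unfolding f_def by (intro continuous_intros)
    have "(\<lambda>n. \<integral>y. f n y \<partial>\<mu>) \<longlonglongrightarrow> (\<integral>y. indicator {x<..} y \<partial>\<mu>)"
      by (rule integral_dominated_convergence[where w="\<lambda>_. 1"]) (simp_all add: lim fb)
    moreover have "(\<lambda>n. \<integral>y. f n y \<partial>\<nu>) \<longlonglongrightarrow> (\<integral>y. indicator {x<..} y \<partial>\<nu>)"
      by (rule integral_dominated_convergence[where w="\<lambda>_. 1"]) (simp_all add: lim fb)
    moreover have "(\<integral>y. f n y \<partial>\<mu>) = (\<integral>y. f n y \<partial>\<nu>)" for n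
      using fc fb by (rule cont)
    ultimately have "(\<integral>y. indicator {x<..} y \<partial>\<mu>) = (\<integral>y. indicator {x<..} y \<partial>\<nu> :: real)"
      by (simp add: LIMSEQ_unique)
    then show ?thesis using sets by (simp add: sets_eq_imp_space_eq)
  qed
  show ?thesis using sets meas
    by (intro measure_eqI_lessThan) (auto simp: \<mu>.emeasure_eq_measure \<nu>.emeasure_eq_measure)
qed

text \<open>The exchange of one coordinate. The numbers in \<open>mom\<close> are the moments of the
  image under \<open>Y\<close> (or \<open>Z\<close>) of the measure with density \<open>U\<close>
  (or \<open>V\<close>), so the two images coincide; the weights will carry the remaining
  coordinates.\<close>

lemma integral_indicator_eqI_moments:
  fixes Y U :: "'w \<Rightarrow> real" and Z V :: "'v \<Rightarrow> real"
  assumes M: "prob_space M" and N: "prob_space N"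
    and [measurable]: "Y \<in> borel_measurable M" "U \<in> borel_measurable M"
      "Z \<in> borel_measurable N" "V \<in> borel_measurable N"
    and Y: "AE x in M. Y x \<in> {0..1}" and Z: "AE x in N. Z x \<in> {0..1}"
    and U: "AE x in M. U x \<in> {0..1}" and V: "AE x in N. V x \<in> {0..1}"
    and mom: "\<And>k::nat. (\<integral>x. Y x ^ k * U x \<partial>M) = (\<integral>x. Z x ^ k * V x \<partial>N)"
    and B[measurable]: "B \<in> sets borel"
  shows "(\<integral>x. indicator B (Y x) * U x \<partial>M) = (\<integral>x. indicator B (Z x) * V x \<partial>N)"
proof -
  interpret M: prob_space M by fact
  interpret N: prob_space N by fact
  have fin: "finite_measure (distr (density Q U) borel Y)" if "prob_space Q" "U \<in> borel_measurable Q"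
    "Y \<in> borel_measurable Q" "AE x in Q. U x \<in> {0..1}"
    for Q and U Y :: "'z \<Rightarrow> real"
  proof -
    interpret prob_space Q by fact
    have [measurable]: "U \<in> borel_measurable Q" "Y \<in> borel_measurable Q" by fact+
    have "(\<integral>\<^sup>+x. ennreal (U x) \<partial>Q) \<le> (\<integral>\<^sup>+x. 1 \<partial>Q)"
      using that(4) by (intro nn_integral_mono_AE) (auto elim!: eventually_mono)
    then have "(\<integral>\<^sup>+x. ennreal (U x) \<partial>Q) < \<infinity>" by (simp add: emeasure_space_1 le_less_trans)
    moreover have "emeasure (distr (density Q U) borel Y) UNIV = (\<integral>\<^sup>+x. ennreal (U x) \<partial>Q)"
      by (simp add: emeasure_distr emeasure_density cong: nn_integral_cong)
    ultimately show ?thesis by (intro finite_measureI) auto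
  qed
  have int: "(\<integral>y. h y \<partial>distr (density Q U) borel Y) = (\<integral>x. h (Y x) * U x \<partial>Q)"
    if "U \<in> borel_measurable Q" "Y \<in> borel_measurable Q" "AE x in Q. U x \<in> {0..1}" "h \<in> borel_measurable borel"
    for Q and U Y :: "'z \<Rightarrow> real" and h :: "real \<Rightarrow> real"
  proof -
    have [measurable]: "U \<in> borel_measurable Q" "Y \<in> borel_measurable Q" "h \<in> borel_measurable borel" by fact+
    show ?thesis using that(3)
      by (simp add: integral_distr integral_density eventually_mono mult.commute)
  qed
  have AE: "AE y in distr (density Q U) borel Y. y \<in> {0..1}"
    if "U \<in> borel_measurable Q" "Y \<in> borel_measurable Q" "AE x in Q. Y x \<in> {0..1}"
    for Q and U Y :: "'z \<Rightarrow> real"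
    using that by (auto simp: AE_distr_iff AE_density simp del: atLeastAtMost_iff elim!: eventually_mono)
  have "distr (density M U) borel Y = distr (density N V) borel Z"
    by (intro finite_measure_eqI_moments fin AE) (use M N Y Z U V mom in \<open>auto simp: int\<close>)
  then have "(\<integral>y. indicator B y \<partial>distr (density M U) borel Y) = (\<integral>y. indicator B y \<partial>distr (density N V) borel Z :: real)"
    by (rule arg_cong)
  then show ?thesis using U V by (subst (asm) (1 2) int) auto
qed

lemma prod_unit_interval:
  fixes f :: "'i \<Rightarrow> real"
  assumes "\<And>i. i \<in> I \<Longrightarrow> f i \<in> {0..1}"
  shows "(\<Prod>i\<in>I. f i) \<in> {0..1}"
  using assms by (auto intro!: prod_nonneg prod_le_1)

text \<open>The powers are replaced by indicator functions one coordinate at a time.\<close>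

lemma distr_PiM_eqI_moments:
  fixes Y :: "'i \<Rightarrow> 'w \<Rightarrow> real" and Z :: "'i \<Rightarrow> 'v \<Rightarrow> real"
  assumes M: "prob_space M" and N: "prob_space N" and J: "finite J"
    and Ym[measurable]: "\<And>j. j \<in> J \<Longrightarrow> Y j \<in> borel_measurable M"
    and Zm[measurable]: "\<And>j. j \<in> J \<Longrightarrow> Z j \<in> borel_measurable N"
    and Y: "\<And>j. j \<in> J \<Longrightarrow> AE x in M. Y j x \<in> {0..1}" and Z: "\<And>j. j \<in> J \<Longrightarrow> AE x in N. Z j x \<in> {0..1}"
    and mom: "\<And>k::'i \<Rightarrow> nat. (\<integral>x. (\<Prod>j\<in>J. Y j x ^ k j) \<partial>M) = (\<integral>x. (\<Prod>j\<in>J. Z j x ^ k j) \<partial>N)"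
  shows "distr M (PiM J (\<lambda>_. borel)) (\<lambda>x. \<lambda>j\<in>J. Y j x) = distr N (PiM J (\<lambda>_. borel)) (\<lambda>x. \<lambda>j\<in>J. Z j x)"
proof -
  interpret M: prob_space M by fact
  interpret N: prob_space N by fact
  have AEY: "AE x in M. \<forall>j\<in>J. Y j x \<in> {0..1}" using J Y by (simp add: AE_finite_all)
  have AEZ: "AE x in N. \<forall>j\<in>J. Z j x \<in> {0..1}" using J Z by (simp add: AE_finite_all)
  have fin: "finite I" if "I \<subseteq> J" for I using that J by (rule finite_subset)
  have "(\<integral>x. (\<Prod>j\<in>I. indicator (B j) (Y j x)) * (\<Prod>j\<in>J - I. Y j x ^ k j) \<partial>M) =
     (\<integral>x. (\<Prod>j\<in>I. indicator (B j) (Z j x)) * (\<Prod>j\<in>J - I. Z j x ^ k j) \<partial>N)"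
    if "I \<subseteq> J" "\<And>i. i \<in> J \<Longrightarrow> B i \<in> sets borel" for I k and B :: "'i \<Rightarrow> real set"
    using fin[OF that(1)] that(1)
  proof (induction I arbitrary: k)
    case empty
    then show ?case using mom by simp
  next
    case (insert i I)
    have [measurable]: "i \<in> J \<Longrightarrow> B i \<in> sets borel" for i using that by auto
    have sub: "i \<in> J" "I \<subseteq> J" "J - I = insert i (J - insert i I)" using insert.prems insert.hyps by auto
    have im[measurable]: "Y i \<in> borel_measurable M" "Z i \<in> borel_measurable N" using sub by auto
    have IJ: "j \<in> I \<Longrightarrow> j \<in> J" for j using sub by auto
    note [simp] = insert.hyps J
    let ?U = "\<lambda>x. (\<Prod>j\<in>I. indicator (B j) (Y j x)) * (\<Prod>j\<in>J - insert i I. Y j x ^ k j) :: real"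
    let ?V = "\<lambda>x. (\<Prod>j\<in>I. indicator (B j) (Z j x)) * (\<Prod>j\<in>J - insert i I. Z j x ^ k j) :: real"
    have "(\<integral>x. indicator (B i) (Y i x) * ?U x \<partial>M) = (\<integral>x. indicator (B i) (Z i x) * ?V x \<partial>N)"
    proof (rule integral_indicator_eqI_moments[OF M N])
      show "?U \<in> borel_measurable M" "?V \<in> borel_measurable N" using IJ
        by (auto intro!: borel_measurable_times borel_measurable_prod borel_measurable_power measurable_compose[OF Ym] measurable_compose[OF Zm])
      have *: "a * b \<in> {0..1}" if "a \<in> {0..1}" "b \<in> {0..1}" for a b :: real
        using that by (auto intro: mult_le_one)
      have *: "(\<Prod>j\<in>I. indicator (B j) (f j)) * (\<Prod>j\<in>J - insert i I. f j ^ k j) \<in> {0..1}"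
        if "\<forall>j\<in>J. f j \<in> {0..1}" for f :: "'i \<Rightarrow> real"
        using that by (intro * prod_unit_interval) (auto simp: power_le_one indicator_def)
      show "AE x in M. ?U x \<in> {0..1}" using AEY by (rule eventually_mono) (rule *)
      show "AE x in N. ?V x \<in> {0..1}" using AEZ by (rule eventually_mono) (rule *)
      \<comment> \<open>The induction is over all exponents \<open>k\<close> at once because the
        exponent at \<open>i\<close> must be an arbitrary \<open>n\<close> here.\<close>
      show "(\<integral>x. Y i x ^ n * ?U x \<partial>M) = (\<integral>x. Z i x ^ n * ?V x \<partial>N)" for n
      proof -
        have *: "(\<Prod>j\<in>J - insert i I. h j ^ (k(i := n)) j) = (\<Prod>j\<in>J - insert i I. h j ^ k j)" for h :: "'i \<Rightarrow> real"
          by (intro prod.cong) auto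
        have **: "(\<Prod>j\<in>J - I. h j ^ (k(i := n)) j) = h i ^ n * (\<Prod>j\<in>J - insert i I. h j ^ k j)" for h :: "'i \<Rightarrow> real"
          unfolding sub(3) *[symmetric] using J by (subst prod.insert) auto
        show ?thesis using insert.IH[of "k(i := n)"] sub(2) unfolding ** by (simp add: mult.left_commute)
      qed
    qed (use Y Z sub(1) in auto)
    moreover have "(\<Prod>j\<in>insert i I. h j) = h i * (\<Prod>j\<in>I. h j)" for h :: "'i \<Rightarrow> real"
      using insert.hyps by simp
    ultimately show ?case by (simp only: mult.assoc)
  qed
  from this[of J] have eq: "(\<integral>x. (\<Prod>j\<in>J. indicator (B j) (Y j x)) \<partial>M) =
     (\<integral>x. (\<Prod>j\<in>J. indicator (B j) (Z j x)) \<partial>N :: real)" if "\<And>i. i \<in> J \<Longrightarrow> B i \<in> sets borel" for B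
    using that by simp
  have em: "emeasure (distr Q (PiM J (\<lambda>_. borel)) (\<lambda>x. \<lambda>j\<in>J. Y j x)) (Pi\<^sub>E J B) =
     ennreal (\<integral>x. (\<Prod>j\<in>J. indicator (B j) (Y j x)) \<partial>Q)" if "prob_space Q" "\<And>j. j \<in> J \<Longrightarrow> Y j \<in> borel_measurable Q"
    "\<And>i. i \<in> J \<Longrightarrow> B i \<in> sets borel" for Q B and Y :: "'i \<Rightarrow> 'z \<Rightarrow> real"
  proof -
    interpret prob_space Q by fact
    have [measurable]: "j \<in> J \<Longrightarrow> Y j \<in> borel_measurable Q" "j \<in> J \<Longrightarrow> B j \<in> sets borel" for j using that by auto
    have PB[measurable]: "Pi\<^sub>E J B \<in> sets (PiM J (\<lambda>_. borel))" using J that by (intro sets_PiM_I_finite) auto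
    have "(\<Prod>j\<in>J. indicator (B j) (Y j x)) = (indicator ((\<lambda>x. \<lambda>j\<in>J. Y j x) -` Pi\<^sub>E J B \<inter> space Q) x :: real)" if "x \<in> space Q" for x
      using J that by (auto simp: indicator_def prod_zero_iff PiE_iff split: if_splits)
    then have "(\<integral>x. (\<Prod>j\<in>J. indicator (B j) (Y j x)) \<partial>Q) = measure Q ((\<lambda>x. \<lambda>j\<in>J. Y j x) -` Pi\<^sub>E J B \<inter> space Q)"
      by (simp cong: Bochner_Integration.integral_cong)
    then show ?thesis by (subst emeasure_distr) (auto simp: emeasure_eq_measure intro!: measurable_restrict)
  qed
  show ?thesis
  proof (rule measure_eqI_PiM_finite[OF J])
    show "emeasure (distr M (PiM J (\<lambda>_. borel)) (\<lambda>x. \<lambda>j\<in>J. Y j x)) (Pi\<^sub>E J A) =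
      emeasure (distr N (PiM J (\<lambda>_. borel)) (\<lambda>x. \<lambda>j\<in>J. Z j x)) (Pi\<^sub>E J A)" if "\<And>i. i \<in> J \<Longrightarrow> A i \<in> sets borel" for A
      using that M N Ym Zm eq by (simp add: em)
    show "range (\<lambda>_::nat. Pi\<^sub>E J (\<lambda>_. UNIV)) \<subseteq> prod_algebra J (\<lambda>_. borel :: real measure)"
      using J by (auto intro!: prod_algebraI_finite)
    show "(\<Union>i::nat. Pi\<^sub>E J (\<lambda>_. UNIV)) = space (PiM J (\<lambda>_. borel :: real measure))" by (simp add: space_PiM)
    have "(\<lambda>x. \<lambda>j\<in>J. Y j x) \<in> measurable M (PiM J (\<lambda>_. borel))" by (auto intro!: measurable_restrict)
    then interpret D: prob_space "distr M (PiM J (\<lambda>_. borel)) (\<lambda>x. \<lambda>j\<in>J. Y j x)" by (rule M.prob_space_distr)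
    show "emeasure (distr M (PiM J (\<lambda>_. borel)) (\<lambda>x. \<lambda>j\<in>J. Y j x)) (Pi\<^sub>E J (\<lambda>_. UNIV)) \<noteq> \<infinity>" by simp
  qed simp_all
qed

text \<open>By \<open>mom\<close> the joint law and the product of the marginals have the same mixed
  moments, hence are equal.\<close>

lemma (in prob_space) indep_vars_moments:
  fixes Y :: "'i \<Rightarrow> 'a \<Rightarrow> real"
  assumes J: "finite J" and Ym: "\<And>j. j \<in> J \<Longrightarrow> Y j \<in> borel_measurable M"
    and Y: "\<And>j. j \<in> J \<Longrightarrow> AE x in M. Y j x \<in> {0..1}"
    and mom: "\<And>k::'i \<Rightarrow> nat. (\<integral>x. (\<Prod>j\<in>J. Y j x ^ k j) \<partial>M) = (\<Prod>j\<in>J. \<integral>x. Y j x ^ k j \<partial>M)"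
  shows "indep_vars (\<lambda>_. borel) Y J"
proof (cases "J = {}")
  case True
  then show ?thesis by (simp add: indep_vars_def indep_sets_def)
next
  case False
  \<comment> \<open>The point mass outside \<open>J\<close> only serves to make every
    \<open>D j\<close> a probability measure, as the product locale demands.\<close>
  define D where "D j = (if j \<in> J then distr M borel (Y j) else return borel 0)" for j
  have D: "prob_space (D j)" for j using Ym by (auto simp: D_def intro: prob_space_distr prob_space_return)
  interpret D: product_prob_space D J using D by (rule product_prob_spaceI)
  interpret D: finite_product_prob_space D J by unfold_locales (rule J)
  have sD[measurable_cong]: "sets (D j) = sets borel" for j by (simp add: D_def)
  have comp[measurable]: "j \<in> J \<Longrightarrow> (\<lambda>x. x j) \<in> borel_measurable (PiM J D)" for j
    by simp
  have pw: "(\<integral>y. y ^ k \<partial>D j) = (\<integral>x. Y j x ^ k \<partial>M)" if "j \<in> J" for j k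
    using that Ym by (simp add: D_def integral_distr)
  have bd: "AE y in D j. y \<in> {0..1}" if "j \<in> J" for j using that Ym Y[OF that] by (simp only: D_def if_True) (subst AE_distr_iff, auto)
  have int: "integrable (D j) (\<lambda>y. y ^ k)" if "j \<in> J" for j k
  proof -
    have "finite_measure (D j)" using D by (rule prob_space.finite_measure)
    moreover have "AE y in D j. norm (y ^ k) \<le> 1"
      using bd[OF that] by (rule eventually_mono) (auto simp: power_le_one)
    moreover have "(\<lambda>y. y ^ k) \<in> borel_measurable (D j)"
      by (simp add: measurable_cong_sets[OF sD refl])
    ultimately show ?thesis by (rule finite_measure.integrable_const_bound)
  qed
  have "distr M (PiM J (\<lambda>_. borel)) (\<lambda>x. \<lambda>j\<in>J. Y j x) = distr (PiM J D) (PiM J (\<lambda>_. borel)) (\<lambda>x. \<lambda>j\<in>J. x j)"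
  proof (rule distr_PiM_eqI_moments)
    show "prob_space M" by unfold_locales
    show "prob_space (PiM J D)" by unfold_locales
    show "AE x in PiM J D. x j \<in> {0..1}" if "j \<in> J" for j
      using that bd[OF that] by (rule D.AE_component)
    show "(\<integral>x. (\<Prod>j\<in>J. Y j x ^ k j) \<partial>M) = (\<integral>x. (\<Prod>j\<in>J. x j ^ k j) \<partial>PiM J D)" for k
      by (subst D.product_integral_prod[OF J]) (simp_all add: mom[of k] pw int)
  qed (use J Ym Y comp in auto)
  also have "\<dots> = distr (PiM J D) (PiM J D) (\<lambda>x. x)"
    by (intro distr_cong sets_PiM_cong) (simp_all add: sD space_PiM PiE_restrict)
  also have "\<dots> = PiM J D" by (rule distr_id)
  also have "\<dots> = PiM J (\<lambda>j. distr M borel (Y j))" by (intro PiM_cong) (auto simp: D_def)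
  finally show ?thesis using False Ym by (simp add: indep_vars_iff_distr_eq_PiM')
qed

section \<open>Poisson point processes\<close>

text \<open>The function exp(-x) on [0,\<infinity>], continuous at \<infinity> with value 0. Being
  bounded, it can be integrated along random sums that are not yet known to be finite.\<close>

definition nexp :: "ennreal \<Rightarrow> real" where
  "nexp x = (if x = \<top> then 0 else exp (- enn2real x))"

lemma nexp_top [simp]: "nexp \<top> = 0" and nexp_0 [simp]: "nexp 0 = 1"
  by (simp_all add: nexp_def)

lemma nexp_ennreal [simp]: "0 \<le> x \<Longrightarrow> nexp (ennreal x) = exp (- x)"
  by (simp add: nexp_def)

lemma nexp_nonneg [simp]: "0 \<le> nexp x" and nexp_le_1 [simp]: "nexp x \<le> 1"
  by (simp_all add: nexp_def)

lemma nexp_less_1_iff [simp]: "nexp x < 1 \<longleftrightarrow> x \<noteq> 0"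
  by (cases x) (auto simp: ennreal_eq_0_iff)

lemma nexp_eq_0_iff [simp]: "nexp x = 0 \<longleftrightarrow> x = \<top>"
  by (simp add: nexp_def)

lemma nexp_antimono: "x \<le> y \<Longrightarrow> nexp y \<le> nexp x"
  by (cases x; cases y) (auto simp: top_unique)

lemma nexp_add: "nexp (x + y) = nexp x * nexp y"
  by (cases x; cases y) (auto simp: ennreal_plus[symmetric] exp_add[symmetric] simp del: ennreal_plus)

lemma nexp_sum: "nexp (\<Sum>i\<in>I. f i) = (\<Prod>i\<in>I. nexp (f i))"
  by (induction I rule: infinite_finite_induct) (auto simp: nexp_add)

lemma nexp_power: "nexp x ^ k = nexp (of_nat k * x)"
  by (induction k) (auto simp: nexp_add algebra_simps)

lemma measurable_nexp [measurable]: "nexp \<in> borel_measurable borel"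
  unfolding nexp_def[abs_def] by measurable

lemma tendsto_nexp:
  assumes "(f \<longlongrightarrow> x) F" shows "((\<lambda>n. nexp (f n)) \<longlongrightarrow> nexp x) F"
proof (cases x)
  case (real r)
  then have "x < \<top>" by simp
  then have ev: "eventually (\<lambda>n. f n < \<top>) F" using assms by (rule order_tendstoD(2)[rotated])
  have "((\<lambda>n. exp (- enn2real (f n))) \<longlongrightarrow> exp (- r)) F"
    using assms real by (intro tendsto_intros tendsto_enn2real) auto
  then show ?thesis using real ev
    by (auto elim!: Lim_transform_eventually eventually_mono simp: nexp_def)
next
  case top
  show ?thesis unfolding top nexp_top
  proof (rule tendstoI)
    fix e :: real assume e: "e > 0"
    have "eventually (\<lambda>n. ennreal \<bar>ln e\<bar> < f n) F"
      using assms[unfolded top] by (rule order_tendstoD) simp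
    then show "eventually (\<lambda>n. dist (nexp (f n)) 0 < e) F"
    proof eventually_elim
      case (elim n)
      show ?case
      proof (cases "f n")
        case (real r)
        then have "\<bar>ln e\<bar> < r" using elim by (simp add: ennreal_less_iff)
        then have "exp (- r) < exp (ln e)" by (subst exp_less_cancel_iff) linarith
        then show ?thesis using real e by simp
      qed (use e in simp)
    qed
  qed
qed

abbreviation poisson_exponent :: "'b measure \<Rightarrow> ('b \<Rightarrow> ennreal) \<Rightarrow> ennreal" where
  "poisson_exponent \<nu> f \<equiv> \<integral>\<^sup>+x. ennreal (1 - nexp (f x)) \<partial>\<nu>"

text \<open>The sum of \<open>f\<close> over the points of the process. Written as an integral
  against counting measure, it inherits linearity and monotone convergence in
  \<open>f\<close>.\<close>

definition psum :: "('v \<Rightarrow> enat) \<Rightarrow> (nat \<Rightarrow> 'v \<Rightarrow> 'b) \<Rightarrow> ('b \<Rightarrow> ennreal) \<Rightarrow> 'v \<Rightarrow> ennreal" where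
  "psum T X f w = (\<integral>\<^sup>+i. (if enat i < T w then f (X i w) else 0) \<partial>count_space UNIV)"

lemma point_count_eq_psum: "point_count T X B = psum T X (indicator B)"
proof
  fix w
  have "point_count T X B w = (\<integral>\<^sup>+i. indicator {i. enat i < T w \<and> X i w \<in> B} i \<partial>count_space UNIV)"
    by (simp add: point_count_def)
  also have "\<dots> = psum T X (indicator B) w"
    unfolding psum_def by (intro nn_integral_cong) (auto simp: indicator_def)
  finally show "point_count T X B w = psum T X (indicator B) w" .
qed

lemma psum_cong:
  "(\<And>i. f (X i w) = g (X i w)) \<Longrightarrow> psum T X f w = psum T X g w"
  unfolding psum_def by (intro nn_integral_cong) auto

lemma psum_cmult: "psum T X (\<lambda>x. c * f x) w = c * psum T X f w"
  unfolding psum_def by (subst nn_integral_cmult[symmetric]) (auto intro!: nn_integral_cong)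

lemma psum_add: "psum T X (\<lambda>x. f x + g x) w = psum T X f w + psum T X g w"
  unfolding psum_def by (subst nn_integral_add[symmetric]) (auto intro!: nn_integral_cong)

lemma psum_sum: "psum T X (\<lambda>x. \<Sum>a\<in>A. f a x) w = (\<Sum>a\<in>A. psum T X (f a) w)"
  unfolding psum_def by (subst nn_integral_sum[symmetric]) (auto intro!: nn_integral_cong)

lemma measurable_psum [measurable]:
  assumes [measurable]: "T \<in> measurable P (count_space UNIV)" "\<And>i. X i \<in> measurable P \<nu>" "f \<in> borel_measurable \<nu>"
  shows "psum T X f \<in> borel_measurable P"
  unfolding psum_def[abs_def] nn_integral_count_space_nat by measurable

lemma psum_LIMSEQ:
  assumes "incseq f" "(SUP n. f n) = g"
  shows "(\<lambda>n. psum T X (f n) w) \<longlonglongrightarrow> psum T X g w"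
proof -
  let ?h = "\<lambda>n i. if enat i < T w then f n (X i w) else 0"
  have inc: "incseq ?h" using assms(1) by (auto simp: incseq_def le_fun_def)
  have "psum T X g w = (\<integral>\<^sup>+i. (SUP n. ?h n i) \<partial>count_space UNIV)"
    unfolding psum_def assms(2)[symmetric] by (intro nn_integral_cong) (auto simp: SUP_apply image_comp)
  also have "\<dots> = (SUP n. psum T X (f n) w)"
    unfolding psum_def by (subst nn_integral_monotone_convergence_SUP[OF inc]) auto
  finally have eq: "psum T X g w = (SUP n. psum T X (f n) w)" .
  have "incseq (\<lambda>n. psum T X (f n) w)" unfolding psum_def using inc
    by (auto simp: incseq_def le_fun_def intro!: nn_integral_mono)
  then show ?thesis unfolding eq by (rule LIMSEQ_SUP)
qed

section \<open>The Laplace functional of a Poisson process\<close>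

lemma poisson_generating_sums:
  fixes r s :: real
  shows "(\<lambda>k. exp (- r) * r ^ k / fact k * s ^ k) sums exp (- (r * (1 - s)))"
proof -
  have "(\<lambda>k. exp (- r) * ((r * s) ^ k /\<^sub>R fact k)) sums (exp (- r) * exp (r * s))"
    by (intro sums_mult exp_converges)
  then show ?thesis by (simp add: exp_add[symmetric] algebra_simps power_mult_distrib divide_inverse)
qed

text \<open>\<open>N\<close> may take any value in [0,\<infinity>], but the prescribed point
  probabilities already sum to 1, so \<open>N\<close> is almost surely a natural number and the
  Poisson generating function at \<open>nexp a\<close> gives the integral.\<close>

lemma integral_nexp_poisson:
  assumes "prob_space P" and N[measurable]: "N \<in> borel_measurable P" and r: "0 \<le> r"
    and pois: "\<And>k::nat. measure P {w \<in> space P. N w = of_nat k} = exp (- r) * r ^ k / fact k"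
    and a: "a < \<top>"
  shows "(\<integral>w. nexp (a * N w) \<partial>P) = exp (- (r * (1 - nexp a)))"
proof -
  interpret prob_space P by fact
  let ?E = "\<lambda>k::nat. {w \<in> space P. N w = of_nat k}"
  have E[measurable]: "?E k \<in> sets P" for k by measurable
  have s1: "(\<lambda>k. measure P (?E k)) sums 1"
    using poisson_generating_sums[of r 1] by (simp add: pois)
  have disj: "disjoint_family ?E" by (auto simp: disjoint_family_on_def)
  have "(\<lambda>k. measure P (?E k)) sums measure P (\<Union>k. ?E k)"
    using disj by (intro finite_measure_UNION) auto
  then have "prob (\<Union>k. ?E k) = 1" using s1 sums_unique2 by blast
  then have AE: "AE w in P. w \<in> (\<Union>k. ?E k)" by (subst (asm) prob_eq_1) auto
  have "(\<integral>\<^sup>+w. ennreal (nexp (a * N w)) \<partial>P) = (\<integral>\<^sup>+w. (\<Sum>k. ennreal (nexp a ^ k) * indicator (?E k) w) \<partial>P)"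
  proof (intro nn_integral_cong_AE, use AE in eventually_elim)
    case (elim w)
    then obtain k where k: "w \<in> ?E k" by blast
    have "(\<Sum>j. ennreal (nexp a ^ j) * indicator (?E j) w) = (\<Sum>j. if j = k then ennreal (nexp a ^ k) else 0)"
      using k by (intro suminf_cong) auto
    also have "\<dots> = ennreal (nexp a ^ k)" by (intro sums_unique[symmetric] sums_single)
    finally show ?case using k by (simp add: nexp_power mult.commute)
  qed
  also have "\<dots> = (\<Sum>k. ennreal (nexp a ^ k) * emeasure P (?E k))"
    by (subst nn_integral_suminf) (auto simp: nn_integral_cmult)
  also have "\<dots> = (\<Sum>k. ennreal (exp (- r) * r ^ k / fact k * nexp a ^ k))"
    by (simp add: emeasure_eq_measure pois ennreal_mult'[symmetric] mult.commute)
  also have "\<dots> = ennreal (exp (- (r * (1 - nexp a))))"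
    using r by (intro suminf_ennreal_eq poisson_generating_sums) auto
  finally show ?thesis by (intro integral_eq_nn_integral[THEN trans]) auto
qed

text \<open>The level sets of \<open>f\<close> are disjoint and finite in number, so their counts
  are independent Poisson variables and the functional factorises into one-dimensional
  transforms.\<close>

lemma poisson_point_process_laplace_simple:
  assumes PP: "poisson_point_process P \<nu> T X" and f: "simple_function \<nu> f"
    and top: "\<And>x. f x < \<top>" and fin: "(poisson_exponent \<nu> f) < \<infinity>"
  shows "(\<integral>w. nexp (psum T X f w) \<partial>P) = nexp (poisson_exponent \<nu> f)"
proof -
  have P: "prob_space P" and T[measurable]: "T \<in> measurable P (count_space UNIV)"
    and X[measurable]: "\<And>i. X i \<in> measurable P \<nu>"
    and pois: "\<And>B k. B \<in> sets \<nu> \<Longrightarrow> emeasure \<nu> B < \<infinity> \<Longrightarrow>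
       measure P {w \<in> space P. point_count T X B w = of_nat k} = exp (- measure \<nu> B) * measure \<nu> B ^ k / fact k"
    and ind: "\<And>n B. (\<forall>i<n. B i \<in> sets \<nu>) \<and> disjoint_family_on B {..<n} \<Longrightarrow>
        prob_space.indep_vars P (\<lambda>_. borel) (\<lambda>i. point_count T X (B i)) {..<n::nat}"
    using PP unfolding poisson_point_process_def complete_prob_space_def by auto
  interpret prob_space P by fact
  define A where "A = f ` space \<nu>"
  define B where "B a = f -` {a} \<inter> space \<nu>" for a
  define N where "N a = point_count T X (B a)" for a
  have finA: "finite A" using f by (simp add: A_def simple_function_def)
  have Bm[measurable]: "B a \<in> sets \<nu>" for a
  proof (cases "a \<in> A")
    case True then show ?thesis using f by (auto simp: A_def B_def simple_function_def)
  next
    case False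
    then have "B a = {}" by (auto simp: A_def B_def)
    then show ?thesis by simp
  qed
  have Nm[measurable]: "N a \<in> borel_measurable P" for a unfolding N_def point_count_eq_psum by measurable
  have Atop: "a \<in> A \<Longrightarrow> a < \<top>" for a using top by (auto simp: A_def)
  have dec: "g (f x) = (\<Sum>a\<in>A. g a * indicator (B a) x)" if "x \<in> space \<nu>" for x and g :: "ennreal \<Rightarrow> ennreal"
  proof -
    have "(\<Sum>a\<in>A. g a * indicator (B a) x) = (\<Sum>a\<in>A. if a = f x then g (f x) else 0)"
      using that by (intro sum.cong) (auto simp: B_def indicator_def)
    then show ?thesis using that finA by (simp add: A_def)
  qed
  have ps: "psum T X f w = (\<Sum>a\<in>A. a * N a w)" if "w \<in> space P" for w
  proof -
    have "psum T X f w = psum T X (\<lambda>x. \<Sum>a\<in>A. a * indicator (B a) x) w"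
      using measurable_space[OF X that] dec[of _ "\<lambda>x. x"] by (intro psum_cong) auto
    then show ?thesis by (simp add: psum_sum psum_cmult N_def point_count_eq_psum)
  qed
  have int: "(poisson_exponent \<nu> f) = (\<Sum>a\<in>A. ennreal (1 - nexp a) * emeasure \<nu> (B a))"
  proof -
    have "(poisson_exponent \<nu> f) = (\<integral>\<^sup>+x. (\<Sum>a\<in>A. ennreal (1 - nexp a) * indicator (B a) x) \<partial>\<nu>)"
      using dec[of _ "\<lambda>a. ennreal (1 - nexp a)"] by (intro nn_integral_cong) auto
    then show ?thesis by (simp add: nn_integral_sum nn_integral_cmult)
  qed
  \<comment> \<open>The level set of 0 is excluded: it may have infinite measure, but it contributes
    the factor 1.\<close>
  have finB: "emeasure \<nu> (B a) < \<infinity>" if "a \<in> A" "a \<noteq> 0" for a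
  proof -
    have "ennreal (1 - nexp a) * emeasure \<nu> (B a) \<le> (poisson_exponent \<nu> f)"
      unfolding int using finA that by (intro member_le_sum) auto
    then have "ennreal (1 - nexp a) * emeasure \<nu> (B a) < \<top>" using fin by (simp add: le_less_trans)
    moreover have "ennreal (1 - nexp a) \<noteq> 0" using that nexp_less_1_iff[of a] by (simp add: ennreal_eq_0_iff not_le)
    ultimately show ?thesis by (auto simp: ennreal_mult_less_top top.not_eq_extremum)
  qed
  \<comment> \<open>Independence of counts is stated for families indexed by \<open>{..<n}\<close>,
    hence the numbering of the values.\<close>
  obtain h where h: "bij_betw h {..<card A} A"
    using finA by (metis bij_betw_from_nat_into_finite ex_bij_betw_nat_finite atLeast0LessThan)
  have inj: "inj_on h {..<card A}" and hA: "i < card A \<Longrightarrow> h i \<in> A" for i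
    using h by (auto simp: bij_betw_def)
  have iv: "indep_vars (\<lambda>_. borel) (\<lambda>i. N (h i)) {..<card A}"
    unfolding N_def
  proof (intro ind conjI allI impI Bm)
    show "disjoint_family_on (\<lambda>i. B (h i)) {..<card A}"
      by (auto simp: disjoint_family_on_def B_def inj_on_eq_iff[OF inj])
  qed
  have iv: "indep_vars (\<lambda>_. borel) (\<lambda>i w. nexp (h i * N (h i) w)) {..<card A}"
    using indep_vars_compose2[OF iv, of "\<lambda>i x. nexp (h i * x)" "\<lambda>_. borel"] by simp
  have one: "(\<integral>w. nexp (a * N a w) \<partial>P) = exp (- ((1 - nexp a) * measure \<nu> (B a)))" if "a \<in> A" for a
  proof (cases "a = 0")
    case True then show ?thesis by (simp add: prob_space)
  next
    case False
    show ?thesis using pois[OF Bm finB[OF that False]] Atop[OF that]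
      by (subst integral_nexp_poisson[where r="measure \<nu> (B a)"]) (auto simp: N_def[symmetric] mult.commute P)
  qed
  have "(\<integral>w. nexp (psum T X f w) \<partial>P) = (\<integral>w. (\<Prod>i<card A. nexp (h i * N (h i) w)) \<partial>P)"
    by (intro Bochner_Integration.integral_cong)
       (auto simp: ps nexp_sum prod.reindex_bij_betw[OF h, of "\<lambda>a. nexp (a * N a _)"])
  also have "\<dots> = (\<Prod>i<card A. \<integral>w. nexp (h i * N (h i) w) \<partial>P)"
    by (intro indep_vars_lebesgue_integral iv) (auto intro!: integrable_const_bound[of _ 1])
  also have "\<dots> = (\<Prod>i<card A. exp (- ((1 - nexp (h i)) * measure \<nu> (B (h i)))))"
    using hA by (intro prod.cong) (auto simp: one)
  also have "\<dots> = (\<Prod>a\<in>A. exp (- ((1 - nexp a) * measure \<nu> (B a))))"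
    by (rule prod.reindex_bij_betw[OF h])
  also have "\<dots> = (\<Prod>a\<in>A. nexp (ennreal (1 - nexp a) * emeasure \<nu> (B a)))"
  proof (intro prod.cong refl)
    fix a assume a: "a \<in> A"
    show "exp (- ((1 - nexp a) * measure \<nu> (B a))) = nexp (ennreal (1 - nexp a) * emeasure \<nu> (B a))"
    proof (cases "a = 0")
      case False
      have "emeasure \<nu> (B a) = ennreal (measure \<nu> (B a))"
        using finB[OF a False] by (intro emeasure_eq_ennreal_measure) auto
      then show ?thesis by (simp add: ennreal_mult'[symmetric])
    qed simp
  qed
  also have "\<dots> = nexp (poisson_exponent \<nu> f)"
    by (simp add: int nexp_sum)
  finally show ?thesis .
qed

text \<open>Both sides pass to the limit along increasing simple functions, the left by dominated
  and the right by monotone convergence; the exponents of the approximations stay below that of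
  \<open>f\<close>, hence finite.\<close>

lemma poisson_point_process_laplace:
  assumes PP: "poisson_point_process P \<nu> T X" and f[measurable]: "f \<in> borel_measurable \<nu>"
    and fin: "(poisson_exponent \<nu> f) < \<infinity>"
  shows "(\<integral>w. nexp (psum T X f w) \<partial>P) = nexp (poisson_exponent \<nu> f)"
proof -
  have P: "prob_space P" and T[measurable]: "T \<in> measurable P (count_space UNIV)"
    and X[measurable]: "\<And>i. X i \<in> measurable P \<nu>"
    using PP unfolding poisson_point_process_def complete_prob_space_def by auto
  interpret prob_space P by fact
  obtain g where g: "\<And>i. simple_function \<nu> (g i)" "incseq g" "\<And>i x. g i x < \<top>" "\<And>x. (SUP i. g i x) = f x"
    using borel_measurable_implies_simple_function_sequence'[OF f] by metis
  have [measurable]: "g i \<in> borel_measurable \<nu>" for i using g(1) by (rule borel_measurable_simple_function)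
  have glim: "(\<lambda>n. g n x) \<longlonglongrightarrow> f x" for x
    using LIMSEQ_SUP[of "\<lambda>n. g n x"] g(2,4) by (auto simp: incseq_def le_fun_def)
  have gle: "g n x \<le> f x" for n x using g(4)[of x] by (metis SUP_upper UNIV_I)
  have int_le: "(\<integral>\<^sup>+x. ennreal (1 - nexp (g n x)) \<partial>\<nu>) \<le> (poisson_exponent \<nu> f)" for n
    by (intro nn_integral_mono ennreal_leI) (auto intro!: nexp_antimono gle)
  have l1: "(\<lambda>n. \<integral>w. nexp (psum T X (g n) w) \<partial>P) \<longlonglongrightarrow> (\<integral>w. nexp (psum T X f w) \<partial>P)"
    using g(2,4) by (intro integral_dominated_convergence[where w="\<lambda>_. 1"] AE_I2 tendsto_nexp psum_LIMSEQ)
      (auto simp: fun_eq_iff image_image)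
  have "(\<lambda>n. \<integral>\<^sup>+x. ennreal (1 - nexp (g n x)) \<partial>\<nu>) \<longlonglongrightarrow> (poisson_exponent \<nu> f)"
  proof (rule nn_integral_LIMSEQ)
    show "incseq (\<lambda>n x. ennreal (1 - nexp (g n x)))" using g(2)
      by (auto simp: incseq_def le_fun_def intro!: ennreal_leI nexp_antimono)
    show "(\<lambda>n. ennreal (1 - nexp (g n x))) \<longlonglongrightarrow> ennreal (1 - nexp (f x))" for x
      by (intro tendsto_ennrealI tendsto_intros tendsto_nexp glim)
  qed measurable
  then have "(\<lambda>n. nexp (\<integral>\<^sup>+x. ennreal (1 - nexp (g n x)) \<partial>\<nu>)) \<longlonglongrightarrow> nexp (poisson_exponent \<nu> f)"
    by (rule tendsto_nexp)
  moreover have "(\<integral>w. nexp (psum T X (g n) w) \<partial>P) = nexp (\<integral>\<^sup>+x. ennreal (1 - nexp (g n x)) \<partial>\<nu>)" for n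
    using PP g int_le[of n] fin by (intro poisson_point_process_laplace_simple) (auto simp: le_less_trans)
  ultimately show ?thesis using l1 LIMSEQ_unique by simp
qed

section \<open>Recognising a Poisson process by its Laplace functional\<close>

lemma distr_eqI_moments:
  fixes Y :: "'w \<Rightarrow> real" and Z :: "'v \<Rightarrow> real"
  assumes M: "prob_space M" and N: "prob_space N"
    and [measurable]: "Y \<in> borel_measurable M" "Z \<in> borel_measurable N"
    and Y: "\<And>x. Y x \<in> {0..1}" and Z: "\<And>x. Z x \<in> {0..1}"
    and mom: "\<And>k::nat. (\<integral>x. Y x ^ k \<partial>M) = (\<integral>x. Z x ^ k \<partial>N)"
  shows "distr M borel Y = distr N borel Z"
proof (rule finite_measure_eqI_moments)
  show "finite_measure (distr M borel Y)" "finite_measure (distr N borel Z)"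
    using M N by (auto intro!: prob_space.finite_measure prob_space.prob_space_distr)
  show "AE x in distr M borel Y. x \<in> {0..1}" by (subst AE_distr_iff) (use Y in auto)
  show "AE x in distr N borel Z. x \<in> {0..1}" by (subst AE_distr_iff) (use Z in auto)
qed (auto simp: integral_distr mom)

text \<open>The Poisson law with rate 0 included, as needed for pieces of measure zero.\<close>

definition poisson0_pmf :: "real \<Rightarrow> nat pmf" where
  "poisson0_pmf r = (if 0 < r then poisson_pmf r else return_pmf 0)"

lemma pmf_poisson0: "0 \<le> r \<Longrightarrow> pmf (poisson0_pmf r) k = exp (- r) * r ^ k / fact k"
  by (cases "r = 0"; cases k) (auto simp: poisson0_pmf_def)

lemma integral_power_poisson0:
  assumes r: "0 \<le> r" and s: "0 \<le> s" "s \<le> 1"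
  shows "(\<integral>k. s ^ k \<partial>measure_pmf (poisson0_pmf r)) = exp (- (r * (1 - s)))"
proof -
  define a where "a = (if s = 0 then \<top> else ennreal (- ln s))"
  have na: "s = nexp a" using s by (auto simp: a_def)
  have "(\<integral>\<^sup>+k. ennreal (s ^ k) \<partial>measure_pmf (poisson0_pmf r)) = (\<Sum>k. ennreal (exp (- r) * r ^ k / fact k * s ^ k))"
    using s r by (simp add: nn_integral_measure_pmf nn_integral_count_space_nat pmf_poisson0 ennreal_mult'[symmetric])
  also have "\<dots> = ennreal (exp (- (r * (1 - s))))"
    using r s by (intro suminf_ennreal_eq poisson_generating_sums) auto
  finally show ?thesis using s by (intro integral_eq_nn_integral[THEN trans]) auto
qed

text \<open>Every clause of the definition is a special choice of \<open>f\<close>. Integer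
  multiples of one indicator give all moments of \<open>nexp\<close> of a count, hence its law; on a
  set of infinite measure the transform is 0, which forces an infinite count; combinations of
  disjoint indicators give the mixed moments behind independence.\<close>

lemma poisson_point_processI_laplace:
  assumes P: "complete_prob_space P" and T[measurable]: "T \<in> measurable P (count_space UNIV)"
    and X[measurable]: "\<And>i. X i \<in> measurable P \<nu>"
    and lap: "\<And>f. f \<in> borel_measurable \<nu> \<Longrightarrow>
       (\<integral>w. nexp (psum T X f w) \<partial>P) = nexp (poisson_exponent \<nu> f)"
  shows "poisson_point_process P \<nu> T X"
proof -
  have P': "prob_space P" using P by (simp add: complete_prob_space_def)
  interpret prob_space P by fact
  have Nm[measurable]: "point_count T X B \<in> borel_measurable P" if [measurable]: "B \<in> sets \<nu>" for B
    unfolding point_count_eq_psum by measurable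
  have ind: "(\<integral>\<^sup>+x. ennreal (1 - nexp (c * indicator B x)) \<partial>\<nu>) = ennreal (1 - nexp c) * emeasure \<nu> B"
    if [measurable]: "B \<in> sets \<nu>" for B c
  proof -
    have "(\<integral>\<^sup>+x. ennreal (1 - nexp (c * indicator B x)) \<partial>\<nu>) = (\<integral>\<^sup>+x. ennreal (1 - nexp c) * indicator B x \<partial>\<nu>)"
      by (intro nn_integral_cong) (auto simp: indicator_def)
    then show ?thesis by (simp add: nn_integral_cmult)
  qed
  have lapB: "(\<integral>w. nexp (c * point_count T X B w) \<partial>P) = nexp (ennreal (1 - nexp c) * emeasure \<nu> B)"
    if [measurable]: "B \<in> sets \<nu>" for B c
    using lap[of "\<lambda>x. c * indicator B x"] by (simp add: ind psum_cmult point_count_eq_psum)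
  have "measure P {w \<in> space P. point_count T X B w = of_nat k} = exp (- measure \<nu> B) * measure \<nu> B ^ k / fact k"
    if [measurable]: "B \<in> sets \<nu>" and fin: "emeasure \<nu> B < \<infinity>" for B k
  proof -
    let ?p = "measure_pmf (poisson0_pmf (measure \<nu> B))"
    have em: "emeasure \<nu> B = ennreal (measure \<nu> B)" using fin by (intro emeasure_eq_ennreal_measure) auto
    have D: "distr P borel (\<lambda>w. nexp (point_count T X B w)) = distr ?p borel (\<lambda>n. exp (- real n))"
    proof (rule distr_eqI_moments)
      fix k :: nat
      have "(\<integral>w. nexp (point_count T X B w) ^ k \<partial>P) = exp (- (measure \<nu> B * (1 - exp (- real k))))"
        using lapB[OF that(1), of "of_nat k"] nexp_ennreal[of "real k"]
        by (simp add: nexp_power em ennreal_mult'[symmetric] mult.commute ennreal_of_nat_eq_real_of_nat del: nexp_ennreal)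
           (simp add: ennreal_of_nat_eq_real_of_nat)
      also have "\<dots> = (\<integral>n. exp (- real k) ^ n \<partial>?p)"
        by (subst integral_power_poisson0) auto
      also have "\<dots> = (\<integral>n. exp (- real n) ^ k \<partial>?p)"
        by (simp add: exp_of_nat_mult[symmetric] mult.commute)
      finally show "(\<integral>w. nexp (point_count T X B w) ^ k \<partial>P) = (\<integral>n. exp (- real n) ^ k \<partial>?p)" .
    qed (auto simp: measure_pmf.prob_space_axioms P')
    have inj: "nexp x = exp (- real k) \<longleftrightarrow> x = of_nat k" for x
      by (cases x) (auto simp: ennreal_of_nat_eq_real_of_nat)
    have "measure P {w \<in> space P. point_count T X B w = of_nat k} =
       measure (distr P borel (\<lambda>w. nexp (point_count T X B w))) {exp (- real k)}"
      by (subst measure_distr) (auto intro!: arg_cong[where f="measure P"] simp: inj)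
    also have "\<dots> = measure ?p {k}"
      unfolding D by (subst measure_distr) (auto intro!: arg_cong[where f="measure _"])
    finally show ?thesis by (simp add: measure_pmf_single pmf_poisson0)
  qed
  moreover have "AE w in P. point_count T X B w = \<infinity>" if [measurable]: "B \<in> sets \<nu>" and inf: "emeasure \<nu> B = \<infinity>" for B
  proof -
    have "ennreal (1 - nexp 1) \<noteq> 0" using nexp_less_1_iff[of 1] by (simp add: ennreal_eq_0_iff not_le)
    then have "(\<integral>w. nexp (point_count T X B w) \<partial>P) = 0"
      using lapB[OF that(1), of 1] inf by (simp add: ennreal_mult_top)
    then have "AE w in P. nexp (point_count T X B w) = 0"
      by (subst (asm) integral_nonneg_eq_0_iff_AE) (auto intro!: integrable_const_bound[of _ 1])
    then show ?thesis by simp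
  qed
  moreover have "indep_vars (\<lambda>_. borel) (\<lambda>i. point_count T X (B i)) {..<n}"
    if B: "\<forall>i<n. B i \<in> sets \<nu>" and disj: "disjoint_family_on B {..<n}" for n :: nat and B
  proof -
    have [measurable]: "i < n \<Longrightarrow> B i \<in> sets \<nu>" for i using B by simp
    have "indep_vars (\<lambda>_. borel) (\<lambda>i w. nexp (point_count T X (B i) w)) {..<n}"
    proof (rule indep_vars_moments)
      fix k :: "nat \<Rightarrow> nat"
      \<comment> \<open>At most one summand is non-zero at \<open>x\<close>, and on such sums
        \<open>1 - nexp\<close> is additive. This is how disjointness turns into factorising
        moments.\<close>
      have eq: "1 - nexp (\<Sum>i<n. of_nat (k i) * indicator (B i) x) = (\<Sum>i<n. 1 - nexp (of_nat (k i) * indicator (B i) x))" for x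
      proof (cases "\<exists>i<n. x \<in> B i")
        case True
        then obtain i where i: "i < n" "x \<in> B i" by blast
        have "indicator (B j) x = (if j = i then 1 else 0 :: ennreal)" if "j < n" for j
          using that i disj by (auto simp: disjoint_family_on_def indicator_def)
        then have "(\<Sum>i<n. of_nat (k i) * indicator (B i) x :: ennreal) = (\<Sum>j<n. if j = i then of_nat (k i) else 0)"
          "(\<Sum>i<n. 1 - nexp (of_nat (k i) * indicator (B i) x)) = (\<Sum>j<n. if j = i then 1 - nexp (of_nat (k i)) else 0)"
          by (intro sum.cong; simp)+
        then show ?thesis using i by simp
      qed (auto intro!: sum.neutral)
      have "(\<integral>w. (\<Prod>i<n. nexp (point_count T X (B i) w) ^ k i) \<partial>P) =
        (\<integral>w. nexp (psum T X (\<lambda>x. \<Sum>i<n. of_nat (k i) * indicator (B i) x) w) \<partial>P)"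
        unfolding point_count_eq_psum psum_sum psum_cmult nexp_sum nexp_power ..
      also have "\<dots> = nexp (\<integral>\<^sup>+x. (\<Sum>i<n. ennreal (1 - nexp (of_nat (k i) * indicator (B i) x))) \<partial>\<nu>)"
      proof -
        have "ennreal (1 - nexp (\<Sum>i<n. of_nat (k i) * indicator (B i) x)) =
          (\<Sum>i<n. ennreal (1 - nexp (of_nat (k i) * indicator (B i) x)))" for x
          unfolding eq by (intro sum_ennreal[symmetric]) simp
        moreover have "(\<lambda>x. \<Sum>i<n. of_nat (k i) * indicator (B i) x :: ennreal) \<in> borel_measurable \<nu>"
          by (intro borel_measurable_sum) measurable
        ultimately show ?thesis by (simp only: lap)
      qed
      also have "\<dots> = (\<Prod>i<n. nexp (\<integral>\<^sup>+x. ennreal (1 - nexp (of_nat (k i) * indicator (B i) x)) \<partial>\<nu>))"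
        by (subst nn_integral_sum) (auto simp: nexp_sum)
      also have "\<dots> = (\<Prod>i<n. \<integral>w. nexp (point_count T X (B i) w) ^ k i \<partial>P)"
        using B by (intro prod.cong) (auto simp: ind lapB nexp_power)
      finally show "(\<integral>w. (\<Prod>i<n. nexp (point_count T X (B i) w) ^ k i) \<partial>P) = (\<Prod>i<n. \<integral>w. nexp (point_count T X (B i) w) ^ k i \<partial>P)" .
    qed auto
    \<comment> \<open>The inverse of \<open>nexp\<close>, with 0 sent to \<infinity>, recovers the
      counts.\<close>
    from indep_vars_compose2[OF this, of "\<lambda>i y. if y = 0 then \<top> else ennreal (- ln y)" "\<lambda>_. borel"]
    have "indep_vars (\<lambda>_. borel) (\<lambda>i w. if nexp (point_count T X (B i) w) = 0 then \<top> else ennreal (- ln (nexp (point_count T X (B i) w)))) {..<n}"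
      by simp
    moreover have "(if nexp x = 0 then \<top> else ennreal (- ln (nexp x))) = x" for x by (cases x) auto
    ultimately show ?thesis by simp
  qed
  ultimately show ?thesis using P unfolding poisson_point_process_def by simp
qed

text \<open>The increasing enumeration of the active indices. As \<open>c m\<close> counts the
  active indices below \<open>m\<close>, the active \<open>m\<close> with \<open>c m = i\<close> is
  number \<open>i\<close>, counting from 0; the admissible \<open>i\<close> form an initial segment,
  which is everything if infinitely many indices are active.\<close>

lemma bij_betw_enumeration:
  fixes act :: "nat \<Rightarrow> bool"
  defines "c \<equiv> \<lambda>m. card {j. j < m \<and> act j}"
  shows "bij_betw (\<lambda>i. LEAST m. act m \<and> c m = i) {i. \<exists>m. i < c m} {m. act m}"
proof -
  have c0: "c 0 = 0" by (simp add: c_def)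
  have cS: "c (Suc m) = c m + of_bool (act m)" for m
  proof -
    have "{j. j < Suc m \<and> act j} = (if act m then insert m {j. j < m \<and> act j} else {j. j < m \<and> act j})"
      by (auto simp: less_Suc_eq)
    then show ?thesis by (simp add: c_def)
  qed
  have mono: "c m \<le> c n" if "m \<le> n" for m n
    unfolding c_def using that by (intro card_mono) auto
  have inj: "m = n" if "act m" "act n" "c m = c n" for m n
  proof (rule ccontr)
    assume "m \<noteq> n"
    then consider "Suc m \<le> n" | "Suc n \<le> m" by linarith
    then show False using mono[of "Suc m" n] mono[of "Suc n" m] cS[of m] cS[of n] that by cases auto
  qed
  have ex: "\<exists>m. act m \<and> c m = i" if "\<exists>m. i < c m" for i
  proof -
    let ?m = "LEAST m. i < c m"
    have m: "i < c ?m" using that by (rule LeastI_ex)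
    then obtain j where j: "?m = Suc j" using c0 by (cases ?m) auto
    have "\<not> i < c j" using not_less_Least[of j "\<lambda>m. i < c m"] j by simp
    then show ?thesis using m cS[of j] unfolding j by (intro exI[of _ j]) (cases "act j"; simp)
  qed
  let ?s = "\<lambda>i. LEAST m. act m \<and> c m = i"
  have s: "act (?s i) \<and> c (?s i) = i" if "\<exists>m. i < c m" for i
    using ex[OF that] by (rule LeastI_ex)
  show ?thesis
  proof (rule bij_betwI')
    show "?s i = ?s j \<longleftrightarrow> i = j" if "i \<in> {i. \<exists>m. i < c m}" "j \<in> {i. \<exists>m. i < c m}" for i j
    proof
      assume eq: "?s i = ?s j"
      have "i = c (?s i)" using s[of i] that by simp
      also have "\<dots> = j" unfolding eq using s[of j] that by simp
      finally show "i = j" .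
    qed simp
    show "?s i \<in> {m. act m}" if "i \<in> {i. \<exists>m. i < c m}" for i using s that by auto
    show "\<exists>i\<in>{i. \<exists>m. i < c m}. m = ?s i" if "m \<in> {m. act m}" for m
    proof -
      have "c m < c (Suc m)" using that by (simp add: cS)
      then have ex: "\<exists>n. c m < c n" by blast
      then have "m = ?s (c m)" using inj[of m "?s (c m)"] s[OF ex] that by simp
      then show ?thesis using ex by blast
    qed
  qed
qed

lemma point_enumeration:
  assumes act[measurable]: "\<And>m::nat. Measurable.pred M (act m)" and Y[measurable]: "\<And>m. Y m \<in> measurable M \<nu>"
  obtains T :: "'w \<Rightarrow> enat" and X where "T \<in> measurable M (count_space UNIV)" "\<And>i. X i \<in> measurable M \<nu>"
    "\<And>f w. psum T X f w = (\<integral>\<^sup>+m. (if act m w then f (Y m w) else 0) \<partial>count_space UNIV)"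
proof -
  define c where "c w m = card {j. j < m \<and> act j w}" for w m
  define T where "T w = (SUP m. enat (c w m))" for w
  \<comment> \<open>For \<open>i\<close> beyond the total number no index qualifies and
    \<open>LEAST\<close> returns some fixed number; such \<open>X i\<close> do not count.\<close>
  define sel where "sel i w = (LEAST m. act m w \<and> c w m = i)" for i w
  define X where "X i w = Y (sel i w) w" for i w
  have c_eq: "c w m = (\<Sum>j<m. if act j w then 1 else 0)" for w m
    by (simp add: c_def sum.If_cases) (auto intro!: arg_cong[where f=card])
  have cm[measurable]: "(\<lambda>w. c w m) \<in> measurable M (count_space UNIV)" for m
    unfolding c_eq by measurable
  have T_less: "enat i < T w \<longleftrightarrow> (\<exists>m. i < c w m)" for i w
    by (simp add: T_def less_SUP_iff)
  have enat_le: "x \<le> y" if "\<And>i. enat i < x \<Longrightarrow> enat i < y" for x y :: enat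
  proof (rule ccontr)
    assume "\<not> x \<le> y"
    then obtain n where "y = enat n" "enat n < x" by (cases y) (auto simp: not_le)
    then show False using that[of n] by simp
  qed
  have "T w = e \<longleftrightarrow> (\<forall>i. (\<exists>m. i < c w m) \<longleftrightarrow> enat i < e)" for w e
    unfolding T_less[symmetric] by (meson enat_le antisym)
  then have T_eq: "T -` {e} \<inter> space M = {w \<in> space M. \<forall>i. (\<exists>m. i < c w m) \<longleftrightarrow> enat i < e}" for e by auto
  have "T -` {e} \<inter> space M \<in> sets M" for e unfolding T_eq by measurable
  then have Tm: "T \<in> measurable M (count_space UNIV)"
    by (subst measurable_count_space_eq2_countable) auto
  have [measurable]: "sel i \<in> measurable M (count_space UNIV)" for i
    unfolding sel_def[abs_def] by measurable
  have Xm: "X i \<in> measurable M \<nu>" for i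
    unfolding X_def by (rule measurable_compose_countable[where f="\<lambda>m w. Y m w"]) measurable
  have "psum T X f w = (\<integral>\<^sup>+m. (if act m w then f (Y m w) else 0) \<partial>count_space UNIV)" for f w
  proof -
    have "psum T X f w = (\<integral>\<^sup>+i. f (Y (sel i w) w) \<partial>count_space {i. enat i < T w})"
      unfolding psum_def by (subst nn_integral_count_space_indicator) (auto simp: X_def intro!: nn_integral_cong)
    also have "\<dots> = (\<integral>\<^sup>+m. f (Y m w) \<partial>count_space {m. act m w})"
      using bij_betw_enumeration[of "\<lambda>m. act m w"]
      by (intro nn_integral_bij_count_space[where f="\<lambda>m. f (Y m w)"]) (simp add: T_less sel_def c_def)
    also have "\<dots> = (\<integral>\<^sup>+m. (if act m w then f (Y m w) else 0) \<partial>count_space UNIV)"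
      by (subst nn_integral_count_space_indicator) (auto intro!: nn_integral_cong)
    finally show ?thesis .
  qed
  with Tm Xm show ?thesis by (rule that)
qed

section \<open>Existence of Poisson processes\<close>

lemma (in product_prob_space) integral_prod_components:
  fixes f :: "'i \<Rightarrow> 'a \<Rightarrow> real"
  assumes J: "finite J" "J \<subseteq> I" and f: "\<And>j. j \<in> J \<Longrightarrow> integrable (M j) (f j)"
  shows "(\<integral>x. (\<Prod>j\<in>J. f j (x j)) \<partial>PiM I M) = (\<Prod>j\<in>J. \<integral>x. f j x \<partial>M j)"
proof -
  have [measurable]: "j \<in> J \<Longrightarrow> f j \<in> borel_measurable (M j)" for j using f by auto
  have "(\<Prod>j\<in>J. \<integral>x. f j x \<partial>M j) = (\<integral>x. (\<Prod>j\<in>J. f j (x j)) \<partial>PiM J M)"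
    using J f by (subst product_integral_prod) auto
  also have "\<dots> = (\<integral>x. (\<Prod>j\<in>J. f j (x j)) \<partial>distr (PiM I M) (PiM J M) (\<lambda>x. restrict x J))"
    using distr_PiM_restrict_finite[OF J] by simp
  also have "\<dots> = (\<integral>x. (\<Prod>j\<in>J. f j (restrict x J j)) \<partial>PiM I M)"
    using J by (intro integral_distr borel_measurable_prod) (auto intro!: measurable_restrict_subset)
  also have "\<dots> = (\<integral>x. (\<Prod>j\<in>J. f j (x j)) \<partial>PiM I M)"
    by (simp cong: prod.cong)
  finally show ?thesis by simp
qed

text \<open>A sample \<open>q\<close> is a random number \<open>fst q\<close> with an infinite
  sequence \<open>snd q\<close> of independent points, of which only the first \<open>fst q\<close>
  are used; so the length of the random list need not enter the type.\<close>

lemma measurable_mixed_sample: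
  fixes \<rho> :: "'b measure"
  defines "Q p \<equiv> measure_pmf p \<Otimes>\<^sub>M PiM UNIV (\<lambda>_::nat. \<rho>)"
  shows "fst \<in> measurable (Q p) (count_space UNIV)" "(\<lambda>q. snd q j) \<in> measurable (Q p) \<rho>"
    and "f \<in> borel_measurable \<rho> \<Longrightarrow> (\<lambda>q. \<Sum>j<fst q. f (snd q j) :: ennreal) \<in> borel_measurable (Q p)"
proof -
  show fst[measurable]: "fst \<in> measurable (Q p) (count_space UNIV)" unfolding Q_def
    using measurable_fst[of "measure_pmf p" "PiM UNIV (\<lambda>_::nat. \<rho>)"]
    by (simp add: measurable_cong_sets[OF refl sets_measure_pmf_count_space])
  show snd[measurable]: "(\<lambda>q. snd q j) \<in> measurable (Q p) \<rho>" for j unfolding Q_def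
    by (rule measurable_compose[OF measurable_snd measurable_component_singleton]) simp
  assume [measurable]: "f \<in> borel_measurable \<rho>"
  have "(\<lambda>q. \<Sum>j<fst q. f (snd q j)) = (\<lambda>q. \<Sum>j. if j < fst q then f (snd q j) else 0)"
    by (intro ext, subst suminf_finite[of "{..<fst _}"]) auto
  moreover have "(\<lambda>q. \<Sum>j. if j < fst q then f (snd q j) else 0) \<in> borel_measurable (Q p)"
    by measurable
  ultimately show "(\<lambda>q. \<Sum>j<fst q. f (snd q j)) \<in> borel_measurable (Q p)" by simp
qed

text \<open>Given the number n of points, independence produces the n-th power of
  \<open>\<integral>x. nexp (f x) \<partial>\<rho>\<close>; averaging over n is the Poisson
  generating function.\<close>

lemma integral_nexp_mixed_sample:
  fixes f :: "'b \<Rightarrow> ennreal"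
  assumes \<rho>: "prob_space \<rho>" and r: "0 \<le> r" and f[measurable]: "f \<in> borel_measurable \<rho>"
  defines "Q \<equiv> measure_pmf (poisson0_pmf r) \<Otimes>\<^sub>M PiM UNIV (\<lambda>_::nat. \<rho>)"
  shows "(\<integral>q. nexp (\<Sum>j<fst q. f (snd q j)) \<partial>Q) = exp (- (r * (1 - (\<integral>x. nexp (f x) \<partial>\<rho>))))"
proof -
  interpret R: product_prob_space "\<lambda>_::nat. \<rho>" UNIV using \<rho> by (intro product_prob_spaceI)
  interpret N: prob_space "measure_pmf (poisson0_pmf r)" by (rule measure_pmf.prob_space_axioms)
  interpret PP: prob_space "PiM UNIV (\<lambda>_::nat. \<rho>)" by (intro prob_space_PiM \<rho>)
  interpret pair_prob_space "measure_pmf (poisson0_pmf r)" "PiM UNIV (\<lambda>_::nat. \<rho>)" by unfold_locales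
  let ?g = "\<integral>x. nexp (f x) \<partial>\<rho>"
  have int: "integrable \<rho> (\<lambda>x. nexp (f x))"
    using \<rho> by (intro finite_measure.integrable_const_bound[of _ _ 1] prob_space.finite_measure) auto
  have g: "0 \<le> ?g" "?g \<le> 1" using \<rho> int
    by (auto intro!: integral_nonneg prob_space.integral_le_const)
  have m: "(\<lambda>q. nexp (\<Sum>j<fst q. f (snd q j))) \<in> borel_measurable Q"
    unfolding Q_def using measurable_compose[OF measurable_mixed_sample(3)[OF f] measurable_nexp] .
  have "(\<integral>q. nexp (\<Sum>j<fst q. f (snd q j)) \<partial>Q) =
    (\<integral>n. (\<integral>y. nexp (\<Sum>j<n. f (y j)) \<partial>PiM UNIV (\<lambda>_::nat. \<rho>)) \<partial>measure_pmf (poisson0_pmf r))"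
    unfolding Q_def
    by (subst integral_fst'[symmetric])
       (use m in \<open>auto simp: Q_def intro!: P.integrable_const_bound[of _ 1]\<close>)
  also have "(\<lambda>n. \<integral>y. nexp (\<Sum>j<n. f (y j)) \<partial>PiM UNIV (\<lambda>_::nat. \<rho>)) = (\<lambda>n. ?g ^ n)"
    unfolding nexp_sum using int by (intro ext, subst R.integral_prod_components) auto
  also have "(\<integral>n. ?g ^ n \<partial>measure_pmf (poisson0_pmf r)) = exp (- (r * (1 - ?g)))"
    using r g by (rule integral_power_poisson0)
  finally show ?thesis .
qed

text \<open>On each of countably many disjoint pieces of finite measure, place a Poisson number \<open>N\<^sub>k\<close> of
  independent points \<open>Y\<^sub>k\<^sub>j\<close>, \<open>j < N\<^sub>k\<close>, and enumerate the pairs \<open>(k, j)\<close> in use.\<close>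

lemma poisson_process_exists:
  fixes \<nu> :: "'b measure"
  assumes "sigma_finite_measure \<nu>" and ne: "space \<nu> \<noteq> {}"
  obtains P :: "(enat \<times> (nat \<Rightarrow> 'b)) measure" and T X where "poisson_point_process P \<nu> T X"
proof -
  interpret \<nu>: sigma_finite_measure \<nu> by fact
  obtain A :: "nat \<Rightarrow> 'b set" where A: "range A \<subseteq> sets \<nu>" "(\<Union>i. A i) = space \<nu>" "\<And>i. emeasure \<nu> (A i) \<noteq> \<infinity>" "disjoint_family A"
    using \<nu>.sigma_finite_disjoint by blast
  obtain x0 where x0: "x0 \<in> space \<nu>" using ne by blast
  have Am[measurable]: "A k \<in> sets \<nu>" for k using A(1) by blast
  define r where "r k = measure \<nu> (A k)" for k
  have em: "emeasure \<nu> (A k) = ennreal (r k)" for k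
    unfolding r_def using A(3) by (intro emeasure_eq_ennreal_measure) auto
  define \<rho> where "\<rho> k = (if r k > 0 then uniform_measure \<nu> (A k) else return \<nu> x0)" for k
  have \<rho>: "prob_space (\<rho> k)" for k unfolding \<rho>_def
    using x0 em[of k] A(3)[of k] by (auto intro!: prob_space_uniform_measure prob_space_return)
  have s\<rho>[measurable_cong]: "sets (\<rho> k) = sets \<nu>" for k by (simp add: \<rho>_def)
  have key: "ennreal (r k * (1 - (\<integral>x. nexp (f x) \<partial>\<rho> k))) = (\<integral>\<^sup>+x. ennreal (1 - nexp (f x)) * indicator (A k) x \<partial>\<nu>)"
    if f[measurable]: "f \<in> borel_measurable \<nu>" for f k
  proof (cases "r k > 0")
    case True
    interpret prob_space "\<rho> k" by (rule \<rho>)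
    have int: "integrable (\<rho> k) (\<lambda>x. nexp (f x))" by (intro integrable_const_bound[of _ 1]) auto
    have "ennreal (1 - (\<integral>x. nexp (f x) \<partial>\<rho> k)) = ennreal (\<integral>x. 1 - nexp (f x) \<partial>\<rho> k)"
      using int by (simp add: prob_space)
    also have "\<dots> = (\<integral>\<^sup>+x. ennreal (1 - nexp (f x)) \<partial>\<rho> k)"
      using int by (intro nn_integral_eq_integral[symmetric]) auto
    also have "\<dots> = (\<integral>\<^sup>+x. ennreal (1 - nexp (f x)) * indicator (A k) x \<partial>\<nu>) / ennreal (r k)"
      using True by (simp add: \<rho>_def nn_integral_uniform_measure em)
    finally have "ennreal (r k) * ennreal (1 - (\<integral>x. nexp (f x) \<partial>\<rho> k)) =
      ennreal (r k) * ((\<integral>\<^sup>+x. ennreal (1 - nexp (f x)) * indicator (A k) x \<partial>\<nu>) / ennreal (r k))" by simp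
    also have "\<dots> = (\<integral>\<^sup>+x. ennreal (1 - nexp (f x)) * indicator (A k) x \<partial>\<nu>)"
      using True by (simp add: ennreal_times_divide mult.commute[of "ennreal (r k)"] mult_divide_eq_ennreal)
    finally show ?thesis using True by (simp add: ennreal_mult')
  next
    case False
    then have r0: "r k = 0" by (simp add: r_def zero_less_measure_iff)
    then have "A k \<in> null_sets \<nu>" using em[of k] by (intro null_setsI) auto
    then have "AE x in \<nu>. x \<notin> A k" by (rule AE_not_in)
    then have "(\<integral>\<^sup>+x. ennreal (1 - nexp (f x)) * indicator (A k) x \<partial>\<nu>) = (\<integral>\<^sup>+x. 0 \<partial>\<nu>)"
      by (intro nn_integral_cong_AE) (auto simp: indicator_def)
    then show ?thesis using r0 by simp
  qed
  define Q where "Q k = measure_pmf (poisson0_pmf (r k)) \<Otimes>\<^sub>M PiM UNIV (\<lambda>_::nat. \<rho> k)" for k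
  have Q: "prob_space (Q k)" for k
  proof -
    interpret N: prob_space "measure_pmf (poisson0_pmf (r k))" by (rule measure_pmf.prob_space_axioms)
    interpret PP: prob_space "PiM UNIV (\<lambda>_::nat. \<rho> k)" by (intro prob_space_PiM \<rho>)
    interpret pair_prob_space "measure_pmf (poisson0_pmf (r k))" "PiM UNIV (\<lambda>_::nat. \<rho> k)" by unfold_locales
    show ?thesis unfolding Q_def by (rule P.prob_space_axioms)
  qed
  interpret Q: product_prob_space Q UNIV using Q by (rule product_prob_spaceI)
  define \<Omega> where "\<Omega> = PiM UNIV Q"
  interpret \<Omega>: prob_space \<Omega> unfolding \<Omega>_def by (intro prob_space_PiM Q)
  define act where "act m w = (case prod_decode m of (k, j) \<Rightarrow> j < fst (w k))" for m and w :: "nat \<Rightarrow> nat \<times> (nat \<Rightarrow> 'b)"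
  define Y where "Y m w = (case prod_decode m of (k, j) \<Rightarrow> snd (w k) j)" for m and w :: "nat \<Rightarrow> nat \<times> (nat \<Rightarrow> 'b)"
  have comp: "(\<lambda>w. w k) \<in> measurable \<Omega> (Q k)" for k unfolding \<Omega>_def by simp
  have fstQ: "fst \<in> measurable (Q k) (count_space UNIV)" and sndQ: "(\<lambda>q. snd q j) \<in> measurable (Q k) \<nu>" for k j
    unfolding Q_def using measurable_mixed_sample(1) measurable_mixed_sample(2)[where \<rho>="\<rho> k"]
    by (simp_all add: measurable_cong_sets[OF refl s\<rho>])
  note [measurable] = measurable_compose[OF comp fstQ] measurable_compose[OF comp sndQ]
  have am: "Measurable.pred \<Omega> (act m)" for m unfolding act_def by (cases "prod_decode m") simp
  have Ym: "Y m \<in> measurable \<Omega> \<nu>" for m unfolding Y_def by (cases "prod_decode m") simp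
  obtain T X where T[measurable]: "T \<in> measurable \<Omega> (count_space UNIV)" and X[measurable]: "\<And>i. X i \<in> measurable \<Omega> \<nu>"
    and ps: "\<And>f w. psum T X f w = (\<integral>\<^sup>+m. (if act m w then f (Y m w) else 0) \<partial>count_space UNIV)"
    by (rule point_enumeration[where act=act and Y=Y, OF am Ym]) (rule that)
  have ps: "psum T X f w = (\<Sum>k. \<Sum>j<fst (w k). f (snd (w k) j))" for f w
  proof -
    let ?F = "\<lambda>(k, j). if j < fst (w k) then f (snd (w k) j) else 0"
    have "psum T X f w = (\<Sum>m. ?F (prod_decode m))"
      unfolding ps nn_integral_count_space_nat by (intro suminf_cong) (simp add: act_def Y_def split: prod.split)
    also have "\<dots> = (\<Sum>k. \<Sum>j. ?F (k, j))" by (rule suminf_ennreal_2dimen) simp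
    also have "\<dots> = (\<Sum>k. \<Sum>j<fst (w k). f (snd (w k) j))"
      by (intro suminf_cong, subst suminf_finite[of "{..<fst (w _)}"]) auto
    finally show ?thesis .
  qed
  have lap: "(\<integral>w. nexp (psum T X f w) \<partial>\<Omega>) = nexp (poisson_exponent \<nu> f)"
    if f[measurable]: "f \<in> borel_measurable \<nu>" for f
  proof -
    let ?g = "\<lambda>q. \<Sum>j<fst q. f (snd q j)"
    let ?E = "\<lambda>k. \<integral>\<^sup>+x. ennreal (1 - nexp (f x)) * indicator (A k) x \<partial>\<nu>"
    have gm: "?g \<in> borel_measurable (Q k)" for k
      unfolding Q_def by (intro measurable_mixed_sample) simp
    have [measurable]: "(\<lambda>w. ?g (w k)) \<in> borel_measurable \<Omega>" for k
      using measurable_compose[OF comp gm] .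
    have one: "(\<integral>q. nexp (?g q) \<partial>Q k) = nexp (?E k)" for k
    proof -
      have "0 \<le> r k * (1 - (\<integral>x. nexp (f x) \<partial>\<rho> k))"
        using \<rho>[of k] by (auto intro!: mult_nonneg_nonneg prob_space.integral_le_const
          finite_measure.integrable_const_bound[of _ _ 1] prob_space.finite_measure simp: r_def)
      then have "nexp (?E k) = exp (- (r k * (1 - (\<integral>x. nexp (f x) \<partial>\<rho> k))))"
        unfolding key[OF f, symmetric] by (rule nexp_ennreal)
      then show ?thesis unfolding Q_def
        by (subst integral_nexp_mixed_sample) (auto simp: \<rho> r_def)
    qed
    have gi: "integrable (Q k) (\<lambda>q. nexp (?g q))" for k
      using Q[of k] gm[of k] by (intro finite_measure.integrable_const_bound[of _ _ 1] prob_space.finite_measure) auto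
    have fin: "(\<integral>w. nexp (\<Sum>k<n. ?g (w k)) \<partial>\<Omega>) = nexp (\<Sum>k<n. ?E k)" for n
      unfolding nexp_sum[of _ "{..<n}"] \<Omega>_def using gi by (subst Q.integral_prod_components) (auto simp: one)
    have "(\<lambda>n. \<Sum>k<n. ?E k) \<longlonglongrightarrow> (\<Sum>k. ?E k)" by (intro summable_LIMSEQ) simp
    then have "(\<lambda>n. nexp (\<Sum>k<n. ?E k)) \<longlonglongrightarrow> nexp (\<Sum>k. ?E k)" by (rule tendsto_nexp)
    moreover have "(\<lambda>n. \<integral>w. nexp (\<Sum>k<n. ?g (w k)) \<partial>\<Omega>) \<longlonglongrightarrow> (\<integral>w. nexp (\<Sum>k. ?g (w k)) \<partial>\<Omega>)"
    proof (rule integral_dominated_convergence[where w="\<lambda>_. 1"])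
      have "(\<lambda>n. nexp (\<Sum>k<n. ?g (w k))) \<longlonglongrightarrow> nexp (\<Sum>k. ?g (w k))" for w
        by (intro tendsto_nexp summable_LIMSEQ) simp
      then show "AE w in \<Omega>. (\<lambda>n. nexp (\<Sum>k<n. ?g (w k))) \<longlonglongrightarrow> nexp (\<Sum>k. ?g (w k))" by (rule AE_I2)
    qed simp_all
    ultimately have "(\<integral>w. nexp (\<Sum>k. ?g (w k)) \<partial>\<Omega>) = nexp (\<Sum>k. ?E k)"
      unfolding fin by (intro LIMSEQ_unique)
    also have "(\<Sum>k. ?E k) = (\<integral>\<^sup>+x. (\<Sum>k. ennreal (1 - nexp (f x)) * indicator (A k) x) \<partial>\<nu>)"
      by (intro nn_integral_suminf[symmetric]) measurable
    also have "\<dots> = poisson_exponent \<nu> f"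
    proof (intro nn_integral_cong)
      fix x assume "x \<in> space \<nu>"
      then show "(\<Sum>k. ennreal (1 - nexp (f x)) * indicator (A k) x) = ennreal (1 - nexp (f x))"
        using suminf_indicator[OF A(4), of x] A(2) by simp
    qed
    finally show ?thesis by (simp add: ps)
  qed
  \<comment> \<open>The process is moved to the completed law of \<open>(T, X)\<close>: the
    completion meets the completeness requirement, and the sample points get the type promised in
    the statement.\<close>
  let ?S = "count_space UNIV \<Otimes>\<^sub>M PiM UNIV (\<lambda>_::nat. \<nu>)"
  define h where "h w = (T w, \<lambda>i. X i w)" for w
  have hm[measurable]: "h \<in> measurable \<Omega> ?S" unfolding h_def
    by (intro measurable_Pair T measurable_PiM_single') (auto simp: measurable_space[OF X])
  define P where "P = completion (distr \<Omega> ?S h)"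
  interpret D: prob_space "distr \<Omega> ?S h" by (rule \<Omega>.prob_space_distr[OF hm])
  have m1: "fst \<in> measurable ?S (count_space UNIV)" "(\<lambda>p. snd p i) \<in> measurable ?S \<nu>" for i by measurable
  have "poisson_point_process P \<nu> fst (\<lambda>i p. snd p i)"
  proof (rule poisson_point_processI_laplace)
    show "complete_prob_space P"
      unfolding P_def complete_prob_space_def by (intro conjI D.prob_space_completion completion.complete_measure_axioms)
    show "fst \<in> measurable P (count_space UNIV)" "(\<lambda>p. snd p i) \<in> measurable P \<nu>" for i
      unfolding P_def using m1 by (auto intro!: measurable_completion)
    fix f :: "'b \<Rightarrow> ennreal" assume f[measurable]: "f \<in> borel_measurable \<nu>"
    have pm: "(\<lambda>w. psum fst (\<lambda>i p. snd p i) f w) \<in> borel_measurable ?S"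
      using measurable_psum[OF m1 f] .
    have "(\<integral>w. nexp (psum fst (\<lambda>i p. snd p i) f w) \<partial>P) = (\<integral>w. nexp (psum fst (\<lambda>i p. snd p i) f w) \<partial>distr \<Omega> ?S h)"
      unfolding P_def using measurable_compose[OF pm measurable_nexp] by (intro integral_completion) simp
    also have "\<dots> = (\<integral>w. nexp (psum fst (\<lambda>i p. snd p i) f (h w)) \<partial>\<Omega>)"
      using measurable_compose[OF pm measurable_nexp] by (intro integral_distr hm)
    also have "\<dots> = (\<integral>w. nexp (psum T X f w) \<partial>\<Omega>)" unfolding psum_def h_def fst_conv snd_conv ..
    finally show "(\<integral>w. nexp (psum fst (\<lambda>i p. snd p i) f w) \<partial>P) = nexp (poisson_exponent \<nu> f)"
      using lap[OF f] by simp
  qed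
  then show ?thesis by (rule that)
qed

section \<open>The Laplace exponent and the Levy measure\<close>

lemma convex_bodies_empty [simp]: "{} \<in> convex_bodies"
  by (simp add: convex_bodies_def)

lemma convex_bodies_Int: "K \<in> convex_bodies \<Longrightarrow> L \<in> convex_bodies \<Longrightarrow> K \<inter> L \<in> convex_bodies"
  by (auto simp: convex_bodies_def compact_Int convex_Int)

lemma one_minus_exp_le: "0 \<le> x \<Longrightarrow> 1 - exp (- x) \<le> min 1 x" for x :: real
  using exp_ge_add_one_self[of "- x"] by auto

text \<open>The bound through which (L1) dominates Laplace exponents. One \<open>x i\<close> above 1
  makes the right side at least 1; otherwise the truncations change nothing.\<close>

lemma min_one_sum_le:
  fixes x u :: "'i \<Rightarrow> real"
  assumes "\<And>i. i \<in> I \<Longrightarrow> 0 \<le> x i" "\<And>i. i \<in> I \<Longrightarrow> 0 \<le> u i"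
  shows "min 1 (\<Sum>i\<in>I. u i * x i) \<le> (\<Sum>i\<in>I. max 1 (u i) * min 1 (x i))"
proof (cases "\<exists>i\<in>I. 1 < x i")
  have nn: "0 \<le> max 1 (u i) * min 1 (x i)" if "i \<in> I" for i using assms that by simp
  case True
  then obtain i where i: "i \<in> I" "1 < x i" by blast
  show ?thesis
  proof (cases "finite I")
    case True
    have "1 \<le> max 1 (u i) * min 1 (x i)" using i by simp
    also have "\<dots> \<le> (\<Sum>i\<in>I. max 1 (u i) * min 1 (x i))"
      using True i nn by (intro member_le_sum) auto
    finally show ?thesis by linarith
  qed simp
next
  case False
  have "(\<Sum>i\<in>I. u i * x i) \<le> (\<Sum>i\<in>I. max 1 (u i) * min 1 (x i))"
    using False assms by (intro sum_mono mult_mono) (auto simp: not_less)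
  then show ?thesis by linarith
qed

section \<open>Essential infima\<close>

context prob_space
begin

lemma ess_inf_bdd_above: "bdd_above {c. AE w in M. c \<le> (X w :: real)}"
proof (rule ccontr)
  assume *: "\<not> bdd_above {c. AE w in M. c \<le> X w}"
  have "AE w in M. real n \<le> X w" for n
  proof -
    obtain c where c: "AE w in M. c \<le> X w" "real n < c"
      using * unfolding bdd_above_def by (metis mem_Collect_eq not_le)
    show ?thesis using c(1) by (rule eventually_mono) (use c(2) in linarith)
  qed
  then have "AE w in M. \<forall>n. real n \<le> X w" by (simp add: AE_all_countable)
  then have "AE w in M. False"
    by (rule eventually_mono) (use reals_Archimedean2 not_le in blast)
  then show False by simp
qed

lemma le_ess_infI: "(AE w in M. c \<le> X w) \<Longrightarrow> c \<le> ess_inf M X"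
  unfolding ess_inf_def by (intro cSup_upper ess_inf_bdd_above) simp

lemma AE_ess_inf_le:
  assumes "AE w in M. 0 \<le> X w"
  shows "AE w in M. ess_inf M X \<le> X w"
proof -
  have "AE w in M. ess_inf M X - 1 / real (Suc n) \<le> X w" for n
  proof -
    have "\<exists>c\<in>{c. AE w in M. c \<le> X w}. ess_inf M X - 1 / real (Suc n) < c"
      using assms unfolding ess_inf_def by (intro less_cSupD) auto
    then obtain c where c: "AE w in M. c \<le> X w" "ess_inf M X - 1 / real (Suc n) < c" by blast
    show ?thesis using c(1) by (rule eventually_mono) (use c(2) in linarith)
  qed
  then have "AE w in M. \<forall>n. ess_inf M X - 1 / real (Suc n) \<le> X w" by (simp add: AE_all_countable)
  then show ?thesis
  proof (rule eventually_mono)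
    fix w assume *: "\<forall>n. ess_inf M X - 1 / real (Suc n) \<le> X w"
    show "ess_inf M X \<le> X w"
    proof (rule field_le_epsilon)
      fix e :: real assume "e > 0"
      then obtain n where "1 / real (Suc n) < e" using nat_approx_posE by metis
      then show "ess_inf M X \<le> X w + e" using *[rule_format, of n] by linarith
    qed
  qed
qed

end

lemma decreases_to_subset: "decreases_to Ks K \<Longrightarrow> K \<subseteq> Ks n" "decreases_to Ks K \<Longrightarrow> m \<le> n \<Longrightarrow> Ks n \<subseteq> Ks m"
  by (auto simp: decreases_to_def decseq_def)

section \<open>What the deterministic part and the Levy measure inherit from the paths\<close>

locale monotone_levy = prob_space M for M :: "'w measure" +
  fixes \<Phi> :: "'a::euclidean_space set \<Rightarrow> 'w \<Rightarrow> real" and \<Lambda> :: "('a set \<Rightarrow> real) measure"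
  assumes \<Phi>_measurable [measurable]: "K \<in> convex_bodies \<Longrightarrow> \<Phi> K \<in> borel_measurable M"
    and \<Phi>_empty: "AE w in M. \<Phi> {} w = 0"
    and \<Phi>_valuation: "K \<in> convex_bodies \<Longrightarrow> L \<in> convex_bodies \<Longrightarrow> K \<union> L \<in> convex_bodies \<Longrightarrow>
      AE w in M. \<Phi> (K \<union> L) w + \<Phi> (K \<inter> L) w = \<Phi> K w + \<Phi> L w"
    and \<Phi>_mono_on: "AE w in M. mono_on convex_bodies (\<lambda>K. \<Phi> K w)"
    and \<Phi>_sigma_continuous: "AE w in M. sigma_continuous (\<lambda>K. \<Phi> K w)"
    and levy: "levy_measure_of M \<Phi> \<Lambda>"
begin

abbreviation "\<phi> \<equiv> deterministic_part M \<Phi>"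

lemma \<Phi>_mono: "K \<in> convex_bodies \<Longrightarrow> L \<in> convex_bodies \<Longrightarrow> L \<subseteq> K \<Longrightarrow> AE w in M. \<Phi> L w \<le> \<Phi> K w"
  using \<Phi>_mono_on by (rule eventually_mono) (auto dest: mono_onD)

lemma \<Phi>_nonneg: assumes "K \<in> convex_bodies" shows "AE w in M. 0 \<le> \<Phi> K w"
proof -
  have "AE w in M. \<Phi> {} w \<le> \<Phi> K w" using assms by (intro \<Phi>_mono) auto
  then show ?thesis using \<Phi>_empty by eventually_elim simp
qed

lemma \<Phi>_LIMSEQ:
  "range Ks \<subseteq> convex_bodies \<Longrightarrow> K \<in> convex_bodies \<Longrightarrow> decreases_to Ks K \<Longrightarrow>
    AE w in M. (\<lambda>n. \<Phi> (Ks n) w) \<longlonglongrightarrow> \<Phi> K w"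
  using \<Phi>_sigma_continuous by (rule eventually_mono) (auto simp: sigma_continuous_def)

lemma deterministic_part_le: "K \<in> convex_bodies \<Longrightarrow> AE w in M. \<phi> K \<le> \<Phi> K w"
  unfolding deterministic_part_def by (intro AE_ess_inf_le \<Phi>_nonneg)

lemma deterministic_part_mono:
  assumes "K \<in> convex_bodies" "L \<in> convex_bodies" "L \<subseteq> K" shows "\<phi> L \<le> \<phi> K"
proof -
  have "AE w in M. \<phi> L \<le> \<Phi> K w"
    using deterministic_part_le[OF assms(2)] \<Phi>_mono[OF assms] by eventually_elim simp
  then show ?thesis unfolding deterministic_part_def[of M \<Phi> K] by (rule le_ess_infI)
qed

lemma deterministic_part_nonneg: "K \<in> convex_bodies \<Longrightarrow> 0 \<le> \<phi> K"
  unfolding deterministic_part_def by (intro le_ess_infI \<Phi>_nonneg)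

lemma deterministic_part_empty: "\<phi> {} = 0"
proof (rule antisym)
  have "AE w in M. \<phi> {} \<le> 0"
    using deterministic_part_le[OF convex_bodies_empty] \<Phi>_empty by eventually_elim simp
  then show "\<phi> {} \<le> 0" by simp
qed (simp add: deterministic_part_nonneg)

lemma mono_on_deterministic_part: "mono_on convex_bodies \<phi>"
  by (intro mono_onI deterministic_part_mono)

text \<open>By monotonicity the values along the sequence decrease to some \<open>c\<close> with
  \<open>\<phi> K \<le> c\<close>. By continuity of the paths \<open>c\<close> is almost surely a
  lower bound of \<open>\<Phi> K\<close>, so \<open>c \<le> \<phi> K\<close> as well.\<close>

lemma sigma_continuous_deterministic_part: "sigma_continuous \<phi>"
  unfolding sigma_continuous_def
proof (intro allI impI, elim conjE)
  fix Ks :: "nat \<Rightarrow> 'a set" and K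
  assume Ks: "range Ks \<subseteq> convex_bodies" and K: "K \<in> convex_bodies" and dec: "decreases_to Ks K"
  have cb: "Ks n \<in> convex_bodies" for n using Ks by blast
  have "decseq (\<lambda>n. \<phi> (Ks n))"
    unfolding decseq_def by (auto intro!: deterministic_part_mono cb decreases_to_subset(2)[OF dec])
  moreover have "\<phi> K \<le> \<phi> (Ks n)" for n
    using dec by (intro deterministic_part_mono cb K decreases_to_subset)
  ultimately obtain c where c: "(\<lambda>n. \<phi> (Ks n)) \<longlonglongrightarrow> c" "\<And>n. c \<le> \<phi> (Ks n)"
    using decseq_convergent[of "\<lambda>n. \<phi> (Ks n)" "\<phi> K"] by blast
  have "AE w in M. \<forall>n. \<phi> (Ks n) \<le> \<Phi> (Ks n) w"
    using cb by (simp add: AE_all_countable deterministic_part_le)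
  then have "AE w in M. c \<le> \<Phi> K w" using \<Phi>_LIMSEQ[OF Ks K dec]
  proof eventually_elim
    case (elim w)
    then show ?case using c(2) by (intro LIMSEQ_le_const) (auto intro: order_trans)
  qed
  then have "c \<le> \<phi> K" unfolding deterministic_part_def by (rule le_ess_infI)
  moreover have "\<phi> K \<le> c" using c(1) \<open>\<And>n. \<phi> K \<le> \<phi> (Ks n)\<close> by (intro LIMSEQ_le_const) auto
  ultimately show "(\<lambda>n. \<phi> (Ks n)) \<longlonglongrightarrow> \<phi> K" using c(1) by simp
qed

lemma levy_measure_\<Lambda>: "levy_measure \<Lambda>"
  using levy by (simp add: levy_measure_of_def)

lemma sets_\<Lambda>: "sets \<Lambda> = sets path_space"
  using levy_measure_\<Lambda> by (simp add: levy_measure_def)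

lemma space_\<Lambda>: "space \<Lambda> = (\<Pi>\<^sub>E K\<in>convex_bodies. {0..})"
  using sets_eq_imp_space_eq[OF sets_\<Lambda>] by (simp add: path_space_def space_PiM space_restrict_space)

lemma \<psi>_nonneg: "\<psi> \<in> space \<Lambda> \<Longrightarrow> K \<in> convex_bodies \<Longrightarrow> 0 \<le> \<psi> K"
  by (auto simp: space_\<Lambda>)

lemma \<psi>_measurable [measurable]:
  assumes "K \<in> convex_bodies" shows "(\<lambda>\<psi>. \<psi> K) \<in> borel_measurable \<Lambda>"
proof -
  have "(\<lambda>\<psi>. \<psi> K) \<in> measurable path_space (restrict_space borel {0..})"
    unfolding path_space_def using assms by measurable
  then have "(\<lambda>\<psi>. \<psi> K) \<in> borel_measurable path_space" by (simp add: measurable_restrict_space2_iff)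
  then show ?thesis by (simp add: measurable_cong_sets[OF sets_\<Lambda> refl])
qed

lemma nn_integral_min_finite: "K \<in> convex_bodies \<Longrightarrow> (\<integral>\<^sup>+\<psi>. ennreal (min 1 (\<psi> K)) \<partial>\<Lambda>) < \<infinity>"
  using levy_measure_\<Lambda> by (simp add: levy_measure_def)

lemma integrable_min: assumes "K \<in> convex_bodies" shows "integrable \<Lambda> (\<lambda>\<psi>. min 1 (\<psi> K))"
proof (rule integrableI_nonneg)
  show "(\<lambda>\<psi>. min 1 (\<psi> K)) \<in> borel_measurable \<Lambda>" using assms by measurable
  show "AE \<psi> in \<Lambda>. 0 \<le> min 1 (\<psi> K)" using assms by (intro AE_I2) (simp add: \<psi>_nonneg)
qed (use nn_integral_min_finite[OF assms] in simp)

abbreviation "levy_exponent m K u \<equiv> \<integral>\<psi>. 1 - exp (- (\<Sum>j<(m::nat). u j * \<psi> (K j))) \<partial>\<Lambda>"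

lemma integrable_one_minus_exp:
  assumes "\<And>j. j < m \<Longrightarrow> K j \<in> convex_bodies" "\<And>j. j < m \<Longrightarrow> 0 \<le> u j"
  shows "integrable \<Lambda> (\<lambda>\<psi>. 1 - exp (- (\<Sum>j<(m::nat). u j * \<psi> (K j))))"
proof (rule Bochner_Integration.integrable_bound)
  show "integrable \<Lambda> (\<lambda>\<psi>. \<Sum>j<m. max 1 (u j) * min 1 (\<psi> (K j)))"
    using assms by (intro Bochner_Integration.integrable_sum integrable_mult_right integrable_min) auto
  show "(\<lambda>\<psi>. 1 - exp (- (\<Sum>j<m. u j * \<psi> (K j)))) \<in> borel_measurable \<Lambda>"
    using assms(1) by (intro borel_measurable_diff borel_measurable_const borel_measurable_exp
      borel_measurable_uminus borel_measurable_sum borel_measurable_times \<psi>_measurable) auto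
  show "AE \<psi> in \<Lambda>. norm (1 - exp (- (\<Sum>j<m. u j * \<psi> (K j)))) \<le> norm (\<Sum>j<m. max 1 (u j) * min 1 (\<psi> (K j)))"
  proof (rule AE_I2)
    fix \<psi> assume \<psi>: "\<psi> \<in> space \<Lambda>"
    have s: "0 \<le> (\<Sum>j<m. u j * \<psi> (K j))" using assms \<psi>_nonneg[OF \<psi>] by (intro sum_nonneg mult_nonneg_nonneg) auto
    then have "1 - exp (- (\<Sum>j<m. u j * \<psi> (K j))) \<le> min 1 (\<Sum>j<m. u j * \<psi> (K j))" by (rule one_minus_exp_le)
    also have "\<dots> \<le> (\<Sum>j<m. max 1 (u j) * min 1 (\<psi> (K j)))"
      using assms \<psi>_nonneg[OF \<psi>] by (intro min_one_sum_le[of _ "\<lambda>j. \<psi> (K j)" u]) auto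
    finally show "norm (1 - exp (- (\<Sum>j<m. u j * \<psi> (K j)))) \<le> norm (\<Sum>j<m. max 1 (u j) * min 1 (\<psi> (K j)))"
      using s by simp
  qed
qed

lemma laplace:
  assumes "m \<ge> 1" "\<And>j. j < m \<Longrightarrow> K j \<in> convex_bodies" "\<And>j. j < m \<Longrightarrow> 0 \<le> u j"
  shows "(\<integral>w. exp (- (\<Sum>j<(m::nat). u j * \<Phi> (K j) w)) \<partial>M) =
    exp (- (\<Sum>j<m. u j * \<phi> (K j)) - levy_exponent m K u)"
  using levy assms unfolding levy_measure_of_def by blast

text \<open>Comparing the Laplace exponents of \<open>2A\<close>, \<open>A + B\<close> and \<open>2B\<close> gives
  \<open>\<integral>(e\<^sup>-\<^sup>A - e\<^sup>-\<^sup>B)\<^sup>2 d\<Lambda> = 0\<close>.\<close>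

lemma AE_levy_linear_eq:
  assumes m: "m \<ge> 1" and K: "\<And>j. j < m \<Longrightarrow> K j \<in> convex_bodies"
    and u: "\<And>j. j < m \<Longrightarrow> 0 \<le> u j" and v: "\<And>j. j < m \<Longrightarrow> 0 \<le> v j"
    and eq: "AE w in M. (\<Sum>j<(m::nat). u j * \<Phi> (K j) w) = (\<Sum>j<m. v j * \<Phi> (K j) w)"
  shows "AE \<psi> in \<Lambda>. (\<Sum>j<m. u j * \<psi> (K j)) = (\<Sum>j<m. v j * \<psi> (K j))"
    and "(\<Sum>j<m. u j * \<phi> (K j)) = (\<Sum>j<m. v j * \<phi> (K j))"
proof -
  let ?A = "\<lambda>\<psi>. \<Sum>j<m. u j * \<psi> (K j)" and ?B = "\<lambda>\<psi>. \<Sum>j<m. v j * \<psi> (K j)"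
  define J where "J a b \<psi> = 1 - exp (- (a * ?A \<psi> + b * ?B \<psi>))" for a b \<psi>
  define I where "I a b = (\<integral>\<psi>. J a b \<psi> \<partial>\<Lambda>)" for a b
  have comb: "a * (\<Sum>j<m. u j * x j) + b * (\<Sum>j<m. v j * x j) = (\<Sum>j<m. (a * u j + b * v j) * x j)"
    for a b :: real and x
    by (simp add: sum_distrib_left sum.distrib algebra_simps)
  have int: "integrable \<Lambda> (J a b)" if "0 \<le> a" "0 \<le> b" for a b
    unfolding J_def comb using K u v that by (intro integrable_one_minus_exp) auto
  have L: "(\<integral>w. exp (- (a * ?A (\<lambda>K. \<Phi> K w) + b * ?B (\<lambda>K. \<Phi> K w))) \<partial>M) = exp (- (a * ?A \<phi> + b * ?B \<phi>) - I a b)"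
    if "0 \<le> a" "0 \<le> b" for a b
    unfolding comb I_def J_def using K u v that m by (intro laplace) auto
  have Am: "(\<lambda>w. \<Sum>j<m. u j * \<Phi> (K j) w) \<in> borel_measurable M" "(\<lambda>w. \<Sum>j<m. v j * \<Phi> (K j) w) \<in> borel_measurable M"
    using K by (auto intro!: borel_measurable_sum borel_measurable_times)
  have E: "(\<integral>w. exp (- (a * ?A (\<lambda>K. \<Phi> K w) + b * ?B (\<lambda>K. \<Phi> K w))) \<partial>M) =
    (\<integral>w. exp (- ((a + b) * ?A (\<lambda>K. \<Phi> K w))) \<partial>M)" for a b
  proof (rule integral_cong_AE)
    show "AE w in M. exp (- (a * ?A (\<lambda>K. \<Phi> K w) + b * ?B (\<lambda>K. \<Phi> K w))) = exp (- ((a + b) * ?A (\<lambda>K. \<Phi> K w)))"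
      using eq by eventually_elim (simp add: algebra_simps)
  qed (use Am in measurable)
  \<comment> \<open>As the two linear forms agree almost surely, the full exponent, deterministic
    part included, depends on \<open>a + b\<close> only. In comparing (2,0) and (0,2) with twice
    (1,1) the deterministic terms cancel.\<close>
  have G: "a * ?A \<phi> + b * ?B \<phi> + I a b = c * ?A \<phi> + d * ?B \<phi> + I c d"
    if "0 \<le> a" "0 \<le> b" "0 \<le> c" "0 \<le> d" "a + b = c + d" for a b c d
  proof -
    have "exp (- (a * ?A \<phi> + b * ?B \<phi>) - I a b) = exp (- (c * ?A \<phi> + d * ?B \<phi>) - I c d)"
      using that L[of a b] L[of c d] E[of a b] E[of c d] by simp
    then show ?thesis by simp
  qed
  have "I 2 0 + I 0 2 = 2 * I 1 1" using G[of 2 0 1 1] G[of 0 2 1 1] by simp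
  moreover have "integrable \<Lambda> (\<lambda>\<psi>. (exp (- ?A \<psi>) - exp (- ?B \<psi>))\<^sup>2)"
    and "(\<integral>\<psi>. (exp (- ?A \<psi>) - exp (- ?B \<psi>))\<^sup>2 \<partial>\<Lambda>) = 2 * I 1 1 - I 2 0 - I 0 2"
  proof -
    have "(exp (- x) - exp (- y))\<^sup>2 = 2 * (1 - exp (- (1 * x + 1 * y))) - (1 - exp (- (2 * x + 0 * y))) - (1 - exp (- (0 * x + 2 * y)))"
      for x y :: real
    proof -
      have "exp (- (2 * x)) = exp (- x)^2" "exp (- (2 * y)) = exp (- y)^2"
        by (simp_all add: exp_double[symmetric])
      moreover have "exp (- (x + y)) = exp (- x) * exp (- y)" by (simp add: exp_add[symmetric])
      ultimately show ?thesis by (simp add: power2_eq_square algebra_simps)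
    qed
    then have sq: "(\<lambda>\<psi>. (exp (- ?A \<psi>) - exp (- ?B \<psi>))\<^sup>2) =
      (\<lambda>\<psi>. 2 * J 1 1 \<psi> - J 2 0 \<psi> - J 0 2 \<psi>)"
      unfolding J_def by (intro ext)
    show int_sq: "integrable \<Lambda> (\<lambda>\<psi>. (exp (- ?A \<psi>) - exp (- ?B \<psi>))\<^sup>2)"
      unfolding sq by (intro Bochner_Integration.integrable_diff integrable_mult_right int) auto
    show "(\<integral>\<psi>. (exp (- ?A \<psi>) - exp (- ?B \<psi>))\<^sup>2 \<partial>\<Lambda>) = 2 * I 1 1 - I 2 0 - I 0 2"
      unfolding sq I_def by (simp add: int)
  qed
  ultimately have "(\<integral>\<psi>. (exp (- ?A \<psi>) - exp (- ?B \<psi>))\<^sup>2 \<partial>\<Lambda>) = 0"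
    and "integrable \<Lambda> (\<lambda>\<psi>. (exp (- ?A \<psi>) - exp (- ?B \<psi>))\<^sup>2)" by simp_all
  then have "AE \<psi> in \<Lambda>. (exp (- ?A \<psi>) - exp (- ?B \<psi>))\<^sup>2 = 0"
    by (subst (asm) integral_nonneg_eq_0_iff_AE) auto
  then show *: "AE \<psi> in \<Lambda>. ?A \<psi> = ?B \<psi>" by (rule eventually_mono) simp
  \<comment> \<open>Once the integral parts agree, comparing (1,0) with (0,1) leaves the
    deterministic terms alone.\<close>
  have "I 1 0 = I 0 1" unfolding I_def
  proof (rule integral_cong_AE)
    show "AE \<psi> in \<Lambda>. J 1 0 \<psi> = J 0 1 \<psi>"
      using * by eventually_elim (simp add: J_def)
  qed (use int[of 1 0] int[of 0 1] in auto)
  then show "?A \<phi> = ?B \<phi>" using G[of 1 0 0 1] by simp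
qed

text \<open>Essential infima are not additive in general, so the relation cannot be read off the
  paths; it comes from comparing Laplace exponents of the two sides of the valuation
  identity.\<close>

lemma valuation_deterministic_part: "valuation \<phi>"
  unfolding valuation_def
proof (intro conjI ballI impI deterministic_part_empty)
  fix K L :: "'a set" assume cb: "K \<in> convex_bodies" "L \<in> convex_bodies" "K \<union> L \<in> convex_bodies"
  let ?K = "(!) [K \<union> L, K \<inter> L, K, L]" and ?u = "(!) [1, 1, 0, 0 :: real]" and ?v = "(!) [0, 0, 1, 1 :: real]"
  have "(\<Sum>j<4. ?u j * \<phi> (?K j)) = (\<Sum>j<4. ?v j * \<phi> (?K j))"
    using cb \<Phi>_valuation[OF cb]
    by (intro AE_levy_linear_eq) (auto simp: eval_nat_numeral less_Suc_eq convex_bodies_Int)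
  then show "\<phi> (K \<union> L) + \<phi> (K \<inter> L) = \<phi> K + \<phi> L" by (simp add: eval_nat_numeral)
qed

lemma AE_levy_valuation:
  assumes cb: "K \<in> convex_bodies" "L \<in> convex_bodies" "K \<union> L \<in> convex_bodies"
  shows "AE \<psi> in \<Lambda>. \<psi> (K \<union> L) + \<psi> (K \<inter> L) = \<psi> K + \<psi> L"
proof -
  let ?K = "(!) [K \<union> L, K \<inter> L, K, L]" and ?u = "(!) [1, 1, 0, 0 :: real]" and ?v = "(!) [0, 0, 1, 1 :: real]"
  have "AE \<psi> in \<Lambda>. (\<Sum>j<4. ?u j * \<psi> (?K j)) = (\<Sum>j<4. ?v j * \<psi> (?K j))"
    using cb \<Phi>_valuation[OF cb]
    by (intro AE_levy_linear_eq) (auto simp: eval_nat_numeral less_Suc_eq convex_bodies_Int)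
  then show ?thesis by (simp add: eval_nat_numeral)
qed

lemma AE_levy_empty: "AE \<psi> in \<Lambda>. \<psi> {} = 0"
proof -
  show ?thesis using AE_levy_linear_eq(1)[of 1 "\<lambda>_. {}" "\<lambda>_. 1" "\<lambda>_. 0"] \<Phi>_empty by simp
qed

text \<open>With \<open>x = \<psi> K\<close> and \<open>y = \<psi> L\<close>, the integral of \<open>(e\<^sup>-\<^sup>x - e\<^sup>-\<^sup>y)\<^sup>2 (1 - e\<^sup>-\<^sup>y)\<close> is a combination of
  Laplace exponents that vanishes by \<open>rel\<close>.\<close>

lemma AE_levy_two_valued:
  assumes ind: "independent_increments M \<Phi>" and KL: "K \<in> convex_bodies" "L \<in> convex_bodies" "L \<subseteq> K"
  shows "AE \<psi> in \<Lambda>. \<psi> L = 0 \<or> \<psi> L = \<psi> K"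
proof -
  define J where "J a b \<psi> = 1 - exp (- (a * \<psi> K + b * \<psi> L))" for a b :: real and \<psi> :: "'a set \<Rightarrow> real"
  define I where "I a b = (\<integral>\<psi>. J a b \<psi> \<partial>\<Lambda>)" for a b
  define E where "E a b = (\<integral>w. exp (- (a * \<Phi> K w + b * \<Phi> L w)) \<partial>M)" for a b
  have two: "(\<Sum>j<2. [a, b] ! j * f ([K, L] ! j)) = a * f K + b * f L" for a b :: real and f :: "'a set \<Rightarrow> real"
    by (simp add: eval_nat_numeral)
  have two\<Phi>: "(\<Sum>j<2. [a, b] ! j * \<Phi> ([K, L] ! j) w) = a * \<Phi> K w + b * \<Phi> L w" for a b w
    by (rule two)
  have cb2: "[K, L] ! j \<in> convex_bodies" if "j < 2" for j
    using that KL by (auto simp: less_2_cases_iff)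
  have nn2: "0 \<le> [a, b] ! j" if "j < 2" "0 \<le> a" "0 \<le> b" for j and a b :: real
    using that by (auto simp: less_2_cases_iff)
  have int: "integrable \<Lambda> (J a b)" if "0 \<le> a" "0 \<le> b" for a b
    using integrable_one_minus_exp[of 2 "(!) [K, L]" "(!) [a, b]", OF cb2 nn2] that unfolding two J_def
    by simp
  have E: "E a b = exp (- (a * \<phi> K + b * \<phi> L) - I a b)" if "0 \<le> a" "0 \<le> b" for a b
    using laplace[of 2 "(!) [K, L]" "(!) [a, b]", OF _ cb2 nn2] that unfolding two two\<Phi> J_def I_def E_def
    by simp
  \<comment> \<open>Increments are numbered from 1, so the nested sequence K, L, {} is read with the
    shift \<open>i - 1\<close>.\<close>
  define X where "X i w = \<Phi> ([K, L, {}] ! (i - 1)) w - \<Phi> ([K, L, {}] ! i) w" for i :: nat and w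
  have X: "X 1 w = \<Phi> K w - \<Phi> L w" "X (Suc 0) w = \<Phi> K w - \<Phi> L w" "X 2 w = \<Phi> L w - \<Phi> {} w" for w by (simp_all add: X_def eval_nat_numeral)
  have set2: "{1..2} = {1, 2::nat}" "{Suc 0..2} = {1, 2}" "{1..<2} = {1::nat}" by auto
  have "indep_vars (\<lambda>_. borel) X {1..2}"
    using ind[unfolded independent_increments_def, rule_format, of 2 "\<lambda>i. [K, L, {}] ! (i - 1)"] KL
    by (simp add: set2 X_def[abs_def] del: One_nat_def)
  from indep_vars_compose2[OF this, of "\<lambda>i x. exp (- (([a, a + b] ! (i - 1)) * x))" "\<lambda>_. borel" for a b]
  have iv: "indep_vars (\<lambda>_. borel) (\<lambda>i w. exp (- (([a, a + b] ! (i - 1)) * X i w))) {1..2}" for a b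
    by simp
  have Xm[measurable]: "\<Phi> K \<in> borel_measurable M" "\<Phi> L \<in> borel_measurable M" "\<Phi> {} \<in> borel_measurable M" using KL by auto
  have X1: "AE w in M. 0 \<le> X 1 w" using \<Phi>_mono[OF KL] by eventually_elim (simp add: X)
  have X2: "AE w in M. X 2 w = \<Phi> L w" using \<Phi>_empty by eventually_elim (simp add: X)
  have X2': "AE w in M. 0 \<le> X 2 w" using X2 \<Phi>_nonneg[OF KL(2)] by eventually_elim simp
  have ie: "integrable M (\<lambda>w. exp (- (c * X i w)))" if "i \<in> {1, 2}" "0 \<le> c" for c i
  proof (rule integrable_const_bound)
    have "AE w in M. 0 \<le> X i w" using that X1 X2' by auto
    then show "AE w in M. norm (exp (- (c * X i w))) \<le> 1" by eventually_elim (use that in simp)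
    show "(\<lambda>w. exp (- (c * X i w))) \<in> borel_measurable M" using that(1) by (auto simp: X)
  qed
  \<comment> \<open>a\<Phi>(K) + b\<Phi>(L) = a(\<Phi>(K) - \<Phi>(L)) + (a + b)\<Phi>(L), and the
    two parts are independent.\<close>
  have split: "E a b = (\<integral>w. exp (- (a * X 1 w)) \<partial>M) * E 0 (a + b)" if "0 \<le> a" "0 \<le> b" for a b
  proof -
    have "E a b = (\<integral>w. (\<Prod>i\<in>{1..2::nat}. exp (- (([a, a + b] ! (i - 1)) * X i w))) \<partial>M)"
      unfolding E_def
    proof (rule integral_cong_AE)
      show "AE w in M. exp (- (a * \<Phi> K w + b * \<Phi> L w)) = (\<Prod>i\<in>{1..2::nat}. exp (- (([a, a + b] ! (i - 1)) * X i w)))"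
        using X2 by eventually_elim (simp add: set2 exp_add[symmetric] X(1,2) algebra_simps)
    qed (simp_all add: set2 X)
    also have "\<dots> = (\<Prod>i\<in>{1..2::nat}. \<integral>w. exp (- (([a, a + b] ! (i - 1)) * X i w)) \<partial>M)"
      using that by (intro indep_vars_lebesgue_integral iv) (auto simp: set2 intro!: ie)
    also have "\<dots> = (\<integral>w. exp (- (a * X 1 w)) \<partial>M) * (\<integral>w. exp (- ((a + b) * X 2 w)) \<partial>M)"
      by (simp add: set2)
    also have "(\<integral>w. exp (- ((a + b) * X 2 w)) \<partial>M) = E 0 (a + b)"
      unfolding E_def
    proof (rule integral_cong_AE)
      show "AE w in M. exp (- ((a + b) * X 2 w)) = exp (- (0 * \<Phi> K w + (a + b) * \<Phi> L w))"
        using X2 by eventually_elim simp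
    qed (simp_all add: X)
    finally show ?thesis .
  qed
  \<comment> \<open>The factor of the first increment depends on \<open>a\<close> only. Comparing
    with \<open>b = 0\<close> eliminates it, and the deterministic terms cancel too.\<close>
  have rel: "I a b = I a 0 + I 0 (a + b) - I 0 a" if "0 \<le> a" "0 \<le> b" for a b
  proof -
    have "E a b * E 0 a = E a 0 * E 0 (a + b)"
      using split[OF that] split[of a 0] that by simp
    then have "exp (- (a * \<phi> K + b * \<phi> L) - I a b + (- (a * \<phi> L) - I 0 a)) =
      exp (- (a * \<phi> K) - I a 0 + (- ((a + b) * \<phi> L) - I 0 (a + b)))"
      using that by (simp add: E exp_add)
    then show ?thesis by (simp add: algebra_simps)
  qed
  \<comment> \<open>Non-negative on the path space, and zero exactly where \<psi>(K) = \<psi>(L) or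
    \<psi>(L) = 0. When it is expanded in the functions \<open>J\<close>, their constants 1 cancel,
    so it is integrable although \<Lambda> may be infinite.\<close>
  let ?f = "\<lambda>\<psi>. (exp (- \<psi> K) - exp (- \<psi> L))\<^sup>2 * (1 - exp (- \<psi> L)) :: real"
  have f: "?f = (\<lambda>\<psi>. J 2 1 \<psi> - J 2 0 \<psi> + 2 * J 1 1 \<psi> - 2 * J 1 2 \<psi> - J 0 2 \<psi> + J 0 3 \<psi>)"
  proof
    fix \<psi> :: "'a set \<Rightarrow> real"
    have "exp (- (real n * \<psi> K + real k * \<psi> L)) = exp (- \<psi> K) ^ n * exp (- \<psi> L) ^ k" for n k
      by (simp add: exp_of_nat_mult[symmetric] exp_add[symmetric])
    from this[of 2 1] this[of 2 0] this[of 1 1] this[of 1 2] this[of 0 2] this[of 0 3]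
    show "?f \<psi> = J 2 1 \<psi> - J 2 0 \<psi> + 2 * J 1 1 \<psi> - 2 * J 1 2 \<psi> - J 0 2 \<psi> + J 0 3 \<psi>"
      unfolding J_def by (simp add: power2_eq_square power3_eq_cube algebra_simps)
  qed
  have fi: "integrable \<Lambda> ?f" unfolding f
    by (intro Bochner_Integration.integrable_add Bochner_Integration.integrable_diff
      integrable_mult_right int) auto
  have nn: "AE \<psi> in \<Lambda>. 0 \<le> ?f \<psi>" using \<psi>_nonneg KL by (intro AE_I2) auto
  have "(\<integral>\<psi>. ?f \<psi> \<partial>\<Lambda>) = I 2 1 - I 2 0 + 2 * I 1 1 - 2 * I 1 2 - I 0 2 + I 0 3"
    unfolding f I_def by (simp add: int)
  also have "\<dots> = 0" using rel[of 2 1] rel[of 1 1] rel[of 1 2] by simp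
  finally have "AE \<psi> in \<Lambda>. ?f \<psi> = 0"
    using integral_nonneg_eq_0_iff_AE[OF fi nn] by (rule iffD1[rotated])
  then show ?thesis by eventually_elim auto
qed

lemma AE_levy_mono:
  assumes "independent_increments M \<Phi>" "K \<in> convex_bodies" "L \<in> convex_bodies" "L \<subseteq> K"
  shows "AE \<psi> in \<Lambda>. \<psi> L \<le> \<psi> K"
  using AE_levy_two_valued[OF assms] AE_space
  by eventually_elim (use \<psi>_nonneg assms in auto)

text \<open>Continuity of the paths and of \<open>\<phi>\<close> makes the exponents
  \<open>I (Ks n)\<close> converge to \<open>I K\<close>. A function that stays positive along
  \<open>Ks\<close> keeps the value at \<open>Ks 0\<close>; if it vanished at \<open>K\<close>, it
  would contribute the same positive amount to every difference
  \<open>I (Ks n) - I K\<close>.\<close>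

lemma AE_levy_continuous:
  assumes ind: "independent_increments M \<Phi>"
    and Ks: "\<And>n. Ks n \<in> convex_bodies" and K: "K \<in> convex_bodies" and dec: "decreases_to Ks K"
  shows "AE \<psi> in \<Lambda>. (\<forall>n. 0 < \<psi> (Ks n)) \<longrightarrow> 0 < \<psi> K"
proof -
  have int: "integrable \<Lambda> (\<lambda>\<psi>. 1 - exp (- \<psi> L))" if "L \<in> convex_bodies" for L
    using integrable_one_minus_exp[of 1 "\<lambda>_. L" "\<lambda>_. 1"] that by simp
  define I where "I L = (\<integral>\<psi>. 1 - exp (- \<psi> L) \<partial>\<Lambda>)" for L
  have lap: "(\<integral>w. exp (- \<Phi> L w) \<partial>M) = exp (- \<phi> L - I L)" if "L \<in> convex_bodies" for L
    using laplace[of 1 "\<lambda>_. L" "\<lambda>_. 1"] that by (simp add: I_def)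
  have "(\<lambda>n. \<integral>w. exp (- \<Phi> (Ks n) w) \<partial>M) \<longlonglongrightarrow> (\<integral>w. exp (- \<Phi> K w) \<partial>M)"
  proof (rule integral_dominated_convergence[where w="\<lambda>_. 1"])
    show "AE w in M. (\<lambda>n. exp (- \<Phi> (Ks n) w)) \<longlonglongrightarrow> exp (- \<Phi> K w)"
      using \<Phi>_LIMSEQ[OF image_subsetI K dec] by (rule eventually_mono) (use Ks in \<open>auto intro!: tendsto_intros\<close>)
    show "AE w in M. norm (exp (- \<Phi> (Ks n) w)) \<le> 1" for n
      using \<Phi>_nonneg[OF Ks[of n]] by eventually_elim simp
  qed (use Ks K in auto)
  then have l1: "(\<lambda>n. ln (exp (- \<phi> (Ks n) - I (Ks n)))) \<longlonglongrightarrow> ln (exp (- \<phi> K - I K))"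
    using Ks K by (intro tendsto_ln) (simp_all add: lap)
  have l2: "(\<lambda>n. \<phi> (Ks n)) \<longlonglongrightarrow> \<phi> K"
    using sigma_continuous_deterministic_part Ks K dec by (auto simp: sigma_continuous_def)
  have "(\<lambda>n. - (- \<phi> (Ks n) - I (Ks n)) - \<phi> (Ks n)) \<longlonglongrightarrow> - (- \<phi> K - I K) - \<phi> K"
    by (rule tendsto_diff[OF tendsto_minus[OF l1[unfolded ln_exp]] l2])
  then have "(\<lambda>n. I (Ks n)) \<longlonglongrightarrow> I K" by simp
  then have lim: "(\<lambda>n. I (Ks n) - I K) \<longlonglongrightarrow> 0" by (rule LIM_zero)
  define S where "S = {\<psi> \<in> space \<Lambda>. (\<forall>n. 0 < \<psi> (Ks n)) \<and> \<psi> K = 0}"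
  have [measurable]: "S \<in> sets \<Lambda>" unfolding S_def using Ks K by measurable
  \<comment> \<open>The amount contributed by the exceptional set \<open>S\<close>, a lower bound of
    the integrand of \<open>I (Ks n) - I K\<close> for every \<open>n\<close>.\<close>
  let ?g = "\<lambda>\<psi>. indicator S \<psi> * (1 - exp (- \<psi> (Ks 0)))"
  have gi: "integrable \<Lambda> ?g"
    using integrable_mult_indicator[OF \<open>S \<in> sets \<Lambda>\<close> int[OF Ks[of 0]]] by simp
  have "(\<integral>\<psi>. ?g \<psi> \<partial>\<Lambda>) \<le> I (Ks n) - I K" for n
  proof -
    have "(\<integral>\<psi>. ?g \<psi> \<partial>\<Lambda>) \<le> (\<integral>\<psi>. (1 - exp (- \<psi> (Ks n))) - (1 - exp (- \<psi> K)) \<partial>\<Lambda>)"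
    proof (rule integral_mono_AE)
      have "AE \<psi> in \<Lambda>. \<psi> (Ks n) = 0 \<or> \<psi> (Ks n) = \<psi> (Ks 0)"
        using dec by (intro AE_levy_two_valued ind Ks decreases_to_subset) auto
      moreover have "AE \<psi> in \<Lambda>. \<psi> K \<le> \<psi> (Ks n)"
        using dec by (intro AE_levy_mono ind Ks K decreases_to_subset)
      ultimately show "AE \<psi> in \<Lambda>. ?g \<psi> \<le> (1 - exp (- \<psi> (Ks n))) - (1 - exp (- \<psi> K))"
      proof eventually_elim
        case (elim \<psi>)
        show ?case
        proof (cases "\<psi> \<in> S")
          case True
          then have "0 < \<psi> (Ks n)" "\<psi> K = 0" by (auto simp: S_def)
          then show ?thesis using elim True by auto
        next
          case False
          then show ?thesis using elim by simp
        qed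
      qed
    qed (intro gi Bochner_Integration.integrable_diff int Ks K)+
    also have "\<dots> = I (Ks n) - I K" unfolding I_def
      by (intro Bochner_Integration.integral_diff int Ks K)
    finally show ?thesis .
  qed
  then have "(\<integral>\<psi>. ?g \<psi> \<partial>\<Lambda>) \<le> 0" using lim by (intro LIMSEQ_le_const) auto
  moreover have nn: "AE \<psi> in \<Lambda>. 0 \<le> ?g \<psi>" using \<psi>_nonneg[OF _ Ks] by (intro AE_I2) (auto simp: indicator_def)
  ultimately have "(\<integral>\<psi>. ?g \<psi> \<partial>\<Lambda>) = 0" using integral_nonneg_AE[OF nn] by linarith
  then have "AE \<psi> in \<Lambda>. ?g \<psi> = 0" using gi nn by (subst (asm) integral_nonneg_eq_0_iff_AE) auto
  then show ?thesis using AE_space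
  proof eventually_elim
    case (elim \<psi>)
    show ?case
    proof (intro impI)
      assume *: "\<forall>n. 0 < \<psi> (Ks n)"
      then have "\<psi> (Ks 0) \<noteq> 0" by (metis less_irrefl)
      then have "\<psi> \<notin> S" using elim(1) by (auto simp: indicator_def)
      then show "0 < \<psi> K" using * elim(2) \<psi>_nonneg[OF elim(2) K] by (auto simp: S_def)
    qed
  qed
qed

end

section \<open>Borel sets of the Fell topology\<close>

definition rational_vectors :: "'a::euclidean_space set" where
  "rational_vectors = {a. \<forall>i\<in>Basis. a \<bullet> i \<in> \<rat>}"

lemma countable_rational_vectors: "countable (rational_vectors :: 'a::euclidean_space set)"
proof -
  have "countable (Basis \<rightarrow>\<^sub>E (\<rat> :: real set) :: ('a \<Rightarrow> real) set)"
    by (intro countable_PiE countable_rat) simp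
  moreover have "rational_vectors \<subseteq> (\<lambda>f. \<Sum>i\<in>Basis. f i *\<^sub>R i) ` (Basis \<rightarrow>\<^sub>E \<rat> :: ('a \<Rightarrow> real) set)"
  proof
    fix a :: 'a assume "a \<in> rational_vectors"
    then have "restrict (\<lambda>i. a \<bullet> i) Basis \<in> Basis \<rightarrow>\<^sub>E \<rat>" by (auto simp: rational_vectors_def)
    moreover have "a = (\<Sum>i\<in>Basis. restrict (\<lambda>i. a \<bullet> i) Basis i *\<^sub>R i)"
      by (simp add: euclidean_representation)
    ultimately show "a \<in> (\<lambda>f. \<Sum>i\<in>Basis. f i *\<^sub>R i) ` (Basis \<rightarrow>\<^sub>E \<rat>)" by blast
  qed
  ultimately show ?thesis by (meson countable_image countable_subset)
qed

lemma rational_box_neighbourhood: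
  assumes "open U" "x \<in> U"
  obtains a b where "a \<in> rational_vectors" "b \<in> rational_vectors" "x \<in> box a b" "cbox a b \<subseteq> U"
proof -
  obtain e where e: "e > 0" "ball x e \<subseteq> U" using assms openE by blast
  obtain a b where ab: "\<forall>i\<in>Basis. a \<bullet> i \<in> \<rat> \<and> b \<bullet> i \<in> \<rat>" "x \<in> box a b" "box a b \<subseteq> ball x (e / 2)"
    using rational_boxes[of "e / 2" x] e(1) by auto
  have "cbox a b = closure (box a b)" using ab(2) by (subst closure_box) auto
  also have "\<dots> \<subseteq> closure (ball x (e / 2))" using ab(3) by (rule closure_mono)
  also have "\<dots> \<subseteq> ball x e" using e(1) by auto
  finally show ?thesis using ab e(2) by (intro that[of a b]) (auto simp: rational_vectors_def)
qed

abbreviation missing :: "'a::euclidean_space set \<Rightarrow> 'a set set" where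
  "missing C \<equiv> {F. closed F \<and> F \<inter> C = {}}"

abbreviation hitting :: "'a::euclidean_space set \<Rightarrow> 'a set set" where
  "hitting U \<equiv> {F. closed F \<and> F \<inter> U \<noteq> {}}"

text \<open>Countably many sets that suffice to build the Fell topology. Finite unions of boxes
  appear because a compact set disjoint from F is covered by finitely many boxes, not by
  one.\<close>

definition fell_subbase :: "'a::euclidean_space set set set" where
  "fell_subbase =
     (\<lambda>I. missing (\<Union>(a, b)\<in>I. cbox a b)) ` {I. finite I \<and> I \<subseteq> rational_vectors \<times> rational_vectors} \<union>
     (\<lambda>(a, b). hitting (box a b)) ` (rational_vectors \<times> rational_vectors)"

lemma countable_fell_subbase: "countable (fell_subbase :: 'a::euclidean_space set set set)"
  unfolding fell_subbase_def
  by (intro countable_Un countable_image countable_Collect_finite_subset countable_SIGMA countable_rational_vectors)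

lemma topspace_fell: "topspace fell_topology = {F. closed F}"
proof -
  have "missing {} \<in> {missing K | K :: 'a set. compact K}" by (intro CollectI exI[of _ "{}"]) auto
  then have "missing {} \<subseteq> topspace (fell_topology :: 'a set topology)"
    unfolding fell_topology_def topology_generated_by_topspace by (intro Union_upper UnI1)
  moreover have "topspace fell_topology \<subseteq> {F :: 'a set. closed F}"
    unfolding fell_topology_def topology_generated_by_topspace by auto
  ultimately show ?thesis by auto
qed

lemma openin_fell:
  "compact C \<Longrightarrow> openin fell_topology (missing C)" "open U \<Longrightarrow> openin fell_topology (hitting U)"
  unfolding fell_topology_def openin_topology_generated_by_iff
  by (rule generate_topology_on.Basis, blast)+

text \<open>If F misses a compact set, finitely many rational boxes inside the complement of F cover
  that set; if F hits an open set, one rational box around a common point witnesses it. Finite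
  intersections and unions preserve the property.\<close>

lemma fell_open_nhd:
  assumes "openin fell_topology W" "F \<in> W"
  obtains S where "finite S" "S \<subseteq> fell_subbase" "F \<in> \<Inter>S" "{F. closed F} \<inter> \<Inter>S \<subseteq> W"
proof -
  have "\<exists>S. finite S \<and> S \<subseteq> fell_subbase \<and> F \<in> \<Inter>S \<and> {F. closed F} \<inter> \<Inter>S \<subseteq> W"
    using assms unfolding fell_topology_def openin_topology_generated_by_iff
  proof (induction rule: generate_topology_on.induct)
    case (Int V W)
    then have "F \<in> V" "F \<in> W" by auto
    obtain S where S: "finite S" "S \<subseteq> fell_subbase" "F \<in> \<Inter>S" "{F. closed F} \<inter> \<Inter>S \<subseteq> V"
      using Int.IH(1)[OF \<open>F \<in> V\<close>] by (elim exE conjE)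
    obtain T where T: "finite T" "T \<subseteq> fell_subbase" "F \<in> \<Inter>T" "{F. closed F} \<inter> \<Inter>T \<subseteq> W"
      using Int.IH(2)[OF \<open>F \<in> W\<close>] by (elim exE conjE)
    have "{F. closed F} \<inter> \<Inter>(S \<union> T) \<subseteq> V \<inter> W" using S(4) T(4) by auto
    then show ?case using S T by (intro exI[of _ "S \<union> T"] conjI) auto
  next
    case (UN \<K>)
    then obtain W where W: "W \<in> \<K>" "F \<in> W" by blast
    obtain S where S: "finite S" "S \<subseteq> fell_subbase" "F \<in> \<Inter>S" "{F. closed F} \<inter> \<Inter>S \<subseteq> W"
      using UN.IH[OF W] by (elim exE conjE)
    have "{F. closed F} \<inter> \<Inter>S \<subseteq> \<Union>\<K>" using S(4) W(1) by auto
    then show ?case using S by (intro exI[of _ S] conjI)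
  next
    case (Basis W)
    then consider C where "compact C" "W = missing C" | U where "open U" "W = hitting U" by blast
    then show ?case
    proof cases
      case 1
      have F: "open (- F)" "F \<inter> C = {}" using Basis.prems 1 by auto
      let ?R = "rational_vectors \<times> rational_vectors :: ('a \<times> 'a) set"
      let ?\<B> = "{p \<in> ?R. cbox (fst p) (snd p) \<subseteq> - F}"
      have cov: "C \<subseteq> (\<Union>p\<in>?\<B>. box (fst p) (snd p))"
      proof
        fix x assume "x \<in> C"
        then have "x \<in> - F" using F(2) by blast
        with F(1) obtain a b where "a \<in> rational_vectors" "b \<in> rational_vectors" "x \<in> box a b" "cbox a b \<subseteq> - F"
          by (rule rational_box_neighbourhood)
        then show "x \<in> (\<Union>p\<in>?\<B>. box (fst p) (snd p))" by (intro UN_I[of "(a, b)"]) auto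
      qed
      obtain I where I: "I \<subseteq> ?\<B>" "finite I" "C \<subseteq> (\<Union>p\<in>I. box (fst p) (snd p))"
        by (rule compactE_image[OF 1(1) _ cov]) (auto simp: open_box)
      have "(\<Union>p\<in>I. box (fst p) (snd p)) \<subseteq> (\<Union>p\<in>I. cbox (fst p) (snd p))"
        by (intro UN_mono box_subset_cbox order_refl)
      with I(3) have CI: "C \<subseteq> (\<Union>(a, b)\<in>I. cbox a b)" by (simp add: case_prod_beta)
      have "(\<Union>p\<in>I. cbox (fst p) (snd p)) \<subseteq> - F" using I(1) by (intro UN_least) auto
      then have "F \<inter> (\<Union>(a, b)\<in>I. cbox a b) = {}" by (auto simp: case_prod_beta)
      moreover have "missing (\<Union>(a, b)\<in>I. cbox a b) \<in> fell_subbase"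
        unfolding fell_subbase_def using I(1,2) by (intro UnI1 image_eqI[of _ _ I]) auto
      ultimately show ?thesis using Basis.prems 1 CI
        by (intro exI[of _ "{missing (\<Union>(a, b)\<in>I. cbox a b)}"] conjI) auto
    next
      case 2
      then obtain x where x: "x \<in> F" "x \<in> U" using Basis.prems by auto
      obtain a b where ab: "a \<in> rational_vectors" "b \<in> rational_vectors" "x \<in> box a b" "cbox a b \<subseteq> U"
        using rational_box_neighbourhood[OF 2(1) x(2)] by blast
      then have "hitting (box a b) \<in> fell_subbase" unfolding fell_subbase_def by (intro UnI2 image_eqI[of _ _ "(a, b)"]) auto
      then show ?thesis using ab x Basis.prems 2 box_subset_cbox[of a b]
        by (intro exI[of _ "{hitting (box a b)}"] conjI) auto
    qed
  qed simp
  then show ?thesis using that by (elim exE conjE)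
qed

section \<open>Measurable maps into and out of the marked sets\<close>

lemma topspace_marked_sets: "topspace marked_sets = closed_convex_sets \<times> {0<..}"
  by (auto simp: marked_sets_def topspace_fell closed_convex_sets_def)

lemma space_borel_of [simp]: "space (borel_of X) = topspace X"
  unfolding borel_of_def by (simp add: space_measure_of_conv)

lemma sets_borel_of: "sets (borel_of X) = sigma_sets (topspace X) {U. openin X U}"
  unfolding borel_of_def by (rule sets_measure_of) (auto dest: openin_subset)

lemma openin_borel_of: "openin X U \<Longrightarrow> U \<in> sets (borel_of X)"
  by (auto simp: sets_borel_of)

text \<open>Every open set of \<open>marked_sets\<close> is a countable union of products of a
  finite intersection from \<open>fell_subbase\<close> with a rational interval, so hit and miss
  events decide measurability.\<close>

lemma measurable_marked_setsI:
  fixes f :: "'b \<Rightarrow> 'a::euclidean_space set" and r :: "'b \<Rightarrow> real"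
  assumes f: "\<And>x. x \<in> space N \<Longrightarrow> f x \<in> closed_convex_sets" and r: "\<And>x. x \<in> space N \<Longrightarrow> 0 < r x"
    and rm[measurable]: "r \<in> borel_measurable N"
    and miss: "\<And>C. compact C \<Longrightarrow> {x \<in> space N. f x \<inter> C = {}} \<in> sets N"
    and hit: "\<And>U. open U \<Longrightarrow> {x \<in> space N. f x \<inter> U \<noteq> {}} \<in> sets N"
  shows "(\<lambda>x. (f x, r x)) \<in> measurable N (borel_of marked_sets)"
  unfolding borel_of_def
proof (rule measurable_measure_of)
  show "{U. openin marked_sets U} \<subseteq> Pow (topspace marked_sets)" by (auto dest: openin_subset)
  show "(\<lambda>x. (f x, r x)) \<in> space N \<rightarrow> topspace marked_sets" using f r by (auto simp: topspace_marked_sets)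
  have cl: "closed (f x)" if "x \<in> space N" for x using f[OF that] by (simp add: closed_convex_sets_def)
  have sub: "{x \<in> space N. f x \<in> B} \<in> sets N" if B: "B \<in> fell_subbase" for B
  proof -
    from B show ?thesis unfolding fell_subbase_def
    proof (elim UnE imageE)
      fix I :: "('a \<times> 'a) set" assume I: "B = missing (\<Union>(a, b)\<in>I. cbox a b)"
        "I \<in> {I. finite I \<and> I \<subseteq> rational_vectors \<times> rational_vectors}"
      then have "{x \<in> space N. f x \<in> B} = {x \<in> space N. f x \<inter> (\<Union>(a, b)\<in>I. cbox a b) = {}}" using cl by auto
      moreover have "compact (\<Union>(a, b)\<in>I. cbox a b)" using I by (intro compact_UN) (auto intro: compact_cbox)
      ultimately show ?thesis using miss by simp
    next
      fix p assume "B = (case p of (a, b) \<Rightarrow> hitting (box a b))"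
      then have "{x \<in> space N. f x \<in> B} = {x \<in> space N. f x \<inter> box (fst p) (snd p) \<noteq> {}}"
        using cl by (auto split: prod.splits)
      then show ?thesis using hit[OF open_box] by simp
    qed
  qed
  fix W :: "('a set \<times> real) set" assume "W \<in> {U. openin marked_sets U}"
  then have W: "openin marked_sets W" by simp
  let ?J = "{S. finite S \<and> S \<subseteq> fell_subbase} \<times> (\<rat> \<times> \<rat>) :: ('a set set set \<times> (real \<times> real)) set"
  let ?E = "\<lambda>(S, p, q). (closed_convex_sets \<inter> \<Inter>S) \<times> ({p<..<q} \<inter> {0<..})"
  let ?P = "\<lambda>(S, p, q). {x \<in> space N. (\<forall>B\<in>S. f x \<in> B) \<and> p < r x \<and> r x < q}"
  have cnt: "countable ?J"
    by (intro countable_SIGMA countable_Collect_finite_subset countable_fell_subbase countable_rat)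
  have "\<exists>j\<in>?J. ?E j \<subseteq> W \<and> (F, t) \<in> ?E j" if Ft: "(F, t) \<in> W" for F t
  proof -
    obtain U V where UV: "openin (subtopology fell_topology closed_convex_sets) U"
      "openin (top_of_set {0<..}) V" "F \<in> U" "t \<in> V" "U \<times> V \<subseteq> W"
      using W[unfolded marked_sets_def openin_prod_topology_alt, rule_format, OF Ft] by (elim exE conjE)
    obtain U' where U': "openin fell_topology U'" "U = U' \<inter> closed_convex_sets"
      using UV(1) by (auto simp: openin_subtopology)
    obtain V' where V': "open V'" "V = V' \<inter> {0<..}"
      using UV(2) by (auto simp: openin_open)
    have F: "F \<in> U'" "F \<in> closed_convex_sets" and t: "t \<in> V'" "0 < t" using UV U' V' by auto
    obtain S where S: "finite S" "S \<subseteq> fell_subbase" "F \<in> \<Inter>S" "{F. closed F} \<inter> \<Inter>S \<subseteq> U'"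
      using fell_open_nhd[OF U'(1) F(1)] .
    obtain e where e: "e > 0" "ball t e \<subseteq> V'" using V'(1) t(1) openE by blast
    obtain p where p: "p \<in> \<rat>" "t - e < p" "p < t" using Rats_dense_in_real[of "t - e" t] e(1) by auto
    obtain q where q: "q \<in> \<rat>" "t < q" "q < t + e" using Rats_dense_in_real[of t "t + e"] e(1) by auto
    have "{p<..<q} \<subseteq> V'" using e(2) p q by (auto simp: dist_real_def subset_iff)
    moreover have "closed_convex_sets \<inter> \<Inter>S \<subseteq> U" using S(4) U'(2) by (auto simp: closed_convex_sets_def)
    ultimately have "(closed_convex_sets \<inter> \<Inter>S) \<times> ({p<..<q} \<inter> {0<..}) \<subseteq> U \<times> V" using V'(2) by blast
    then show ?thesis using UV(5) S F t p q by (intro bexI[of _ "(S, p, q)"]) auto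
  qed
  then have "(\<lambda>x. (f x, r x)) -` W \<inter> space N = (\<Union>j\<in>{j\<in>?J. ?E j \<subseteq> W}. ?P j)" (is "?L = ?R")
  proof (intro equalityI subsetI)
    assume ex: "\<And>F t. (F, t) \<in> W \<Longrightarrow> \<exists>j\<in>?J. ?E j \<subseteq> W \<and> (F, t) \<in> ?E j"
    fix x assume x: "x \<in> ?L"
    then obtain j where j: "j \<in> ?J" "?E j \<subseteq> W" "(f x, r x) \<in> ?E j" using ex[of "f x" "r x"] by auto
    obtain S p q where "j = (S, p, q)" by (cases j) auto
    then show "x \<in> ?R" using j x by (intro UN_I[of j]) auto
  next
    fix x assume "x \<in> ?R"
    then obtain j where j: "j \<in> ?J" "?E j \<subseteq> W" "x \<in> ?P j" by blast
    obtain S p q where "j = (S, p, q)" by (cases j) auto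
    then have "(f x, r x) \<in> ?E j" "x \<in> space N" using j f r by auto
    then show "x \<in> ?L" using j(2) by auto
  qed
  moreover have "?P j \<in> sets N" if j: "j \<in> ?J" for j
  proof -
    obtain S p q where jS: "j = (S, p, q)" "finite S" "S \<subseteq> fell_subbase" using j by (cases j) auto
    have "{x \<in> space N. \<forall>B\<in>S. f x \<in> B} \<in> sets N"
      using jS sub by (intro sets.sets_Collect_finite_All) auto
    moreover have "{x \<in> space N. p < r x} \<in> sets N" "{x \<in> space N. r x < q} \<in> sets N" by measurable
    ultimately have "{x \<in> space N. \<forall>B\<in>S. f x \<in> B} \<inter> ({x \<in> space N. p < r x} \<inter> {x \<in> space N. r x < q}) \<in> sets N"
      by (intro sets.Int)
    moreover have "{x \<in> space N. \<forall>B\<in>S. f x \<in> B} \<inter> ({x \<in> space N. p < r x} \<inter> {x \<in> space N. r x < q}) = ?P j"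
      using jS(1) by auto
    ultimately show ?thesis by simp
  qed
  ultimately show "(\<lambda>x. (f x, r x)) -` W \<inter> space N \<in> sets N"
    using cnt by (auto intro!: sets.countable_UN' countable_Collect simp del: mem_Times_iff)
qed

lemma measurable_hit:
  assumes K: "K \<in> convex_bodies"
  shows "(\<lambda>p. snd p * of_bool (K \<inter> fst p \<noteq> {})) \<in> borel_measurable (borel_of marked_sets)"
proof -
  let ?X = "borel_of (marked_sets :: ('a set \<times> real) topology)"
  have snd: "snd \<in> borel_measurable ?X"
  proof (rule borel_measurableI_greater)
    fix y :: real
    have "openin marked_sets (closed_convex_sets \<times> {max 0 y<..} :: ('a set \<times> real) set)"
      unfolding marked_sets_def openin_prod_Times_iff
      by (auto simp: openin_subtopology topspace_fell closed_convex_sets_def openin_open intro!: exI[of _ "{max 0 y<..}"] exI[of _ "topspace fell_topology"])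
    moreover have "closed_convex_sets \<times> {max 0 y<..} = {w \<in> space ?X. y < snd w}" by (auto simp: topspace_marked_sets)
    ultimately show "{w \<in> space ?X. y < snd w} \<in> sets ?X" by (metis openin_borel_of)
  qed
  have "compact K" using K by (simp add: convex_bodies_def)
  then have "openin (subtopology fell_topology closed_convex_sets) (missing K \<inter> closed_convex_sets)"
    unfolding openin_subtopology using openin_fell(1) by blast
  then have "openin marked_sets ((missing K \<inter> closed_convex_sets) \<times> {0<..})"
    unfolding marked_sets_def openin_prod_Times_iff by simp
  moreover have "(missing K \<inter> closed_convex_sets) \<times> {0<..} = {p \<in> space ?X. \<not> K \<inter> fst p \<noteq> {}}"
    by (auto simp: topspace_marked_sets closed_convex_sets_def)
  ultimately have "{p \<in> space ?X. \<not> K \<inter> fst p \<noteq> {}} \<in> sets ?X" by (metis openin_borel_of)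
  then have "Measurable.pred ?X (\<lambda>p. \<not> K \<inter> fst p \<noteq> {})" by (simp add: pred_def)
  then have "Measurable.pred ?X (\<lambda>p. K \<inter> fst p \<noteq> {})" using pred_intros_logic(2) by force
  with snd show ?thesis by measurable
qed

lemma measurable_hit_function: "hit_function \<in> measurable (borel_of marked_sets) path_space"
  unfolding path_space_def
proof (rule measurable_PiM_single')
  fix K :: "'a set" assume K: "K \<in> convex_bodies"
  have "(\<lambda>p. hit_function p K) = (\<lambda>p. snd p * of_bool (K \<inter> fst p \<noteq> {}))"
    using K by (auto simp: hit_function_def split: prod.split)
  then show "(\<lambda>p. hit_function p K) \<in> measurable (borel_of marked_sets) (restrict_space borel {0..})"
    using measurable_hit[OF K] by (auto simp: measurable_restrict_space2_iff topspace_marked_sets)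
qed (auto simp: hit_function_def topspace_marked_sets space_restrict_space split: prod.splits if_splits)

section \<open>The closed set of a two-valued function\<close>

definition lower :: "'a::euclidean_space \<Rightarrow> real \<Rightarrow> 'a set" where "lower i q = {x. x \<bullet> i \<le> q}"
definition upper :: "'a::euclidean_space \<Rightarrow> real \<Rightarrow> 'a set" where "upper i q = {x. q \<le> x \<bullet> i}"

definition halfspaces :: "'a::euclidean_space set set" where
  "halfspaces = (\<lambda>(i, q). lower i q) ` (Basis \<times> \<rat>) \<union> (\<lambda>(i, q). upper i q) ` (Basis \<times> \<rat>)"

text \<open>Closing a family under cuts by rational coordinate half-spaces keeps it countable, so
  the null sets of all its members can be collected into one.\<close>

definition cuts :: "'a::euclidean_space set set \<Rightarrow> 'a set set" where
  "cuts \<P> = (\<lambda>(P, S). P \<inter> \<Inter>S) ` (\<P> \<times> {S. finite S \<and> S \<subseteq> halfspaces})"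

definition rational_boxes :: "'a::euclidean_space set set" where
  "rational_boxes = (\<lambda>(a, b). cbox a b) ` (rational_vectors \<times> rational_vectors)"

text \<open>What the geometric arguments need of \<psi>, demanded on a family \<E> only: for a
  countable family of cuts it holds almost everywhere. The last clause is the valuation property for
  cutting a body in two.\<close>

definition tame :: "('a::euclidean_space set \<Rightarrow> real) \<Rightarrow> 'a set set \<Rightarrow> bool" where
  "tame \<psi> \<E> \<longleftrightarrow> \<psi> {} = 0 \<and> (\<forall>K\<in>\<E>. 0 \<le> \<psi> K) \<and>
     (\<forall>K\<in>\<E>. \<forall>L\<in>\<E>. L \<subseteq> K \<longrightarrow> \<psi> L = 0 \<or> \<psi> L = \<psi> K) \<and>
     (\<forall>K\<in>\<E>. \<forall>i\<in>Basis. \<forall>q\<in>\<rat>.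
        \<psi> K + \<psi> (K \<inter> lower i q \<inter> upper i q) = \<psi> (K \<inter> lower i q) + \<psi> (K \<inter> upper i q))"

text \<open>Membership is tested with open boxes, which makes the set closed; \<psi> is evaluated at
  the closed ones, since its arguments are compact.\<close>

definition hit_set :: "('a::euclidean_space set \<Rightarrow> real) \<Rightarrow> 'a set" where
  "hit_set \<psi> = {x. \<forall>a\<in>rational_vectors. \<forall>b\<in>rational_vectors. x \<in> box a b \<longrightarrow> 0 < \<psi> (cbox a b)}"

lemma closed_convex_halfspace:
  assumes "H \<in> halfspaces" shows "closed H" "convex H"
  using assms by (auto simp: halfspaces_def lower_def upper_def inner_commute[of _ "_ :: 'a"]
    closed_halfspace_le closed_halfspace_ge convex_halfspace_le convex_halfspace_ge)

lemma halfspaces_memI: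
  "i \<in> Basis \<Longrightarrow> q \<in> \<rat> \<Longrightarrow> lower i q \<in> halfspaces" "i \<in> Basis \<Longrightarrow> q \<in> \<rat> \<Longrightarrow> upper i q \<in> halfspaces"
  unfolding halfspaces_def by force+

lemma cuts_base: "K \<in> \<P> \<Longrightarrow> K \<in> cuts \<P>"
  unfolding cuts_def by (rule image_eqI[of _ _ "(K, {})"]) auto

lemma cuts_Int: assumes "K \<in> cuts \<P>" "H \<in> halfspaces" shows "K \<inter> H \<in> cuts \<P>"
proof -
  obtain P S where "K = P \<inter> \<Inter>S" "P \<in> \<P>" "finite S" "S \<subseteq> halfspaces" using assms(1) by (auto simp: cuts_def)
  then show ?thesis unfolding cuts_def using assms(2)
    by (intro image_eqI[of _ _ "(P, insert H S)"]) auto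
qed

lemma countable_cuts: assumes "countable \<P>" shows "countable (cuts \<P>)"
proof -
  have "countable (halfspaces :: 'a set set)"
    unfolding halfspaces_def by (intro countable_Un countable_image countable_SIGMA countable_rat countable_finite) auto
  then show ?thesis unfolding cuts_def
    by (intro countable_image countable_SIGMA countable_Collect_finite_subset assms)
qed

lemma cuts_convex_bodies: assumes "\<P> \<subseteq> convex_bodies" shows "cuts \<P> \<subseteq> convex_bodies"
proof
  fix K assume "K \<in> cuts \<P>"
  then obtain P S where K: "K = P \<inter> \<Inter>S" "P \<in> \<P>" "S \<subseteq> halfspaces" by (auto simp: cuts_def)
  have "closed (\<Inter>S)" "convex (\<Inter>S)" using K(3) closed_convex_halfspace
    by (auto intro!: closed_Inter convex_Inter)
  then show "K \<in> convex_bodies" using K(1,2) assms by (auto simp: convex_bodies_def intro!: compact_Int_closed convex_Int)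
qed

lemma countable_rational_boxes: "countable rational_boxes"
  unfolding rational_boxes_def by (intro countable_image countable_SIGMA countable_rational_vectors)

lemma rational_boxes_convex_bodies: "rational_boxes \<subseteq> convex_bodies"
  by (auto simp: rational_boxes_def convex_bodies_def intro: compact_cbox convex_box)

lemma cbox_rational_boxes: "a \<in> rational_vectors \<Longrightarrow> b \<in> rational_vectors \<Longrightarrow> cbox a b \<in> rational_boxes"
  unfolding rational_boxes_def by (rule image_eqI[of _ _ "(a, b)"]) auto

section \<open>Charged bodies meet the hit set\<close>

lemma tame_pos_mono:
  assumes "tame \<psi> \<E>" "K \<in> \<E>" "L \<in> \<E>" "L \<subseteq> K" "0 < \<psi> L" shows "\<psi> K = \<psi> L"
  using assms unfolding tame_def by (metis less_irrefl)

lemma hit_set_pos: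
  assumes t: "tame \<psi> \<E>" and L: "L \<in> \<E>" and B: "rational_boxes \<subseteq> \<E>"
    and x: "x \<in> hit_set \<psi>" and U: "open U" "x \<in> U" "U \<subseteq> L"
  shows "0 < \<psi> L"
proof -
  obtain a b where ab: "a \<in> rational_vectors" "b \<in> rational_vectors" "x \<in> box a b" "cbox a b \<subseteq> U"
    using rational_box_neighbourhood[OF U(1,2)] .
  have "0 < \<psi> (cbox a b)" using x ab unfolding hit_set_def by blast
  then show ?thesis using tame_pos_mono[OF t L, of "cbox a b"] ab B U(3) cbox_rational_boxes[OF ab(1,2)] by auto
qed

lemma closed_hit_set: "closed (hit_set \<psi>)"
proof -
  have "- hit_set \<psi> = (\<Union>p\<in>{p \<in> rational_vectors \<times> rational_vectors. \<not> 0 < \<psi> (cbox (fst p) (snd p))}. box (fst p) (snd p))"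
    unfolding hit_set_def by fastforce
  then have "open (- hit_set \<psi>)" by (auto intro!: open_UN open_box)
  then show ?thesis by (simp add: closed_def)
qed

text \<open>Cutting a body successively by all rational coordinate hyperplanes, always keeping a part on
  which \<open>\<psi>\<close> is positive, shrinks it to a point of \<open>hit_set \<psi>\<close>.\<close>

lemma hit_set_meets:
  assumes t: "tame \<psi> (cuts \<P>)" and K: "K \<in> \<P>" "compact K" and B: "rational_boxes \<subseteq> \<P>" and pos: "0 < \<psi> K"
  shows "hit_set \<psi> \<inter> K \<noteq> {}"
proof -
  have t0: "\<psi> {} = 0" and tn: "\<And>K. K \<in> cuts \<P> \<Longrightarrow> 0 \<le> \<psi> K"
    and tc: "\<And>K i q. K \<in> cuts \<P> \<Longrightarrow> i \<in> Basis \<Longrightarrow> q \<in> \<rat> \<Longrightarrow>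
      \<psi> K + \<psi> (K \<inter> lower i q \<inter> upper i q) = \<psi> (K \<inter> lower i q) + \<psi> (K \<inter> upper i q)"
    using t by (auto simp: tame_def)
  let ?C = "Basis \<times> \<rat> :: ('a \<times> real) set"
  define e where "e = from_nat_into ?C"
  have ne: "?C \<noteq> {}" using nonempty_Basis Rats_0 by blast
  have cnt: "countable ?C" by (intro countable_SIGMA countable_rat countable_finite) auto
  have e: "fst (e n) \<in> Basis" "snd (e n) \<in> \<rat>" for n
    using from_nat_into[OF ne, of n] by (auto simp: e_def mem_Times_iff)
  have e_surj: "\<exists>n. e n = (i, q)" if "i \<in> Basis" "q \<in> \<rat>" for i q
    using from_nat_into_surj[OF cnt, of "(i, q)"] that by (auto simp: e_def)
  define C where "C = rec_nat K (\<lambda>n P. if 0 < \<psi> (P \<inter> lower (fst (e n)) (snd (e n)))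
     then P \<inter> lower (fst (e n)) (snd (e n)) else P \<inter> upper (fst (e n)) (snd (e n)))"
  have C0: "C 0 = K" and CS: "C (Suc n) = (if 0 < \<psi> (C n \<inter> lower (fst (e n)) (snd (e n)))
     then C n \<inter> lower (fst (e n)) (snd (e n)) else C n \<inter> upper (fst (e n)) (snd (e n)))" for n
    by (simp_all add: C_def)
  have C: "C n \<in> cuts \<P> \<and> 0 < \<psi> (C n) \<and> compact (C n)" for n
  proof (induction n)
    case 0
    then show ?case using K pos by (simp add: C0 cuts_base)
  next
    case (Suc n)
    let ?l = "lower (fst (e n)) (snd (e n))" and ?u = "upper (fst (e n)) (snd (e n))"
    have lu: "C n \<inter> ?l \<in> cuts \<P>" "C n \<inter> ?u \<in> cuts \<P>" "C n \<inter> ?l \<inter> ?u \<in> cuts \<P>"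
      using Suc e by (auto intro!: cuts_Int halfspaces_memI)
    have "compact (C n \<inter> ?l)" "compact (C n \<inter> ?u)"
      using Suc closed_convex_halfspace(1)[OF halfspaces_memI(1)[OF e]]
        closed_convex_halfspace(1)[OF halfspaces_memI(2)[OF e]]
      by (auto intro!: compact_Int_closed)
    \<comment> \<open>If the lower part has value 0, the cut relation gives the upper part at least
      the value of \<open>C n\<close>, as the slice has a non-negative value.\<close>
    moreover have "0 < \<psi> (C n \<inter> ?u)" if "\<not> 0 < \<psi> (C n \<inter> ?l)"
      using that tc[OF conjunct1[OF Suc] e(1)[of n] e(2)[of n]] conjunct1[OF conjunct2[OF Suc]]
        tn[OF lu(3)] by linarith
    ultimately show ?case using lu by (auto simp: CS)
  qed
  have dec: "C n \<subseteq> C m" if "m \<le> n" for m n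
    using that by (rule lift_Suc_antimono_le[rotated]) (auto simp: CS)
  have "\<Inter>(range C) \<noteq> {}"
  proof (rule compact_nest)
    show "C n \<noteq> {}" for n using C[of n] t0 by auto
  qed (use C dec in auto)
  then obtain x where x: "\<And>n. x \<in> C n" by auto
  have "x \<in> hit_set \<psi>" unfolding hit_set_def
  proof (intro CollectI ballI impI)
    fix a b :: 'a assume ab: "a \<in> rational_vectors" "b \<in> rational_vectors" "x \<in> box a b"
    \<comment> \<open>The hyperplanes through the faces of the box occur in the enumeration. As
      \<open>x\<close> lies strictly on their inner sides and in every \<open>C n\<close>, the part
      kept there was the inner one.\<close>
    have "\<exists>n. C n \<subseteq> upper i (a \<bullet> i) \<inter> lower i (b \<bullet> i)" if i: "i \<in> Basis" for i
    proof -
      have x_ab: "a \<bullet> i < x \<bullet> i" "x \<bullet> i < b \<bullet> i" using ab(3) i by (auto simp: mem_box)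
      obtain m where m: "e m = (i, a \<bullet> i)" using e_surj ab(1) i unfolding rational_vectors_def by blast
      obtain n where n: "e n = (i, b \<bullet> i)" using e_surj ab(2) i unfolding rational_vectors_def by blast
      have "C (Suc m) \<subseteq> upper i (a \<bullet> i)" using x[of "Suc m"] x_ab m by (auto simp: CS lower_def split: if_splits)
      moreover have "C (Suc n) \<subseteq> lower i (b \<bullet> i)" using x[of "Suc n"] x_ab n by (auto simp: CS upper_def split: if_splits)
      ultimately have "C (max (Suc m) (Suc n)) \<subseteq> upper i (a \<bullet> i) \<inter> lower i (b \<bullet> i)"
        using dec[of "Suc m" "max (Suc m) (Suc n)"] dec[of "Suc n" "max (Suc m) (Suc n)"] by auto
      then show ?thesis by blast
    qed
    then obtain N where N: "\<And>i. i \<in> Basis \<Longrightarrow> C (N i) \<subseteq> upper i (a \<bullet> i) \<inter> lower i (b \<bullet> i)" by metis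
    have sub: "C (Max (N ` Basis)) \<subseteq> cbox a b"
    proof
      fix y assume y: "y \<in> C (Max (N ` Basis))"
      have "y \<in> upper i (a \<bullet> i) \<inter> lower i (b \<bullet> i)" if "i \<in> Basis" for i
        using N[OF that] dec[of "N i" "Max (N ` Basis)"] y that by auto
      then show "y \<in> cbox a b" by (auto simp: mem_box upper_def lower_def)
    qed
    show "0 < \<psi> (cbox a b)"
      using tame_pos_mono[OF t cuts_base _ sub] C[of "Max (N ` Basis)"] B cbox_rational_boxes[OF ab(1,2)] by auto
  qed
  then show ?thesis using x[of 0] C0 by auto
qed

text \<open>Countably many bodies that join small boxes around two given points; they are the test
  bodies for convexity of the hit set.\<close>

definition box_hulls :: "'a::euclidean_space set set" where
  "box_hulls = (\<lambda>(P, Q). convex hull (P \<union> Q)) ` (rational_boxes \<times> rational_boxes)"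

lemma countable_box_hulls: "countable box_hulls"
  unfolding box_hulls_def by (intro countable_image countable_SIGMA countable_rational_boxes)

lemma box_hulls_convex_bodies: "box_hulls \<subseteq> convex_bodies"
  using rational_boxes_convex_bodies
  by (auto simp: box_hulls_def convex_bodies_def convex_convex_hull intro!: compact_convex_hull compact_Un)

text \<open>Points of the hull are within \<delta> of the segment from x to y. Along the segment the
  i-th coordinate changes at rate m, so a segment point whose coordinate differs from that of z by
  at most 2\<delta> is within 2\<delta>/m of z in the parameter.\<close>

lemma segment_slab:
  fixes x y z :: "'a::euclidean_space"
  assumes \<delta>: "0 < \<delta>" and i: "i \<in> Basis" and z: "z = (1 - s) *\<^sub>R x + s *\<^sub>R y" and m: "0 < m" "m = (y - x) \<bullet> i"
    and zq: "\<bar>z \<bullet> i - q\<bar> \<le> \<delta>" and w: "w \<in> convex hull (ball x \<delta> \<union> ball y \<delta>)" "w \<bullet> i = q"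
  shows "dist z w \<le> \<delta> + 2 * \<delta> * norm (y - x) / m"
proof -
  let ?S = "\<Union>u\<in>closed_segment x y. \<Union>v\<in>cball 0 \<delta>. {u + v}"
  have "ball x \<delta> \<subseteq> ?S"
  proof
    fix p assume "p \<in> ball x \<delta>"
    then show "p \<in> ?S" by (intro UN_I[of x] UN_I[of "p - x"]) (auto simp: dist_norm norm_minus_commute)
  qed
  moreover have "ball y \<delta> \<subseteq> ?S"
  proof
    fix p assume "p \<in> ball y \<delta>"
    then show "p \<in> ?S" by (intro UN_I[of y] UN_I[of "p - y"]) (auto simp: dist_norm norm_minus_commute)
  qed
  moreover have "convex ?S" by (intro convex_sums convex_closed_segment convex_cball)
  ultimately have "convex hull (ball x \<delta> \<union> ball y \<delta>) \<subseteq> ?S" by (intro hull_minimal) auto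
  then obtain u v where uv: "u \<in> closed_segment x y" "norm v \<le> \<delta>" "w = u + v" using w(1) by auto
  obtain t where t: "u = (1 - t) *\<^sub>R x + t *\<^sub>R y" using uv(1) by (auto simp: in_segment)
  have zu: "z - u = (s - t) *\<^sub>R (y - x)" unfolding z t by (simp add: algebra_simps)
  have "\<bar>v \<bullet> i\<bar> \<le> \<delta>" using Basis_le_norm[OF i, of v] uv(2) by linarith
  moreover have "u \<bullet> i = q - v \<bullet> i" using w(2) uv(3) by (simp add: inner_add_left)
  ultimately have "\<bar>(z - u) \<bullet> i\<bar> \<le> 2 * \<delta>" using zq by (simp add: inner_diff_left)
  then have "\<bar>s - t\<bar> * m \<le> 2 * \<delta>" unfolding zu using m by (simp add: abs_mult)
  then have "\<bar>s - t\<bar> \<le> 2 * \<delta> / m" using m(1) by (simp add: field_simps)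
  then have "\<bar>s - t\<bar> * norm (y - x) \<le> 2 * \<delta> / m * norm (y - x)" by (rule mult_right_mono) simp
  then have "norm (z - u) \<le> 2 * \<delta> * norm (y - x) / m" unfolding zu by simp
  moreover have "dist z w \<le> norm (z - u) + norm v"
    using norm_triangle_ineq4[of "z - u" v] uv(3) by (simp add: dist_norm algebra_simps)
  ultimately show ?thesis using uv(2) by linarith
qed

text \<open>The hull of small boxes around \<open>x\<close> and \<open>y\<close> is cut by a coordinate hyperplane near
  \<open>z = (1 - s)x + sy\<close>. Both halves are charged, hence so is their intersection, which lies close to \<open>z\<close>.\<close>

lemma hit_set_segment:
  assumes t: "tame \<psi> (cuts \<P>)" and B: "rational_boxes \<subseteq> \<P>" "box_hulls \<subseteq> \<P>"
    and xy: "x \<in> hit_set \<psi>" "y \<in> hit_set \<psi>" and i: "i \<in> Basis" "x \<bullet> i < y \<bullet> i"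
    and s: "0 < s" "s < 1"
  shows "(1 - s) *\<^sub>R x + s *\<^sub>R y \<in> hit_set \<psi>"
proof -
  define z where "z = (1 - s) *\<^sub>R x + s *\<^sub>R y"
  define m where "m = (y - x) \<bullet> i"
  have m: "0 < m" using i(2) by (simp add: m_def inner_diff_left)
  have zx: "z \<bullet> i = x \<bullet> i + s * m" and zy: "z \<bullet> i = y \<bullet> i - (1 - s) * m"
    by (simp_all add: z_def m_def inner_add_left inner_diff_left algebra_simps)
  have "z \<in> hit_set \<psi>" unfolding hit_set_def
  proof (intro CollectI ballI impI)
    fix a b :: 'a assume ab: "a \<in> rational_vectors" "b \<in> rational_vectors" "z \<in> box a b"
    obtain \<epsilon> where \<epsilon>: "0 < \<epsilon>" "ball z \<epsilon> \<subseteq> box a b" using ab(3) open_box openE by blast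
    define c where "c = 1 + 2 * norm (y - x) / m"
    have c: "0 < c" using m by (simp add: c_def add_pos_nonneg)
    \<comment> \<open>The first bound makes the distance \<open>\<delta> * c\<close> from
      \<open>segment_slab\<close> less than \<epsilon>. The other two keep the \<delta>-balls around
      x and y on opposite sides of any cut at height between \<open>z \<bullet> i - \<delta>\<close>
      and \<open>z \<bullet> i\<close>.\<close>
    define \<delta> where "\<delta> = min (\<epsilon> / (2 * c)) (min (s * m / 2) ((1 - s) * m / 2))"
    have \<delta>: "0 < \<delta>" "\<delta> \<le> s * m / 2" "\<delta> \<le> (1 - s) * m / 2" using \<epsilon> c m s by (auto simp: \<delta>_def)
    have "\<delta> * c \<le> \<epsilon> / (2 * c) * c" using c by (intro mult_right_mono) (auto simp: \<delta>_def)
    then have \<delta>c: "\<delta> * c < \<epsilon>" using c \<epsilon>(1) by simp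
    obtain q where q: "q \<in> \<rat>" "z \<bullet> i - \<delta> < q" "q < z \<bullet> i" using Rats_dense_in_real[of "z \<bullet> i - \<delta>" "z \<bullet> i"] \<delta>(1) by auto
    obtain P where P: "P \<in> rational_boxes" "P \<subseteq> ball x \<delta>" "0 < \<psi> P"
    proof (rule rational_box_neighbourhood[of "ball x \<delta>" x])
      fix a' b' assume *: "a' \<in> rational_vectors" "b' \<in> rational_vectors" "x \<in> box a' b'" "cbox a' b' \<subseteq> ball x \<delta>"
      show thesis using * xy(1) by (intro that[of "cbox a' b'"] cbox_rational_boxes) (auto simp: hit_set_def)
    qed (use \<delta> in auto)
    obtain Q where Q: "Q \<in> rational_boxes" "Q \<subseteq> ball y \<delta>" "0 < \<psi> Q"
    proof (rule rational_box_neighbourhood[of "ball y \<delta>" y])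
      fix a' b' assume *: "a' \<in> rational_vectors" "b' \<in> rational_vectors" "y \<in> box a' b'" "cbox a' b' \<subseteq> ball y \<delta>"
      show thesis using * xy(2) by (intro that[of "cbox a' b'"] cbox_rational_boxes) (auto simp: hit_set_def)
    qed (use \<delta> in auto)
    have near: "\<bar>p \<bullet> i - o' \<bullet> i\<bar> < \<delta>" if "p \<in> ball o' \<delta>" for p o' :: 'a
      using Basis_le_norm[OF i(1), of "p - o'"] that by (simp add: inner_diff_left dist_norm norm_minus_commute)
    have Pl: "P \<subseteq> lower i q"
    proof
      fix p assume "p \<in> P"
      then have "\<bar>p \<bullet> i - x \<bullet> i\<bar> < \<delta>" using P(2) near by blast
      then show "p \<in> lower i q" using q \<delta> zx unfolding lower_def by simp
    qed
    have Qu: "Q \<subseteq> upper i q"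
    proof
      fix p assume "p \<in> Q"
      then have "\<bar>p \<bullet> i - y \<bullet> i\<bar> < \<delta>" using Q(2) near by blast
      then show "p \<in> upper i q" using q \<delta> zy unfolding upper_def by simp
    qed
    define H where "H = convex hull (P \<union> Q)"
    have "H \<in> \<P>" unfolding H_def using B(2) P(1) Q(1) by (auto simp: box_hulls_def)
    then have H: "H \<in> cuts \<P>" by (rule cuts_base)
    have PQ: "P \<subseteq> H" "Q \<subseteq> H" unfolding H_def using hull_subset[of "P \<union> Q" convex] by auto
    have cP: "P \<in> cuts \<P>" "Q \<in> cuts \<P>" using B(1) P(1) Q(1) cuts_base by blast+
    have cH: "H \<inter> lower i q \<in> cuts \<P>" "H \<inter> upper i q \<in> cuts \<P>" "H \<inter> lower i q \<inter> upper i q \<in> cuts \<P>"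
      using H i(1) q(1) by (auto intro!: cuts_Int halfspaces_memI)
    \<comment> \<open>A charged body fixes the value of each larger one, so \<open>H\<close> and
      both halves share one value; the cut relation then gives it to the slice.\<close>
    have v1: "\<psi> H = \<psi> P" "\<psi> (H \<inter> lower i q) = \<psi> P"
      using PQ Pl by (auto intro!: tame_pos_mono[OF t] H cH cP P)
    have v2: "\<psi> H = \<psi> Q" "\<psi> (H \<inter> upper i q) = \<psi> Q"
      using PQ Qu by (auto intro!: tame_pos_mono[OF t] H cH cP Q)
    have "\<psi> H + \<psi> (H \<inter> lower i q \<inter> upper i q) = \<psi> (H \<inter> lower i q) + \<psi> (H \<inter> upper i q)"
      using t H i(1) q(1) by (simp add: tame_def)
    then have pos: "0 < \<psi> (H \<inter> lower i q \<inter> upper i q)" using v1 v2 P(3) by simp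
    have "H \<inter> lower i q \<inter> upper i q \<subseteq> cbox a b"
    proof
      fix w assume w: "w \<in> H \<inter> lower i q \<inter> upper i q"
      have "w \<in> convex hull (ball x \<delta> \<union> ball y \<delta>)"
        using w hull_mono[of "P \<union> Q" "ball x \<delta> \<union> ball y \<delta>" convex] P(2) Q(2) unfolding H_def by blast
      moreover have "w \<bullet> i = q" using w by (auto simp: lower_def upper_def)
      moreover have "\<bar>z \<bullet> i - q\<bar> \<le> \<delta>" using q by simp
      ultimately have "dist z w \<le> \<delta> + 2 * \<delta> * norm (y - x) / m"
        using \<delta>(1) i(1) z_def m m_def by (intro segment_slab)
      also have "\<dots> = \<delta> * c" by (simp add: c_def algebra_simps)
      finally have "w \<in> ball z \<epsilon>" using \<delta>c by simp
      then show "w \<in> cbox a b" using \<epsilon>(2) box_subset_cbox by blast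
    qed
    then show "0 < \<psi> (cbox a b)"
      using tame_pos_mono[OF t cuts_base cH(3) _ pos] B(1) cbox_rational_boxes[OF ab(1,2)] pos by auto
  qed
  then show ?thesis by (simp add: z_def)
qed

lemma convex_hit_set:
  assumes t: "tame \<psi> (cuts \<P>)" and B: "rational_boxes \<subseteq> \<P>" "box_hulls \<subseteq> \<P>"
  shows "convex (hit_set \<psi>)"
  unfolding convex_alt
proof (intro ballI allI impI)
  fix x y :: 'a and s :: real assume xy: "x \<in> hit_set \<psi>" "y \<in> hit_set \<psi>" and s: "0 \<le> s \<and> s \<le> 1"
  show "(1 - s) *\<^sub>R x + s *\<^sub>R y \<in> hit_set \<psi>"
  proof (cases "s = 0 \<or> s = 1 \<or> x = y")
    case True
    then show ?thesis using xy by (auto simp: algebra_simps)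
  next
    case False
    then have s': "0 < s" "s < 1" using s by auto
    obtain i where i: "i \<in> Basis" "x \<bullet> i \<noteq> y \<bullet> i" using False euclidean_eqI by blast
    show ?thesis
    proof (cases "x \<bullet> i < y \<bullet> i")
      case True
      then show ?thesis using hit_set_segment[OF t B xy i(1)] s' by simp
    next
      case False
      then show ?thesis using hit_set_segment[OF t B xy(2,1) i(1), of "1 - s"] i(2) s' by (simp add: add.commute)
    qed
  qed
qed

section \<open>Independent increments\<close>

text \<open>Sets that depend on countably many coordinates form a \<sigma>-algebra containing the
  cylinders. This reduces statements about uncountably many bodies to countable families.\<close>

lemma sets_PiM_countable_support:
  assumes "A \<in> sets (PiM I M)"
  obtains J where "countable J" "J \<subseteq> I"
    "\<And>x y. x \<in> space (PiM I M) \<Longrightarrow> y \<in> space (PiM I M) \<Longrightarrow> (\<And>i. i \<in> J \<Longrightarrow> x i = y i) \<Longrightarrow> x \<in> A \<longleftrightarrow> y \<in> A"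
proof -
  let ?S = "space (PiM I M)"
  let ?P = "\<lambda>A J. countable J \<and> J \<subseteq> I \<and> (\<forall>x\<in>?S. \<forall>y\<in>?S. (\<forall>i\<in>J. x i = y i) \<longrightarrow> (x \<in> A \<longleftrightarrow> y \<in> A))"
  have "\<exists>J. ?P A J"
    using assms unfolding sets_PiM_single
  proof (induction rule: sigma_sets.induct)
    case (Basic a)
    then obtain i B where "i \<in> I" "a = {f \<in> \<Pi>\<^sub>E i\<in>I. space (M i). f i \<in> B}"
      by (elim CollectE exE conjE)
    then have "?P a {i}" by (simp add: space_PiM)
    then show ?case by (rule exI)
  next
    case Empty
    have "?P {} {}" by simp
    then show ?case by (rule exI)
  next
    case (Compl a)
    obtain J where J: "?P a J" using Compl.IH by (rule exE)
    have "?P ((\<Pi>\<^sub>E i\<in>I. space (M i)) - a) J"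
    proof (intro conjI ballI impI)
      fix x y assume "x \<in> ?S" "y \<in> ?S" "\<forall>i\<in>J. x i = y i"
      moreover from this have "x \<in> a \<longleftrightarrow> y \<in> a" using J by blast
      ultimately show "x \<in> (\<Pi>\<^sub>E i\<in>I. space (M i)) - a \<longleftrightarrow> y \<in> (\<Pi>\<^sub>E i\<in>I. space (M i)) - a"
        by (simp add: space_PiM)
    qed (use J in auto)
    then show ?case by (rule exI)
  next
    case (Union a)
    have "\<forall>n. \<exists>J. ?P (a n) J" using Union.IH by (rule allI)
    then obtain J where "\<forall>n. ?P (a n) (J n)" by (rule choice[THEN exE])
    note J = spec[OF this]
    have "?P (\<Union>n. a n) (\<Union>n. J n)"
    proof (intro conjI ballI impI)
      show "countable (\<Union>n. J n)" by (intro countable_UN countableI_type conjunct1[OF J])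
      show "(\<Union>n. J n) \<subseteq> I" by (intro UN_least conjunct1[OF conjunct2[OF J]])
      fix x y assume xy: "x \<in> ?S" "y \<in> ?S" and eq: "\<forall>i\<in>(\<Union>n. J n). x i = y i"
      have "x \<in> a n \<longleftrightarrow> y \<in> a n" for n
      proof -
        have "\<forall>i\<in>J n. x i = y i" using eq by blast
        then show ?thesis by (rule bspec[OF bspec[OF conjunct2[OF conjunct2[OF J]] xy(1)] xy(2), THEN mp])
      qed
      then show "x \<in> (\<Union>n. a n) \<longleftrightarrow> y \<in> (\<Union>n. a n)" by simp
    qed
    then show ?case by (rule exI)
  qed
  then obtain J where J: "?P A J" by (elim exE)
  show ?thesis
  proof (rule that[OF conjunct1[OF J] conjunct1[OF conjunct2[OF J]]])
    fix x y assume xy: "x \<in> ?S" "y \<in> ?S" and "\<And>i. i \<in> J \<Longrightarrow> x i = y i"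
    then have "\<forall>i\<in>J. x i = y i" by blast
    then show "x \<in> A \<longleftrightarrow> y \<in> A" by (rule bspec[OF bspec[OF conjunct2[OF conjunct2[OF J]] xy(1)] xy(2), THEN mp])
  qed
qed

text \<open>A point of the hit set is only known to charge bodies that contain a neighbourhood of
  it, which \<open>K\<close> need not do. These bodies do, and they decrease to
  \<open>K\<close>.\<close>

definition parallel_body :: "'a::euclidean_space set \<Rightarrow> nat \<Rightarrow> 'a set" where
  "parallel_body K n = (\<Union>x\<in>K. \<Union>y\<in>cball 0 (inverse (real (Suc n))). {x + y})"

lemma parallel_body_convex_bodies: "K \<in> convex_bodies \<Longrightarrow> parallel_body K n \<in> convex_bodies"
  unfolding parallel_body_def convex_bodies_def by (simp add: compact_sums' convex_sums)

lemma ball_parallel_body: "x \<in> K \<Longrightarrow> ball x (inverse (real (Suc n))) \<subseteq> parallel_body K n"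
proof
  fix p assume "x \<in> K" "p \<in> ball x (inverse (real (Suc n)))"
  then show "p \<in> parallel_body K n" unfolding parallel_body_def
    by (intro UN_I[of x] UN_I[of "p - x"]) (auto simp: dist_norm norm_minus_commute)
qed

lemma decreases_to_parallel_body:
  assumes "compact K" shows "decreases_to (parallel_body K) K"
  unfolding decreases_to_def
proof
  show "decseq (parallel_body K)"
  proof (intro decseq_SucI subsetI)
    fix n p assume "p \<in> parallel_body K (Suc n)"
    then obtain x y where "x \<in> K" "norm y \<le> inverse (real (Suc (Suc n)))" "p = x + y" by (auto simp: parallel_body_def)
    moreover from this(2) have "norm y \<le> inverse (real (Suc n))"
      by (rule order_trans) (intro le_imp_inverse_le, auto)
    ultimately have "x \<in> K" "y \<in> cball 0 (inverse (real (Suc n)))" "p \<in> {x + y}"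
      unfolding mem_cball_0 by blast+
    then show "p \<in> parallel_body K n" unfolding parallel_body_def by blast
  qed
  show "(\<Inter>n. parallel_body K n) = K"
  proof (intro equalityI subsetI)
    fix p assume p: "p \<in> (\<Inter>n. parallel_body K n)"
    have "p \<in> closure K" unfolding closure_approachable
    proof (intro allI impI)
      fix e :: real assume "0 < e"
      then obtain n where n: "inverse (real (Suc n)) < e" using reals_Archimedean by blast
      have "p \<in> parallel_body K n" using p by blast
      then obtain x y where "x \<in> K" "norm y \<le> inverse (real (Suc n))" "p = x + y" by (auto simp: parallel_body_def)
      then show "\<exists>x\<in>K. dist x p < e" using n by (intro bexI[of _ x]) (auto simp: dist_norm)
    qed
    then show "p \<in> K" using assms by (simp add: compact_imp_closed)
  next
    fix p assume "p \<in> K"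
    then have "p \<in> parallel_body K n" for n
      unfolding parallel_body_def by (intro UN_I[of p] UN_I[of 0]) auto
    then show "p \<in> (\<Inter>n. parallel_body K n)" by blast
  qed
qed

lemma ball_convex_body: "cball 0 r \<in> convex_bodies"
  by (simp add: convex_bodies_def)

lemma convex_body_subset_ball:
  assumes "K \<in> convex_bodies" obtains N where "\<And>n. n \<ge> N \<Longrightarrow> K \<subseteq> cball 0 (real n)"
proof -
  have "bounded K" using assms by (simp add: convex_bodies_def compact_imp_bounded)
  then obtain B where B: "\<And>x. x \<in> K \<Longrightarrow> norm x \<le> B" by (auto simp: bounded_iff)
  obtain N where "B \<le> real N" using real_arch_simple by blast
  then have "K \<subseteq> cball 0 (real n)" if "n \<ge> N" for n using B that by (fastforce intro: order_trans)
  then show ?thesis by (rule that)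
qed

section \<open>Recovering the closed set and the mark from almost every function\<close>

locale indep_levy = monotone_levy M \<Phi> \<Lambda>
  for M :: "'w measure" and \<Phi> :: "'a::euclidean_space set \<Rightarrow> 'w \<Rightarrow> real" and \<Lambda> +
  assumes ind: "independent_increments M \<Phi>"
begin

lemma AE_tame:
  assumes "countable \<P>" "\<P> \<subseteq> convex_bodies"
  shows "AE \<psi> in \<Lambda>. tame \<psi> (cuts \<P>)"
proof -
  let ?E = "cuts \<P>"
  have cnt: "countable ?E" and cb: "\<And>K. K \<in> ?E \<Longrightarrow> K \<in> convex_bodies"
    using countable_cuts[OF assms(1)] cuts_convex_bodies[OF assms(2)] by auto
  have "AE \<psi> in \<Lambda>. \<forall>K\<in>?E. 0 \<le> \<psi> K" using \<psi>_nonneg cb by (intro AE_I2) auto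
  moreover have "AE \<psi> in \<Lambda>. L \<subseteq> K \<longrightarrow> \<psi> L = 0 \<or> \<psi> L = \<psi> K" if "K \<in> ?E" "L \<in> ?E" for K L
    using AE_levy_two_valued[OF ind cb[OF that(1)] cb[OF that(2)]] by (cases "L \<subseteq> K") auto
  then have "AE \<psi> in \<Lambda>. \<forall>K\<in>?E. \<forall>L\<in>?E. L \<subseteq> K \<longrightarrow> \<psi> L = 0 \<or> \<psi> L = \<psi> K"
    using cnt by (simp add: AE_ball_countable)
  moreover have "AE \<psi> in \<Lambda>. \<psi> K + \<psi> (K \<inter> lower i q \<inter> upper i q) = \<psi> (K \<inter> lower i q) + \<psi> (K \<inter> upper i q)"
    if "K \<in> ?E" "i \<in> Basis" "q \<in> \<rat>" for K i q
  proof -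
    have l: "K \<inter> lower i q \<in> convex_bodies" and u: "K \<inter> upper i q \<in> convex_bodies"
      using that by (auto intro!: cb cuts_Int halfspaces_memI)
    have un: "K \<inter> lower i q \<union> K \<inter> upper i q = K" by (auto simp: lower_def upper_def)
    have int: "(K \<inter> lower i q) \<inter> (K \<inter> upper i q) = K \<inter> lower i q \<inter> upper i q" by auto
    show ?thesis using AE_levy_valuation[OF l u] cb[OF that(1)] unfolding un int by simp
  qed
  then have "AE \<psi> in \<Lambda>. \<forall>K\<in>?E. \<forall>i\<in>Basis. \<forall>q\<in>\<rat>.
      \<psi> K + \<psi> (K \<inter> lower i q \<inter> upper i q) = \<psi> (K \<inter> lower i q) + \<psi> (K \<inter> upper i q)"
    using cnt by (simp add: AE_ball_countable countable_rat countable_finite)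
  ultimately show ?thesis using AE_levy_empty
    by eventually_elim (simp add: tame_def)
qed

text \<open>The family is chosen for this one \<open>K\<close>, so the null set depends on
  \<open>K\<close>. A charged \<open>K\<close> is cut down to a point of the hit set; conversely
  such a point in \<open>K\<close> charges all parallel bodies, and
  \<open>AE_levy_continuous\<close> passes to \<open>K\<close>.\<close>

lemma AE_hit_set:
  assumes K: "K \<in> convex_bodies"
  shows "AE \<psi> in \<Lambda>. 0 < \<psi> K \<longleftrightarrow> hit_set \<psi> \<inter> K \<noteq> {}"
proof -
  let ?P = "insert K (rational_boxes \<union> range (parallel_body K))"
  have cK: "compact K" using K by (simp add: convex_bodies_def)
  have "AE \<psi> in \<Lambda>. tame \<psi> (cuts ?P)"
    using countable_rational_boxes rational_boxes_convex_bodies K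
    by (intro AE_tame) (auto simp: parallel_body_convex_bodies)
  then show ?thesis
    using AE_levy_continuous[OF ind parallel_body_convex_bodies[OF K] K decreases_to_parallel_body[OF cK]]
  proof eventually_elim
    case (elim \<psi>)
    show ?case
    proof
      assume "0 < \<psi> K"
      then show "hit_set \<psi> \<inter> K \<noteq> {}" using elim(1) cK by (intro hit_set_meets[where \<P>="?P"]) auto
    next
      assume "hit_set \<psi> \<inter> K \<noteq> {}"
      then obtain x where x: "x \<in> hit_set \<psi>" "x \<in> K" by blast
      have "0 < \<psi> (parallel_body K n)" for n
      proof (rule hit_set_pos[OF elim(1) _ _ x(1)])
        show "parallel_body K n \<in> cuts ?P" by (rule cuts_base) auto
        show "rational_boxes \<subseteq> cuts ?P" by (auto intro: cuts_base)
        show "ball x (inverse (real (Suc n))) \<subseteq> parallel_body K n" using x(2) by (rule ball_parallel_body)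
      qed auto
      then show "0 < \<psi> K" using elim(2) by blast
    qed
  qed
qed

text \<open>The common value of charged bodies, taken as a limit along balls so that it is
  measurable in \<psi>.\<close>

definition height :: "('a set \<Rightarrow> real) \<Rightarrow> real" where
  "height \<psi> = lim (\<lambda>n. \<psi> (cball 0 (real n)))"

lemma height_measurable [measurable]: "height \<in> borel_measurable \<Lambda>"
  unfolding height_def[abs_def] by (intro borel_measurable_lim_metric \<psi>_measurable ball_convex_body)

lemma AE_height:
  assumes K: "K \<in> convex_bodies"
  shows "AE \<psi> in \<Lambda>. 0 < \<psi> K \<longrightarrow> \<psi> K = height \<psi>"
proof -
  obtain N where N: "\<And>n. n \<ge> N \<Longrightarrow> K \<subseteq> cball 0 (real n)" using convex_body_subset_ball[OF K] by blast
  have "AE \<psi> in \<Lambda>. n \<ge> N \<longrightarrow> \<psi> K = 0 \<or> \<psi> K = \<psi> (cball 0 (real n))" for n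
    using AE_levy_two_valued[OF ind ball_convex_body K] N by (cases "n \<ge> N") auto
  then have "AE \<psi> in \<Lambda>. \<forall>n. n \<ge> N \<longrightarrow> \<psi> K = 0 \<or> \<psi> K = \<psi> (cball 0 (real n))"
    by (simp add: AE_all_countable)
  then show ?thesis
  proof eventually_elim
    case (elim \<psi>)
    show ?case
    proof
      assume "0 < \<psi> K"
      then have "\<psi> (cball 0 (real n)) = \<psi> K" if "n \<ge> N" for n using elim that by auto
      then have "(\<lambda>n. \<psi> (cball 0 (real n))) \<longlonglongrightarrow> \<psi> K"
        by (intro tendsto_eventually eventually_sequentiallyI[of N])
      then show "\<psi> K = height \<psi>" unfolding height_def by (simp add: limI)
    qed
  qed
qed

text \<open>This is where condition (L2) enters: a measurable set without the zero function is determined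
  by countably many bodies, one of which is charged.\<close>

lemma AE_charged: "AE \<psi> in \<Lambda>. \<exists>n. 0 < \<psi> (cball 0 (real n))"
proof -
  define Z where "Z = {\<psi> \<in> space \<Lambda>. \<forall>n. \<psi> (cball 0 (real n)) = 0}"
  have [measurable]: "(\<lambda>\<psi>. \<psi> (cball 0 (real n))) \<in> borel_measurable \<Lambda>" for n by (intro \<psi>_measurable ball_convex_body)
  have Z: "Z \<in> sets \<Lambda>" unfolding Z_def by measurable
  let ?O = "\<lambda>K\<in>convex_bodies. 0 :: real"
  have O: "?O \<in> space \<Lambda>" by (simp add: space_\<Lambda>)
  have "emeasure \<Lambda> C = 0" if C: "C \<in> sets \<Lambda>" "C \<subseteq> Z - {?O}" for C
  proof -
    have CP: "C \<in> sets (PiM convex_bodies (\<lambda>_. restrict_space borel {0..}))"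
      using C(1) by (simp add: sets_\<Lambda> path_space_def)
    have sp: "space (PiM convex_bodies (\<lambda>_. restrict_space borel {0..})) = space \<Lambda>"
      using sets_eq_imp_space_eq[OF sets_\<Lambda>] by (simp add: path_space_def)
    obtain J where J: "countable J" "J \<subseteq> convex_bodies"
      "\<And>x y. x \<in> space \<Lambda> \<Longrightarrow> y \<in> space \<Lambda> \<Longrightarrow> (\<And>i. i \<in> J \<Longrightarrow> x i = y i) \<Longrightarrow> x \<in> C \<longleftrightarrow> y \<in> C"
      using sets_PiM_countable_support[OF CP] unfolding sp by blast
    have "AE \<psi> in \<Lambda>. \<psi> K \<noteq> 0 \<longrightarrow> \<psi> \<notin> Z" if K: "K \<in> J" for K
    proof -
      have cb: "K \<in> convex_bodies" using J(2) K by blast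
      obtain N where "\<And>n. n \<ge> N \<Longrightarrow> K \<subseteq> cball 0 (real n)" using convex_body_subset_ball[OF cb] by blast
      then have "AE \<psi> in \<Lambda>. \<psi> K = 0 \<or> \<psi> K = \<psi> (cball 0 (real N))"
        by (intro AE_levy_two_valued ind ball_convex_body cb) simp
      then show ?thesis by eventually_elim (auto simp: Z_def)
    qed
    then have "AE \<psi> in \<Lambda>. \<forall>K\<in>J. \<psi> K \<noteq> 0 \<longrightarrow> \<psi> \<notin> Z"
      by (subst AE_ball_countable[OF J(1)]) blast
    then have "AE \<psi> in \<Lambda>. \<psi> \<notin> C"
    proof eventually_elim
      case (elim \<psi>)
      show ?case
      proof
        assume \<psi>: "\<psi> \<in> C"
        then have \<psi>Z: "\<psi> \<in> Z" "\<psi> \<in> space \<Lambda>" using C(2) by (auto simp: Z_def)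
        \<comment> \<open>On the bodies that decide membership in \<open>C\<close>, \<psi> agrees
          with the zero function, which \<open>C\<close> excludes.\<close>
        have "\<psi> i = ?O i" if "i \<in> J" for i using elim \<psi>Z(1) that J(2) by auto
        then have "?O \<in> C" using J(3)[OF \<psi>Z(2) O] \<psi> by blast
        then show False using C(2) by blast
      qed
    qed
    then show ?thesis using AE_iff_null_sets[OF C(1)] by (intro null_setsD1) simp
  qed
  then have "inner_measure \<Lambda> (Z - {?O}) = 0"
    unfolding inner_measure_def by (auto intro!: SUP_eq_const[THEN trans] simp: SUP_eq_iff bot_ennreal)
  then have "emeasure \<Lambda> Z = 0" using levy_measure_\<Lambda> Z by (simp add: levy_measure_def)
  then have "AE \<psi> in \<Lambda>. \<psi> \<notin> Z" using Z by (intro AE_not_in) (simp add: null_setsI)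
  then show ?thesis using AE_space
  proof eventually_elim
    case (elim \<psi>)
    then obtain n where "\<psi> (cball 0 (real n)) \<noteq> 0" by (auto simp: Z_def)
    then show ?case using \<psi>_nonneg[OF elim(2) ball_convex_body, of "real n"] by (intro exI[of _ n]) simp
  qed
qed

lemma AE_regular: "AE \<psi> in \<Lambda>. hit_set \<psi> \<in> closed_convex_sets \<and> 0 < height \<psi>"
proof -
  have "AE \<psi> in \<Lambda>. tame \<psi> (cuts (rational_boxes \<union> box_hulls))"
    using countable_rational_boxes countable_box_hulls rational_boxes_convex_bodies box_hulls_convex_bodies
    by (intro AE_tame) auto
  moreover have "AE \<psi> in \<Lambda>. \<forall>n. 0 < \<psi> (cball 0 (real n)) \<longrightarrow> \<psi> (cball 0 (real n)) = height \<psi>"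
    using AE_height[OF ball_convex_body] by (simp add: AE_all_countable)
  moreover have "AE \<psi> in \<Lambda>. \<forall>n. 0 < \<psi> (cball 0 (real n)) \<longleftrightarrow> hit_set \<psi> \<inter> cball 0 (real n) \<noteq> {}"
    using AE_hit_set[OF ball_convex_body] by (simp add: AE_all_countable)
  ultimately show ?thesis using AE_charged
  proof eventually_elim
    case (elim \<psi>)
    obtain n where n: "0 < \<psi> (cball 0 (real n))" using elim(4) by blast
    have "hit_set \<psi> \<noteq> {}" using elim(3) n by blast
    moreover have "convex (hit_set \<psi>)" using elim(1) by (rule convex_hit_set) auto
    moreover have "0 < height \<psi>" using elim(2) n by metis
    ultimately show ?case by (simp add: closed_convex_sets_def closed_hit_set)
  qed
qed

text \<open>By compactness the hit set misses \<open>C\<close> exactly if finitely many uncharged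
  rational boxes cover \<open>C\<close>, and there are only countably many finite families of such
  boxes.\<close>

lemma hit_set_missing_measurable:
  assumes C: "compact C" shows "{\<psi> \<in> space \<Lambda>. hit_set \<psi> \<inter> C = {}} \<in> sets \<Lambda>"
proof -
  let ?J = "{I. finite I \<and> I \<subseteq> rational_vectors \<times> rational_vectors} :: ('a \<times> 'a) set set"
  let ?Q = "\<lambda>I. {\<psi> \<in> space \<Lambda>. \<forall>p\<in>I. \<not> 0 < \<psi> (cbox (fst p) (snd p))}"
  have "{\<psi> \<in> space \<Lambda>. hit_set \<psi> \<inter> C = {}} = (\<Union>I\<in>{I \<in> ?J. C \<subseteq> (\<Union>p\<in>I. box (fst p) (snd p))}. ?Q I)"
  proof (intro equalityI subsetI)
    fix \<psi> assume \<psi>: "\<psi> \<in> {\<psi> \<in> space \<Lambda>. hit_set \<psi> \<inter> C = {}}"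
    let ?B = "{p \<in> rational_vectors \<times> rational_vectors. \<not> 0 < \<psi> (cbox (fst p) (snd p))}"
    have cov: "C \<subseteq> (\<Union>p\<in>?B. box (fst p) (snd p))" using \<psi> unfolding hit_set_def by fastforce
    obtain I where I: "I \<subseteq> ?B" "finite I" "C \<subseteq> (\<Union>p\<in>I. box (fst p) (snd p))"
      by (rule compactE_image[OF C _ cov]) (auto simp: open_box)
    show "\<psi> \<in> (\<Union>I\<in>{I \<in> ?J. C \<subseteq> (\<Union>p\<in>I. box (fst p) (snd p))}. ?Q I)"
      using I \<psi> by (intro UN_I[of I]) auto
  next
    fix \<psi> assume "\<psi> \<in> (\<Union>I\<in>{I \<in> ?J. C \<subseteq> (\<Union>p\<in>I. box (fst p) (snd p))}. ?Q I)"
    then obtain I where I: "I \<in> ?J" "C \<subseteq> (\<Union>p\<in>I. box (fst p) (snd p))" "\<psi> \<in> ?Q I" by blast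
    have "x \<notin> hit_set \<psi>" if x: "x \<in> C" for x
    proof
      assume h: "x \<in> hit_set \<psi>"
      obtain p where p: "p \<in> I" "x \<in> box (fst p) (snd p)" using I(2) x by blast
      then have "0 < \<psi> (cbox (fst p) (snd p))" using h I(1) unfolding hit_set_def by auto
      then show False using I(3) p(1) by blast
    qed
    then show "\<psi> \<in> {\<psi> \<in> space \<Lambda>. hit_set \<psi> \<inter> C = {}}" using I(3) by blast
  qed
  moreover have "?Q I \<in> sets \<Lambda>" if "I \<in> ?J" for I
  proof -
    have cb: "cbox a b \<in> convex_bodies" for a b :: 'a by (simp add: convex_bodies_def compact_cbox convex_box)
    have "{\<psi> \<in> space \<Lambda>. \<not> 0 < \<psi> (cbox a b)} \<in> sets \<Lambda>" for a b
      using \<psi>_measurable[OF cb] by measurable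
    then show ?thesis using that by (intro sets.sets_Collect_finite_All) auto
  qed
  moreover have "countable {I \<in> ?J. C \<subseteq> (\<Union>p\<in>I. box (fst p) (snd p))}"
    by (rule countable_subset[of _ ?J])
      (auto intro!: countable_Collect_finite_subset countable_SIGMA countable_rational_vectors)
  ultimately show ?thesis by (simp only:) (rule sets.countable_UN', auto)
qed

text \<open>An open set is a countable union of compact rational boxes, which reduces hitting it to
  missing compact sets.\<close>

lemma hit_set_hitting_measurable:
  assumes U: "open U" shows "{\<psi> \<in> space \<Lambda>. hit_set \<psi> \<inter> U \<noteq> {}} \<in> sets \<Lambda>"
proof -
  let ?J = "{p \<in> rational_vectors \<times> rational_vectors. cbox (fst p) (snd p) \<subseteq> U} :: ('a \<times> 'a) set"
  have "x \<in> U \<Longrightarrow> \<exists>p\<in>?J. x \<in> cbox (fst p) (snd p)" for x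
  proof -
    assume "x \<in> U"
    with U obtain a b where "a \<in> rational_vectors" "b \<in> rational_vectors" "x \<in> box a b" "cbox a b \<subseteq> U"
      by (rule rational_box_neighbourhood)
    then show ?thesis using box_subset_cbox[of a b] by (intro bexI[of _ "(a, b)"]) auto
  qed
  then have "{\<psi> \<in> space \<Lambda>. hit_set \<psi> \<inter> U \<noteq> {}} =
    (\<Union>p\<in>?J. space \<Lambda> - {\<psi> \<in> space \<Lambda>. hit_set \<psi> \<inter> cbox (fst p) (snd p) = {}})"
    by blast
  moreover have "countable ?J" by (intro countable_Collect countable_SIGMA countable_rational_vectors)
  ultimately show ?thesis
    by (simp only:) (intro sets.countable_UN' image_subsetI sets.Diff sets.top hit_set_missing_measurable compact_cbox)
qed

lemma AE_hit_function:
  assumes K: "K \<in> convex_bodies"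
  shows "AE \<psi> in \<Lambda>. hit_function (hit_set \<psi>, height \<psi>) K = \<psi> K"
  using AE_hit_set[OF K] AE_height[OF K] AE_space
proof eventually_elim
  case (elim \<psi>)
  show ?case
  proof (cases "0 < \<psi> K")
    case True
    then show ?thesis using elim K by (auto simp: hit_function_def Int_commute)
  next
    case False
    then show ?thesis using elim K \<psi>_nonneg[OF elim(3) K] by (auto simp: hit_function_def Int_commute)
  qed
qed

text \<open>For a given \<psi> the reconstructed function \<open>?T \<psi>\<close> need not be
  \<psi>; almost everywhere they agree on any prescribed countable family. Applied to the countable
  support of a measurable set, this equates its measures.\<close>

lemma levy_measure_pushforward:
  "\<exists>\<nu>. borel_measure_on_marked_sets \<nu> \<and> \<Lambda> = hit_pushforward \<nu>"
proof -
  obtain N where N: "N \<in> null_sets \<Lambda>" "{\<psi> \<in> space \<Lambda>. \<not> (hit_set \<psi> \<in> closed_convex_sets \<and> 0 < height \<psi>)} \<subseteq> N"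
    using AE_regular by (rule AE_E3) blast
  have Nm[measurable]: "N \<in> sets \<Lambda>" using N(1) by auto
  \<comment> \<open>On the exceptional null set an arbitrary marked set, here
    \<open>({0}, 1)\<close>, keeps the map inside its target.\<close>
  define f where "f \<psi> = (if \<psi> \<in> N then {0} else hit_set \<psi>)" for \<psi> :: "'a set \<Rightarrow> real"
  define h where "h \<psi> = (if \<psi> \<in> N then 1 else height \<psi>)" for \<psi> :: "'a set \<Rightarrow> real"
  have G: "(\<lambda>\<psi>. (f \<psi>, h \<psi>)) \<in> measurable \<Lambda> (borel_of marked_sets)"
  proof (rule measurable_marked_setsI)
    show "f \<psi> \<in> closed_convex_sets" "0 < h \<psi>" if "\<psi> \<in> space \<Lambda>" for \<psi>
      using that N(2) by (auto simp: f_def h_def closed_convex_sets_def)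
    show "h \<in> borel_measurable \<Lambda>" unfolding h_def[abs_def] by measurable
    show "{\<psi> \<in> space \<Lambda>. f \<psi> \<inter> C = {}} \<in> sets \<Lambda>" if "compact C" for C
    proof -
      have "{\<psi> \<in> space \<Lambda>. f \<psi> \<inter> C = {}} = (if 0 \<in> C then {} else N) \<union> ({\<psi> \<in> space \<Lambda>. hit_set \<psi> \<inter> C = {}} - N)"
        using sets.sets_into_space[OF Nm] by (auto simp: f_def)
      then show ?thesis using hit_set_missing_measurable[OF that] by simp
    qed
    show "{\<psi> \<in> space \<Lambda>. f \<psi> \<inter> U \<noteq> {}} \<in> sets \<Lambda>" if "open U" for U
    proof -
      have "{\<psi> \<in> space \<Lambda>. f \<psi> \<inter> U \<noteq> {}} = (if 0 \<in> U then N else {}) \<union> ({\<psi> \<in> space \<Lambda>. hit_set \<psi> \<inter> U \<noteq> {}} - N)"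
        using sets.sets_into_space[OF Nm] by (auto simp: f_def)
      then show ?thesis using hit_set_hitting_measurable[OF that] by simp
    qed
  qed
  define \<nu> where "\<nu> = distr \<Lambda> (borel_of marked_sets) (\<lambda>\<psi>. (f \<psi>, h \<psi>))"
  let ?T = "\<lambda>\<psi>. hit_function (f \<psi>, h \<psi>)"
  have T: "?T \<in> measurable \<Lambda> path_space" using measurable_compose[OF G measurable_hit_function] .
  have push: "hit_pushforward \<nu> = distr \<Lambda> path_space ?T"
    unfolding hit_pushforward_def \<nu>_def by (subst distr_distr[OF measurable_hit_function G]) (simp add: comp_def)
  have "\<Lambda> = distr \<Lambda> path_space ?T"
  proof (rule measure_eqI)
    show "sets \<Lambda> = sets (distr \<Lambda> path_space ?T)" by (simp add: sets_\<Lambda>)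
    fix A assume A: "A \<in> sets \<Lambda>"
    have AP: "A \<in> sets (PiM convex_bodies (\<lambda>_. restrict_space borel {0..}))"
      using A by (simp add: sets_\<Lambda> path_space_def)
    have sp: "space (PiM convex_bodies (\<lambda>_. restrict_space borel {0..})) = space \<Lambda>"
      using sets_eq_imp_space_eq[OF sets_\<Lambda>] by (simp add: path_space_def)
    obtain J where J: "countable J" "J \<subseteq> convex_bodies"
      "\<And>x y. x \<in> space \<Lambda> \<Longrightarrow> y \<in> space \<Lambda> \<Longrightarrow> (\<And>i. i \<in> J \<Longrightarrow> x i = y i) \<Longrightarrow> x \<in> A \<longleftrightarrow> y \<in> A"
      using sets_PiM_countable_support[OF AP] unfolding sp by blast
    have "AE \<psi> in \<Lambda>. \<forall>K\<in>J. hit_function (hit_set \<psi>, height \<psi>) K = \<psi> K"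
      using J AE_hit_function by (auto simp: AE_ball_countable)
    then have AE: "AE \<psi> in \<Lambda>. \<psi> \<in> A \<longleftrightarrow> \<psi> \<in> ?T -` A \<inter> space \<Lambda>"
      using AE_space AE_not_in[OF N(1)]
    proof eventually_elim
      case (elim \<psi>)
      have "?T \<psi> \<in> space \<Lambda>" using measurable_space[OF T elim(2)] sets_eq_imp_space_eq[OF sets_\<Lambda>] by simp
      moreover have "?T \<psi> i = \<psi> i" if "i \<in> J" for i using elim that by (simp add: f_def h_def)
      ultimately show ?case using J(3)[OF elim(2), of "?T \<psi>"] elim(2) by simp
    qed
    have "?T -` A \<inter> space \<Lambda> \<in> sets \<Lambda>" using T A by (intro measurable_sets) (auto simp: sets_\<Lambda>)
    then show "emeasure \<Lambda> A = emeasure (distr \<Lambda> path_space ?T) A"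
      using AE A T by (subst emeasure_distr) (auto simp: sets_\<Lambda> intro!: emeasure_eq_AE)
  qed
  then show ?thesis unfolding push[symmetric]
    by (intro exI[of _ \<nu>]) (simp add: borel_measure_on_marked_sets_def \<nu>_def)
qed

end

section \<open>The Poisson representation\<close>

text \<open>The numbers in \<open>eq\<close> are the mixed moments of the variables exp(-X), which
  lie in [0,1]; -ln recovers X.\<close>

lemma distr_PiM_eqI_exp:
  fixes X :: "'i \<Rightarrow> 'w \<Rightarrow> real" and X' :: "'i \<Rightarrow> 'v \<Rightarrow> real"
  assumes M: "prob_space M" and N: "prob_space N" and J: "finite J"
    and X[measurable]: "\<And>j. j \<in> J \<Longrightarrow> X j \<in> borel_measurable M"
    and X'[measurable]: "\<And>j. j \<in> J \<Longrightarrow> X' j \<in> borel_measurable N"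
    and nn: "\<And>j. j \<in> J \<Longrightarrow> AE x in M. 0 \<le> X j x" and nn': "\<And>j. j \<in> J \<Longrightarrow> AE x in N. 0 \<le> X' j x"
    and eq: "\<And>k::'i \<Rightarrow> nat. (\<integral>x. exp (- (\<Sum>j\<in>J. real (k j) * X j x)) \<partial>M) = (\<integral>x. exp (- (\<Sum>j\<in>J. real (k j) * X' j x)) \<partial>N)"
  shows "distr M (PiM J (\<lambda>_. borel)) (\<lambda>x. \<lambda>j\<in>J. X j x) = distr N (PiM J (\<lambda>_. borel)) (\<lambda>x. \<lambda>j\<in>J. X' j x)"
proof -
  let ?P = "PiM J (\<lambda>_. borel) :: ('i \<Rightarrow> real) measure"
  let ?g = "\<lambda>y. \<lambda>j\<in>J. - ln (y j) :: real"
  have g: "?g \<in> measurable ?P ?P" by (intro measurable_restrict) simp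
  have e: "(\<lambda>x. \<lambda>j\<in>J. exp (- X j x)) \<in> measurable M ?P" by (intro measurable_restrict) simp
  have e': "(\<lambda>x. \<lambda>j\<in>J. exp (- X' j x)) \<in> measurable N ?P" by (intro measurable_restrict) simp
  have prod: "(\<Prod>j\<in>J. exp (- x j) ^ k j) = exp (- (\<Sum>j\<in>J. real (k j) * x j))" for x :: "'i \<Rightarrow> real" and k
    using J by (simp add: exp_sum exp_of_nat_mult[symmetric] sum_negf[symmetric])
  have "distr M ?P (\<lambda>x. \<lambda>j\<in>J. exp (- X j x)) = distr N ?P (\<lambda>x. \<lambda>j\<in>J. exp (- X' j x))"
  proof (rule distr_PiM_eqI_moments[OF M N J])
    show "AE x in M. exp (- X j x) \<in> {0..1}" if "j \<in> J" for j using nn[OF that] by (rule eventually_mono) simp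
    show "AE x in N. exp (- X' j x) \<in> {0..1}" if "j \<in> J" for j using nn'[OF that] by (rule eventually_mono) simp
  qed (simp_all add: prod eq)
  then have "distr (distr M ?P (\<lambda>x. \<lambda>j\<in>J. exp (- X j x))) ?P ?g = distr (distr N ?P (\<lambda>x. \<lambda>j\<in>J. exp (- X' j x))) ?P ?g"
    by (rule arg_cong)
  then show ?thesis
    unfolding distr_distr[OF g e] distr_distr[OF g e'] by (simp add: comp_def cong: restrict_cong)
qed

text \<open>Independence of functions of a random element depends on its law only, so it passes from
  the Poisson sum to \<open>\<Phi>\<close>.\<close>

lemma indep_vars_transfer:
  fixes g :: "'i \<Rightarrow> 'c \<Rightarrow> real"
  assumes M: "prob_space M" and N: "prob_space N" and A: "A \<in> measurable M S" and B: "B \<in> measurable N S"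
    and eq: "distr M S A = distr N S B" and g: "\<And>i. i \<in> I \<Longrightarrow> g i \<in> borel_measurable S"
    and iv: "prob_space.indep_vars N (\<lambda>_. borel) (\<lambda>i w. g i (B w)) I" and I: "I \<noteq> {}"
  shows "prob_space.indep_vars M (\<lambda>_. borel) (\<lambda>i w. g i (A w)) I"
proof -
  let ?g = "\<lambda>s. \<lambda>i\<in>I. g i s" and ?P = "PiM I (\<lambda>_. borel :: real measure)"
  have gm: "?g \<in> measurable S ?P" using g by (intro measurable_restrict)
  have "distr M ?P (\<lambda>w. \<lambda>i\<in>I. g i (A w)) = distr (distr M S A) ?P ?g"
    by (subst distr_distr[OF gm A]) (simp add: comp_def)
  also have "\<dots> = distr N ?P (\<lambda>w. \<lambda>i\<in>I. g i (B w))"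
    unfolding eq by (subst distr_distr[OF gm B]) (simp add: comp_def)
  also have "\<dots> = PiM I (\<lambda>i. distr N borel (\<lambda>w. g i (B w)))"
    using iv measurable_compose[OF B g] by (subst (asm) prob_space.indep_vars_iff_distr_eq_PiM'[OF N I]) auto
  also have "\<dots> = PiM I (\<lambda>i. distr M borel (\<lambda>w. g i (A w)))"
  proof (intro PiM_cong refl)
    fix i assume i: "i \<in> I"
    have "distr N borel (\<lambda>w. g i (B w)) = distr (distr N S B) borel (g i)"
      by (subst distr_distr[OF g[OF i] B]) (simp add: comp_def)
    also have "\<dots> = distr M borel (\<lambda>w. g i (A w))"
      unfolding eq[symmetric] by (subst distr_distr[OF g[OF i] A]) (simp add: comp_def)
    finally show "distr N borel (\<lambda>w. g i (B w)) = distr M borel (\<lambda>w. g i (A w))" .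
  qed
  finally show ?thesis
    using measurable_compose[OF A g] by (subst prob_space.indep_vars_iff_distr_eq_PiM'[OF M I]) auto
qed

section \<open>The intensity measure\<close>

locale poisson_levy = monotone_levy M \<Phi> \<Lambda>
  for M :: "'w measure" and \<Phi> :: "'a::euclidean_space set \<Rightarrow> 'w \<Rightarrow> real" and \<Lambda> +
  fixes \<nu> :: "('a set \<times> real) measure"
  assumes \<nu>_borel: "borel_measure_on_marked_sets \<nu>" and \<Lambda>_push: "\<Lambda> = hit_pushforward \<nu>"
begin

lemma sets_\<nu> [measurable_cong]: "sets \<nu> = sets (borel_of marked_sets)"
  using \<nu>_borel by (simp add: borel_measure_on_marked_sets_def)

lemma space_\<nu>: "space \<nu> = closed_convex_sets \<times> {0<..}"
  using sets_eq_imp_space_eq[OF sets_\<nu>] by (simp add: topspace_marked_sets)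

lemma hit_function_measurable [measurable]: "hit_function \<in> measurable \<nu> path_space"
  using measurable_hit_function by (simp add: measurable_cong_sets[OF sets_\<nu> refl])

definition height_at :: "'a set \<Rightarrow> 'a set \<times> real \<Rightarrow> real" where
  "height_at K p = snd p * of_bool (K \<inter> fst p \<noteq> {})"

lemma height_at_measurable [measurable]: "K \<in> convex_bodies \<Longrightarrow> height_at K \<in> borel_measurable \<nu>"
  using measurable_hit unfolding height_at_def[abs_def] by (simp add: measurable_cong_sets[OF sets_\<nu> refl])

lemma height_at_eq: "K \<in> convex_bodies \<Longrightarrow> hit_function p K = height_at K p"
  by (simp add: hit_function_def height_at_def split: prod.split)

lemma height_at_nonneg: "p \<in> space \<nu> \<Longrightarrow> 0 \<le> height_at K p"
  by (auto simp: height_at_def space_\<nu>)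

lemma nn_integral_\<Lambda>: "g \<in> borel_measurable \<Lambda> \<Longrightarrow> (\<integral>\<^sup>+\<psi>. g \<psi> \<partial>\<Lambda>) = (\<integral>\<^sup>+p. g (hit_function p) \<partial>\<nu>)"
  unfolding \<Lambda>_push hit_pushforward_def by (intro nn_integral_distr) auto

lemma nn_integral_min_height:
  assumes K: "K \<in> convex_bodies"
  shows "(\<integral>\<^sup>+p. ennreal (min 1 (height_at K p)) \<partial>\<nu>) < \<infinity>"
proof -
  have "(\<integral>\<^sup>+\<psi>. ennreal (min 1 (\<psi> K)) \<partial>\<Lambda>) = (\<integral>\<^sup>+p. ennreal (min 1 (hit_function p K)) \<partial>\<nu>)"
    using K by (intro nn_integral_\<Lambda>) measurable
  then show ?thesis using nn_integral_min_finite[OF K] by (simp add: height_at_eq[OF K])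
qed

lemma min_integral_finite:
  assumes K: "K \<in> convex_bodies"
  shows "(\<integral>\<^sup>+(F, r). ennreal (min 1 r) * of_bool (F \<inter> K \<noteq> {}) \<partial>\<nu>) < \<infinity>"
proof -
  have "(\<integral>\<^sup>+(F, r). ennreal (min 1 r) * of_bool (F \<inter> K \<noteq> {}) \<partial>\<nu>) = (\<integral>\<^sup>+p. ennreal (min 1 (height_at K p)) \<partial>\<nu>)"
    by (intro nn_integral_cong) (auto simp: height_at_def Int_commute split: prod.split)
  then show ?thesis using nn_integral_min_height[OF K] by simp
qed

text \<open>A non-empty set with positive mark hits a large ball with mark above some 1/(n+1), so
  the sets \<open>A n\<close> exhaust the space; on \<open>A n\<close> the integrand of (L1) for
  that ball is at least 1/(n+1), which bounds the measure.\<close>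

lemma sigma_finite_\<nu>: "sigma_finite_measure \<nu>"
proof
  define A where "A n = {p \<in> space \<nu>. 1 / real (Suc n) \<le> height_at (cball 0 (real n)) p}" for n
  have [measurable]: "height_at (cball 0 (real n)) \<in> borel_measurable \<nu>" for n by (intro height_at_measurable ball_convex_body)
  have Am[measurable]: "A n \<in> sets \<nu>" for n unfolding A_def by measurable
  have "emeasure \<nu> (A n) \<noteq> \<infinity>" for n
  proof -
    have "ennreal (1 / real (Suc n)) * emeasure \<nu> (A n) = (\<integral>\<^sup>+p. ennreal (1 / real (Suc n)) * indicator (A n) p \<partial>\<nu>)"
      by (simp add: nn_integral_cmult_indicator)
    also have "\<dots> \<le> (\<integral>\<^sup>+p. ennreal (min 1 (height_at (cball 0 (real n)) p)) \<partial>\<nu>)"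
      by (intro nn_integral_mono) (auto simp: A_def indicator_def intro!: ennreal_leI)
    also have "\<dots> < \<infinity>" by (intro nn_integral_min_height ball_convex_body)
    finally show ?thesis by (auto simp: ennreal_mult_less_top)
  qed
  moreover have "(\<Union>n. A n) = space \<nu>"
  proof (intro equalityI subsetI)
    fix p assume p: "p \<in> space \<nu>"
    then obtain x where x: "x \<in> fst p" "0 < snd p" by (auto simp: space_\<nu> closed_convex_sets_def)
    obtain m where m: "1 / real (Suc m) < snd p" using x(2) nat_approx_posE by blast
    obtain n where n: "norm x \<le> real n" using real_arch_simple by blast
    have "1 / real (Suc (max m n)) \<le> 1 / real (Suc m)" by (intro divide_left_mono) auto
    moreover have "x \<in> cball 0 (real (max m n)) \<inter> fst p" using x n by simp
    ultimately have "p \<in> A (max m n)" using m p unfolding A_def height_at_def by auto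
    then show "p \<in> (\<Union>n. A n)" by blast
  qed (auto simp: A_def)
  ultimately show "\<exists>A. countable A \<and> A \<subseteq> sets \<nu> \<and> \<Union>A = space \<nu> \<and> (\<forall>a\<in>A. emeasure \<nu> a \<noteq> \<infinity>)"
    using Am by (intro exI[of _ "range A"]) auto
qed

lemma space_\<nu>_nonempty: "space \<nu> \<noteq> {}"
proof -
  have "({0}, 1) \<in> space \<nu>" by (simp add: space_\<nu> closed_convex_sets_def)
  then show ?thesis by blast
qed

text \<open>The bridge between the two sides: by change of variables along
  \<open>hit_function\<close>, the Poisson exponent of a combination of heights is a Laplace
  exponent of the Levy measure, in particular finite.\<close>

lemma nn_integral_nexp_height:
  assumes K: "\<And>j. j < m \<Longrightarrow> K j \<in> convex_bodies" and u: "\<And>j. j < m \<Longrightarrow> 0 \<le> u j"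
  shows "(\<integral>\<^sup>+p. ennreal (1 - nexp (\<Sum>j<(m::nat). ennreal (u j) * ennreal (height_at (K j) p))) \<partial>\<nu>) =
    ennreal (levy_exponent m K u)"
proof -
  let ?g = "\<lambda>\<psi>. 1 - exp (- (\<Sum>j<m. u j * \<psi> (K j)))"
  have int: "integrable \<Lambda> ?g" using K u by (rule integrable_one_minus_exp)
  have nn: "0 \<le> ?g \<psi>" if "\<psi> \<in> space \<Lambda>" for \<psi>
    using K u \<psi>_nonneg[OF that] by (auto intro!: sum_nonneg mult_nonneg_nonneg)
  have "ennreal (\<integral>\<psi>. ?g \<psi> \<partial>\<Lambda>) = (\<integral>\<^sup>+\<psi>. ennreal (?g \<psi>) \<partial>\<Lambda>)"
    using int nn by (intro nn_integral_eq_integral[symmetric] AE_I2)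
  also have "\<dots> = (\<integral>\<^sup>+p. ennreal (?g (hit_function p)) \<partial>\<nu>)"
    by (intro nn_integral_\<Lambda> measurable_compose[OF borel_measurable_integrable[OF int] measurable_ennreal])
  also have "\<dots> = (\<integral>\<^sup>+p. ennreal (1 - nexp (\<Sum>j<m. ennreal (u j) * ennreal (height_at (K j) p))) \<partial>\<nu>)"
  proof (intro nn_integral_cong)
    fix p assume p: "p \<in> space \<nu>"
    have "(\<Sum>j<m. ennreal (u j) * ennreal (height_at (K j) p)) = (\<Sum>j<m. ennreal (u j * height_at (K j) p))"
      using u height_at_nonneg[OF p] by (intro sum.cong) (auto simp: ennreal_mult)
    also have "\<dots> = ennreal (\<Sum>j<m. u j * height_at (K j) p)"
      using u height_at_nonneg[OF p] by (intro sum_ennreal) auto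
    also have "nexp \<dots> = exp (- (\<Sum>j<m. u j * hit_function p (K j)))"
      using K u height_at_nonneg[OF p] by (subst nexp_ennreal) (auto intro!: sum_nonneg simp: height_at_eq)
    finally show "ennreal (?g (hit_function p)) = ennreal (1 - nexp (\<Sum>j<m. ennreal (u j) * ennreal (height_at (K j) p)))"
      by simp
  qed
  finally show ?thesis by simp
qed

end

section \<open>The Poisson sum and its increments\<close>

locale poisson_levy_process = poisson_levy M \<Phi> \<Lambda> \<nu>
  for M :: "'w measure" and \<Phi> :: "'a::euclidean_space set \<Rightarrow> 'w \<Rightarrow> real" and \<Lambda> \<nu> +
  fixes P :: "'v measure" and T :: "'v \<Rightarrow> enat" and X :: "nat \<Rightarrow> 'v \<Rightarrow> 'a set \<times> real"
  assumes PP: "poisson_point_process P \<nu> T X"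
begin

lemma prob_P: "prob_space P" and T_measurable [measurable]: "T \<in> measurable P (count_space UNIV)"
  and X_measurable [measurable]: "X i \<in> measurable P \<nu>"
  using PP by (auto simp: poisson_point_process_def complete_prob_space_def)

text \<open>The random part of \<open>poisson_valuation\<close> with values in [0,\<infinity>],
  meaningful before summability is known.\<close>

definition hit_sum :: "'a set \<Rightarrow> 'v \<Rightarrow> ennreal" where
  "hit_sum K = psum T X (\<lambda>p. ennreal (height_at K p))"

lemma hit_sum_measurable [measurable]: "K \<in> convex_bodies \<Longrightarrow> hit_sum K \<in> borel_measurable P"
  unfolding hit_sum_def by measurable

lemma hit_sum_eq: "hit_sum K w = (\<Sum>i. ennreal (hit_term T X K w i))"
  unfolding hit_sum_def psum_def nn_integral_count_space_nat hit_term_def height_at_def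
  by (intro suminf_cong) simp

lemma hit_term_nonneg: "w \<in> space P \<Longrightarrow> 0 \<le> hit_term T X K w i"
  using measurable_space[OF X_measurable, of w i] by (auto simp: hit_term_def space_\<nu>)

lemma laplace_hit_sum:
  assumes K: "\<And>j. j < m \<Longrightarrow> K j \<in> convex_bodies" and u: "\<And>j. j < m \<Longrightarrow> 0 \<le> u j"
  shows "(\<integral>w. nexp (\<Sum>j<(m::nat). ennreal (u j) * hit_sum (K j) w) \<partial>P) =
    exp (- levy_exponent m K u)"
proof -
  let ?f = "\<lambda>p. \<Sum>j<m. ennreal (u j) * ennreal (height_at (K j) p)"
  have e: "(\<integral>\<^sup>+p. ennreal (1 - nexp (?f p)) \<partial>\<nu>) =
      ennreal (levy_exponent m K u)"
    using K u by (rule nn_integral_nexp_height)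
  have "?f \<in> borel_measurable \<nu>" using K by (auto intro!: borel_measurable_sum)
  then have "(\<integral>w. nexp (psum T X ?f w) \<partial>P) = nexp (\<integral>\<^sup>+p. ennreal (1 - nexp (?f p)) \<partial>\<nu>)"
    by (intro poisson_point_process_laplace[OF PP]) (auto simp: e)
  also have "\<dots> = exp (- levy_exponent m K u)"
    unfolding e
  proof (intro nexp_ennreal integral_nonneg_AE AE_I2)
    fix \<psi> assume "\<psi> \<in> space \<Lambda>"
    then show "0 \<le> 1 - exp (- (\<Sum>j<m. u j * \<psi> (K j)))"
      using K u \<psi>_nonneg by (auto intro!: sum_nonneg mult_nonneg_nonneg)
  qed
  finally show ?thesis by (simp add: psum_sum psum_cmult hit_sum_def)
qed

text \<open>For a sum S in [0,\<infinity>], the probability of S < \<infinity> is the limit of the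
  expectation of exp(-uS) as u decreases to 0. Here the exponent tends to 0 by dominated
  convergence, so the limit is 1.\<close>

lemma AE_hit_sum_finite:
  assumes K: "K \<in> convex_bodies"
  shows "AE w in P. hit_sum K w < \<top>"
proof -
  interpret P: prob_space P by (rule prob_P)
  define u where "u n = 1 / real (Suc n)" for n
  have u: "0 \<le> u n" "u n \<le> 1" for n by (auto simp: u_def)
  have u0: "u \<longlonglongrightarrow> 0" unfolding u_def by (rule lim_inverse_n'[THEN LIMSEQ_Suc])
  have int: "integrable \<Lambda> (\<lambda>\<psi>. 1 - exp (- (c * \<psi> K)))" if "0 \<le> c" for c
    using integrable_one_minus_exp[of 1 "\<lambda>_. K" "\<lambda>_. c"] K that by simp
  have "(\<lambda>n. \<integral>\<psi>. 1 - exp (- (u n * \<psi> K)) \<partial>\<Lambda>) \<longlonglongrightarrow> (\<integral>\<psi>. 1 - exp (- (0 * \<psi> K)) \<partial>\<Lambda>)"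
  proof (rule integral_dominated_convergence[where w="\<lambda>\<psi>. 1 - exp (- (1 * \<psi> K))"])
    show "AE \<psi> in \<Lambda>. (\<lambda>n. 1 - exp (- (u n * \<psi> K))) \<longlonglongrightarrow> 1 - exp (- (0 * \<psi> K))"
      using u0 by (intro AE_I2 tendsto_intros)
    show "AE \<psi> in \<Lambda>. norm (1 - exp (- (u n * \<psi> K))) \<le> 1 - exp (- (1 * \<psi> K))" for n
    proof (rule AE_I2)
      fix \<psi> assume "\<psi> \<in> space \<Lambda>"
      then have "0 \<le> \<psi> K" using K by (rule \<psi>_nonneg)
      then show "norm (1 - exp (- (u n * \<psi> K))) \<le> 1 - exp (- (1 * \<psi> K))"
        using u[of n] by (simp add: mult_left_le_one_le)
    qed
  qed (use K int[of 1] in auto)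
  then have "(\<lambda>n. exp (- (\<integral>\<psi>. 1 - exp (- (u n * \<psi> K)) \<partial>\<Lambda>))) \<longlonglongrightarrow> exp (- 0)"
    by (intro tendsto_exp tendsto_minus) simp
  moreover have "(\<integral>w. nexp (ennreal (u n) * hit_sum K w) \<partial>P) = exp (- (\<integral>\<psi>. 1 - exp (- (u n * \<psi> K)) \<partial>\<Lambda>))" for n
    using laplace_hit_sum[of 1 "\<lambda>_. K" "\<lambda>_. u n"] K u by simp
  ultimately have l1: "(\<lambda>n. \<integral>w. nexp (ennreal (u n) * hit_sum K w) \<partial>P) \<longlonglongrightarrow> 1" by simp
  let ?F = "{w \<in> space P. hit_sum K w < \<top>}"
  have F[measurable]: "?F \<in> sets P" using K by measurable
  have "(\<lambda>n. \<integral>w. nexp (ennreal (u n) * hit_sum K w) \<partial>P) \<longlonglongrightarrow> (\<integral>w. indicator ?F w \<partial>P)"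
  proof (rule integral_dominated_convergence[where w="\<lambda>_. 1"])
    show "AE w in P. (\<lambda>n. nexp (ennreal (u n) * hit_sum K w)) \<longlonglongrightarrow> indicator ?F w"
    proof (rule AE_I2)
      fix w assume w: "w \<in> space P"
      show "(\<lambda>n. nexp (ennreal (u n) * hit_sum K w)) \<longlonglongrightarrow> indicator ?F w"
      proof (cases "hit_sum K w")
        case (real r)
        have "(\<lambda>n. exp (- (u n * r))) \<longlonglongrightarrow> exp (- (0 * r))" using u0 by (intro tendsto_intros)
        then show ?thesis using real w u by (simp add: ennreal_mult[symmetric])
      next
        case top
        have "ennreal (u n) \<noteq> 0" for n by (simp add: u_def)
        then show ?thesis using top by (simp add: ennreal_mult_top)
      qed
    qed
  qed (use K in auto)
  then have "(\<integral>w. indicator ?F w \<partial>P) = (1 :: real)" using l1 by (rule LIMSEQ_unique)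
  then have "measure P ?F = 1" by simp
  then show ?thesis using P.prob_eq_1[OF F] by simp
qed

lemma hit_term_mono:
  assumes "w \<in> space P" "L \<subseteq> K" shows "hit_term T X L w i \<le> hit_term T X K w i"
proof (cases "L \<inter> fst (X i w) = {}")
  case True
  then have "hit_term T X L w i = 0" by (simp add: hit_term_def)
  then show ?thesis using hit_term_nonneg[OF assms(1)] by simp
next
  case False
  then have "K \<inter> fst (X i w) \<noteq> {}" using assms(2) by blast
  then show ?thesis using False by (simp add: hit_term_def)
qed

text \<open>One null set serves all bodies: each lies in a ball of integer radius, whose series
  dominates, and there are countably many such balls.\<close>

lemma AE_summable: "AE w in P. \<forall>K\<in>convex_bodies. summable (hit_term T X K w)"
proof -
  have "AE w in P. \<forall>n. hit_sum (cball 0 (real n)) w < \<top>"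
    using AE_hit_sum_finite[OF ball_convex_body] by (simp add: AE_all_countable)
  then show ?thesis using AE_space
  proof eventually_elim
    case (elim w)
    show ?case
    proof
      fix K :: "'a set" assume K: "K \<in> convex_bodies"
      obtain N where N: "\<And>n. n \<ge> N \<Longrightarrow> K \<subseteq> cball 0 (real n)" using convex_body_subset_ball[OF K] by blast
      have "hit_sum (cball 0 (real N)) w < \<top>" using elim(1) ..
      then have "(\<Sum>i. ennreal (hit_term T X (cball 0 (real N)) w i)) \<noteq> \<top>" by (simp add: hit_sum_eq)
      then have "summable (hit_term T X (cball 0 (real N)) w)"
        by (intro summable_suminf_not_top hit_term_nonneg elim(2))
      then show "summable (hit_term T X K w)"
      proof (rule summable_comparison_test'[where N=0])
        show "norm (hit_term T X K w i) \<le> hit_term T X (cball 0 (real N)) w i" for i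
          using hit_term_mono[OF elim(2) N] hit_term_nonneg[OF elim(2)] by simp
      qed
    qed
  qed
qed

lemma AE_poisson_valuation:
  assumes "K \<in> convex_bodies"
  shows "AE w in P. hit_sum K w < \<top> \<and> poisson_valuation \<phi> T X K w = \<phi> K + enn2real (hit_sum K w)"
  using AE_summable AE_hit_sum_finite[OF assms] AE_space
proof eventually_elim
  case (elim w)
  have "hit_sum K w = ennreal (\<Sum>i. hit_term T X K w i)"
    unfolding hit_sum_eq using elim assms by (intro suminf_ennreal2 hit_term_nonneg) auto
  moreover have "0 \<le> (\<Sum>i. hit_term T X K w i)"
    using elim assms by (intro suminf_nonneg hit_term_nonneg) auto
  ultimately show ?case using elim by (simp add: poisson_valuation_def)
qed

lemma poisson_valuation_measurable [measurable]:
  assumes K: "K \<in> convex_bodies" shows "poisson_valuation \<phi> T X K \<in> borel_measurable P"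
proof -
  have "(\<lambda>w. height_at K (X i w)) \<in> borel_measurable P" for i
    using measurable_compose[OF X_measurable height_at_measurable[OF K]] .
  then have "(\<lambda>w. hit_term T X K w i) \<in> borel_measurable P" for i
    unfolding hit_term_def height_at_def by measurable
  then show ?thesis unfolding poisson_valuation_def[abs_def] by measurable
qed

lemma AE_poisson_valuation_nonneg:
  assumes "K \<in> convex_bodies" shows "AE w in P. 0 \<le> poisson_valuation \<phi> T X K w"
  using AE_poisson_valuation[OF assms] by (rule eventually_mono) (simp add: deterministic_part_nonneg[OF assms])

lemma laplace_poisson_valuation:
  assumes K: "\<And>j. j < m \<Longrightarrow> K j \<in> convex_bodies" and u: "\<And>j. j < m \<Longrightarrow> 0 \<le> u j"
  shows "(\<integral>w. exp (- (\<Sum>j<(m::nat). u j * poisson_valuation \<phi> T X (K j) w)) \<partial>P) =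
    exp (- (\<Sum>j<m. u j * \<phi> (K j)) - levy_exponent m K u)"
proof -
  have "AE w in P. \<forall>j\<in>{..<m}. hit_sum (K j) w < \<top> \<and> poisson_valuation \<phi> T X (K j) w = \<phi> (K j) + enn2real (hit_sum (K j) w)"
    using AE_poisson_valuation K by (intro AE_finite_allI) auto
  then have "AE w in P. exp (- (\<Sum>j<m. u j * poisson_valuation \<phi> T X (K j) w)) =
    exp (- (\<Sum>j<m. u j * \<phi> (K j))) * nexp (\<Sum>j<m. ennreal (u j) * hit_sum (K j) w)"
  proof eventually_elim
    case (elim w)
    have "(\<Sum>j<m. ennreal (u j) * hit_sum (K j) w) = (\<Sum>j<m. ennreal (u j * enn2real (hit_sum (K j) w)))"
      using elim u by (intro sum.cong) (auto simp: ennreal_mult)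
    also have "\<dots> = ennreal (\<Sum>j<m. u j * enn2real (hit_sum (K j) w))" using u by (intro sum_ennreal) auto
    also have "nexp \<dots> = exp (- (\<Sum>j<m. u j * enn2real (hit_sum (K j) w)))" using u by (intro nexp_ennreal sum_nonneg) auto
    finally show ?case using elim by (simp add: exp_add[symmetric] sum.distrib algebra_simps)
  qed
  then have "(\<integral>w. exp (- (\<Sum>j<m. u j * poisson_valuation \<phi> T X (K j) w)) \<partial>P) =
    (\<integral>w. exp (- (\<Sum>j<m. u j * \<phi> (K j))) * nexp (\<Sum>j<m. ennreal (u j) * hit_sum (K j) w) \<partial>P)"
    using K by (intro integral_cong_AE)
      (auto intro!: borel_measurable_sum borel_measurable_times borel_measurable_exp borel_measurable_uminus measurable_compose[OF _ measurable_nexp])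
  also have "\<dots> = exp (- (\<Sum>j<m. u j * \<phi> (K j))) * exp (- levy_exponent m K u)"
    using laplace_hit_sum[of m K u, OF K u] by simp
  finally show ?thesis by (simp add: exp_diff exp_minus divide_inverse)
qed

lemma same_fdd_poisson_valuation: "same_fdd M \<Phi> P (poisson_valuation \<phi> T X)"
  unfolding same_fdd_def
proof (intro allI impI, elim conjE)
  fix J :: "'a set set" assume J: "finite J" "J \<subseteq> convex_bodies"
  have eq: "(\<integral>w. exp (- (\<Sum>K\<in>J. real (k K) * \<Phi> K w)) \<partial>M) =
    (\<integral>w. exp (- (\<Sum>K\<in>J. real (k K) * poisson_valuation \<phi> T X K w)) \<partial>P)" for k
  proof (cases "J = {}")
    case True
    then show ?thesis using prob_P by (simp add: prob_space prob_space.prob_space)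
  next
    case False
    obtain h where h: "bij_betw h {..<card J} J"
      using ex_bij_betw_nat_finite[OF J(1)] by (auto simp: atLeast0LessThan)
    have hJ: "h j \<in> convex_bodies" if "j < card J" for j
      using bij_betwE[OF h] that J(2) by auto
    have "1 \<le> card J" using False J(1) by (simp add: Suc_le_eq card_gt_0_iff)
    then have "(\<integral>w. exp (- (\<Sum>j<card J. real (k (h j)) * \<Phi> (h j) w)) \<partial>M) =
      (\<integral>w. exp (- (\<Sum>j<card J. real (k (h j)) * poisson_valuation \<phi> T X (h j) w)) \<partial>P)"
      using hJ by (subst laplace_poisson_valuation laplace; simp)+
    then show ?thesis
      unfolding sum.reindex_bij_betw[OF h, of "\<lambda>K. real (k K) * \<Phi> K _"]
        sum.reindex_bij_betw[OF h, of "\<lambda>K. real (k K) * poisson_valuation \<phi> T X K _"] .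
  qed
  show "distr M (PiM J (\<lambda>_. borel)) (\<lambda>w. \<lambda>K\<in>J. \<Phi> K w) =
    distr P (PiM J (\<lambda>_. borel)) (\<lambda>w. \<lambda>K\<in>J. poisson_valuation \<phi> T X K w)"
  proof (rule distr_PiM_eqI_exp[OF _ prob_P J(1)])
    show "prob_space M" by (rule prob_space_axioms)
  qed (use J eq in \<open>auto intro: \<Phi>_nonneg AE_poisson_valuation_nonneg\<close>)
qed

lemma poisson_representation: "poisson_representation M \<Phi> \<phi> P T X"
  unfolding poisson_representation_def using AE_summable same_fdd_poisson_valuation ..

text \<open>The i-th increment sums the marks of the points that hit \<open>L i\<close> and miss
  \<open>L (Suc i)\<close>. These conditions exclude each other for different i, so the Poisson
  exponent is additive over them and the moments of the exponentials of the increments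
  factorise.\<close>

lemma indep_increments_poisson_valuation:
  assumes L: "\<And>i. i \<in> {1..Suc n} \<Longrightarrow> L i \<in> convex_bodies" and sub: "\<And>i. i \<in> {1..n} \<Longrightarrow> L (Suc i) \<subseteq> L i"
  shows "prob_space.indep_vars P (\<lambda>_. borel)
    (\<lambda>i w. poisson_valuation \<phi> T X (L i) w - poisson_valuation \<phi> T X (L (Suc i)) w) {1..n}"
proof -
  interpret P: prob_space P by (rule prob_P)
  let ?V = "poisson_valuation \<phi> T X"
  let ?I = "{1..n}"
  let ?Y = "\<lambda>i w. exp (- (?V (L i) w - ?V (L (Suc i)) w))"
  define d where "d i p = ennreal (snd p * of_bool (L i \<inter> fst p \<noteq> {} \<and> L (Suc i) \<inter> fst p = {}))" for i and p :: "'a set \<times> real"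
  have dm[measurable]: "d i \<in> borel_measurable \<nu>" if "i \<in> ?I" for i
  proof -
    have "(\<lambda>p. ennreal (height_at (L i) p - height_at (L (Suc i)) p)) \<in> borel_measurable \<nu>"
      using L[of i] L[of "Suc i"] that
      by (intro measurable_compose[OF _ measurable_ennreal] borel_measurable_diff height_at_measurable) auto
    moreover have "d i p = ennreal (height_at (L i) p - height_at (L (Suc i)) p)" for p
      using sub[OF that] by (auto simp: d_def height_at_def)
    ultimately show ?thesis by (simp cong: measurable_cong)
  qed
  have split: "hit_sum (L i) w = hit_sum (L (Suc i)) w + psum T X (d i) w" if "i \<in> ?I" "w \<in> space P" for i w
  proof -
    have "hit_sum (L i) w = psum T X (\<lambda>p. ennreal (height_at (L (Suc i)) p) + d i p) w"
      unfolding hit_sum_def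
    proof (rule psum_cong)
      fix j
      have "0 \<le> snd (X j w)" using measurable_space[OF X_measurable that(2), of j] by (auto simp: space_\<nu>)
      then show "ennreal (height_at (L i) (X j w)) =
          ennreal (height_at (L (Suc i)) (X j w)) + d i (X j w)"
        using sub[OF that(1)] by (auto simp: d_def height_at_def)
    qed
    then show ?thesis by (simp add: psum_add hit_sum_def)
  qed
  \<comment> \<open>The deterministic share of \<open>?Y i\<close>. As \<phi> is monotone, it lies
    in [0,1], which keeps \<open>?Y i\<close> there too, as the moment criterion requires.\<close>
  define c where "c i = exp (- (\<phi> (L i) - \<phi> (L (Suc i))))" for i
  have c: "0 \<le> c i" "c i \<le> 1" if "i \<in> ?I" for i
    using deterministic_part_mono[OF L L sub[OF that]] that by (auto simp: c_def)
  have Y: "AE w in P. ?Y i w = c i * nexp (psum T X (d i) w)" if "i \<in> ?I" for i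
  proof -
    have cb: "L i \<in> convex_bodies" "L (Suc i) \<in> convex_bodies" using L that by auto
    show ?thesis using AE_poisson_valuation[OF cb(1)] AE_poisson_valuation[OF cb(2)] AE_space
    proof eventually_elim
      case (elim w)
      have sp: "hit_sum (L i) w = hit_sum (L (Suc i)) w + psum T X (d i) w" using split that elim by simp
      then have "psum T X (d i) w < \<top>" using elim by auto
      then have "enn2real (hit_sum (L i) w) = enn2real (hit_sum (L (Suc i)) w) + enn2real (psum T X (d i) w)"
        using elim unfolding sp by (intro enn2real_plus) auto
      moreover have "nexp (psum T X (d i) w) = exp (- enn2real (psum T X (d i) w))"
        using \<open>psum T X (d i) w < \<top>\<close> by (simp add: nexp_def)
      ultimately show ?case using elim by (simp add: c_def exp_add[symmetric])
    qed
  qed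
  have Vm: "(\<lambda>w. ?V (L i) w - ?V (L (Suc i)) w) \<in> borel_measurable P" if "i \<in> ?I" for i
    using L that by (intro borel_measurable_diff poisson_valuation_measurable) auto
  have Ym: "(\<lambda>w. ?Y i w) \<in> borel_measurable P" if "i \<in> ?I" for i
    using measurable_compose[OF borel_measurable_uminus[OF Vm[OF that]] borel_measurable_exp] .
  \<comment> \<open>If i < j, a set that hits \<open>L j\<close> also hits \<open>L (Suc i)\<close>;
    hence at most one \<open>d i p\<close> is non-zero, and \<open>1 - nexp\<close> is
    additive.\<close>
  have one: "1 - nexp (\<Sum>i\<in>?I. of_nat (k i) * d i p) = (\<Sum>i\<in>?I. 1 - nexp (of_nat (k i) * d i p))" for k p
  proof (cases "\<exists>i\<in>?I. d i p \<noteq> 0")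
    case True
    then obtain i where i: "i \<in> ?I" "d i p \<noteq> 0" by blast
    have dec: "L b \<subseteq> L a" if "a \<le> b" "1 \<le> a" "b \<le> Suc n" for a b
      using that
    proof (induction b rule: dec_induct)
      case (step b)
      then show ?case using sub[of b] by auto
    qed simp
    have d_pos: "L a \<inter> fst p \<noteq> {} \<and> L (Suc a) \<inter> fst p = {}" if "d a p \<noteq> 0" for a
    proof (rule ccontr)
      assume "\<not> (L a \<inter> fst p \<noteq> {} \<and> L (Suc a) \<inter> fst p = {})"
      then have "d a p = 0" unfolding d_def by (simp only: of_bool_eq mult_zero_right ennreal_0)
      then show False using that by simp
    qed
    have z: "d j p = 0" if j: "j \<in> ?I" "j \<noteq> i" for j
    proof (rule ccontr)
      assume "d j p \<noteq> 0"
      then have "L j \<inter> fst p \<noteq> {}" "L (Suc j) \<inter> fst p = {}" "L i \<inter> fst p \<noteq> {}" "L (Suc i) \<inter> fst p = {}"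
        using d_pos[of j] d_pos[OF i(2)] by auto
      moreover have "L j \<subseteq> L (Suc i) \<or> L i \<subseteq> L (Suc j)"
        using dec[of "Suc i" j] dec[of "Suc j" i] i(1) j by (cases "i < j") auto
      ultimately show False by blast
    qed
    have "(\<Sum>j\<in>?I. of_nat (k j) * d j p) = (\<Sum>j\<in>?I. if j = i then of_nat (k i) * d i p else 0)"
      "(\<Sum>j\<in>?I. 1 - nexp (of_nat (k j) * d j p)) = (\<Sum>j\<in>?I. if j = i then 1 - nexp (of_nat (k i) * d i p) else 0)"
      by (rule sum.cong[OF refl]; use z in auto)+
    then show ?thesis using i(1) by simp
  qed simp
  \<comment> \<open>The Laplace formula needs a finite exponent; \<open>d i\<close> is bounded by
    the height at \<open>L i\<close>, whose exponent is finite.\<close>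
  have fin: "(\<integral>\<^sup>+p. ennreal (1 - nexp (of_nat k * d i p)) \<partial>\<nu>) < \<infinity>" if "i \<in> ?I" for k i
  proof -
    have "(\<integral>\<^sup>+p. ennreal (1 - nexp (of_nat k * d i p)) \<partial>\<nu>) \<le>
      (\<integral>\<^sup>+p. ennreal (1 - nexp (\<Sum>j<(1::nat). ennreal (real k) * ennreal (height_at (L i) p))) \<partial>\<nu>)"
    proof (intro nn_integral_mono ennreal_leI diff_left_mono nexp_antimono)
      fix p assume p: "p \<in> space \<nu>"
      have "d i p \<le> ennreal (height_at (L i) p)"
        using p by (auto simp: d_def height_at_def space_\<nu>)
      then show "of_nat k * d i p \<le> (\<Sum>j<(1::nat). ennreal (real k) * ennreal (height_at (L i) p))"
        by (simp add: ennreal_of_nat_eq_real_of_nat mult_left_mono)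
    qed
    also have "\<dots> < \<infinity>"
      using L[of i] that by (subst nn_integral_nexp_height[of 1 "\<lambda>_. L i" "\<lambda>_. real k"]) auto
    finally show ?thesis .
  qed
  have lap: "(\<integral>w. nexp (psum T X (\<lambda>p. of_nat k * d i p) w) \<partial>P) = nexp (\<integral>\<^sup>+p. ennreal (1 - nexp (of_nat k * d i p)) \<partial>\<nu>)"
    if i: "i \<in> ?I" for k i
    using fin[OF i] dm[OF i] by (intro poisson_point_process_laplace[OF PP]) auto
  have pw: "nexp (psum T X (d i) w) ^ k = nexp (psum T X (\<lambda>p. of_nat k * d i p) w)" for i k w
    by (simp add: nexp_power psum_cmult)
  have "P.indep_vars (\<lambda>_. borel) (\<lambda>i w. ?Y i w) ?I"
  proof (rule P.indep_vars_moments)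
    show "AE w in P. ?Y i w \<in> {0..1}" if "i \<in> ?I" for i
      using Y[OF that] by (rule eventually_mono) (use c[OF that] in \<open>auto intro!: mult_le_one\<close>)
    fix k :: "nat \<Rightarrow> nat"
    let ?f = "\<lambda>p. \<Sum>i\<in>?I. of_nat (k i) * d i p"
    have fm: "?f \<in> borel_measurable \<nu>" using dm by (intro borel_measurable_sum) auto
    have int_f: "(\<integral>\<^sup>+p. ennreal (1 - nexp (?f p)) \<partial>\<nu>) = (\<Sum>i\<in>?I. \<integral>\<^sup>+p. ennreal (1 - nexp (of_nat (k i) * d i p)) \<partial>\<nu>)"
    proof -
      have "ennreal (1 - nexp (?f p)) = (\<Sum>i\<in>?I. ennreal (1 - nexp (of_nat (k i) * d i p)))" for p
        unfolding one by (intro sum_ennreal[symmetric]) simp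
      moreover have "(\<lambda>p. of_nat (k i) * d i p) \<in> borel_measurable \<nu>" if "i \<in> ?I" for i
        using dm[OF that] by measurable
      ultimately show ?thesis
        by (simp only:) (intro nn_integral_sum measurable_compose[OF _ measurable_ennreal]
          borel_measurable_diff borel_measurable_const measurable_compose[OF _ measurable_nexp])
    qed
    have fin_f: "(\<integral>\<^sup>+p. ennreal (1 - nexp (?f p)) \<partial>\<nu>) < \<infinity>"
      unfolding int_f infinity_ennreal_def using fin by (subst ennreal_sum_less_top) auto
    have prod: "(\<Prod>i\<in>?I. (c i * nexp (psum T X (d i) w)) ^ k i) = (\<Prod>i\<in>?I. c i ^ k i) * nexp (psum T X ?f w)" for w
      by (simp add: power_mult_distrib prod.distrib pw psum_sum nexp_sum)
    have AEY: "AE w in P. \<forall>i\<in>?I. ?Y i w = c i * nexp (psum T X (d i) w)"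
      using Y by (intro AE_finite_allI) auto
    have "(\<integral>w. (\<Prod>i\<in>?I. ?Y i w ^ k i) \<partial>P) =
      (\<integral>w. (\<Prod>i\<in>?I. c i ^ k i) * nexp (psum T X ?f w) \<partial>P)"
    proof (rule integral_cong_AE)
      show "AE w in P. (\<Prod>i\<in>?I. ?Y i w ^ k i) = (\<Prod>i\<in>?I. c i ^ k i) * nexp (psum T X ?f w)"
        using AEY
      proof eventually_elim
        case (elim w)
        then show ?case unfolding prod[symmetric] by (intro prod.cong) auto
      qed
      show "(\<lambda>w. \<Prod>i\<in>?I. ?Y i w ^ k i) \<in> borel_measurable P"
        by (intro borel_measurable_prod borel_measurable_power Ym)
      show "(\<lambda>w. (\<Prod>i\<in>?I. c i ^ k i) * nexp (psum T X ?f w)) \<in> borel_measurable P"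
        using fm by measurable
    qed
    also have "\<dots> = (\<Prod>i\<in>?I. c i ^ k i) * nexp (\<integral>\<^sup>+p. ennreal (1 - nexp (?f p)) \<partial>\<nu>)"
      using poisson_point_process_laplace[OF PP fm fin_f] by simp
    also have "\<dots> = (\<Prod>i\<in>?I. c i ^ k i * (\<integral>w. nexp (psum T X (d i) w) ^ k i \<partial>P))"
      unfolding int_f unfolding nexp_sum[of _ ?I] prod.distrib
      by (intro arg_cong2[where f="(*)"] prod.cong refl) (simp only: pw lap)
    also have "\<dots> = (\<Prod>i\<in>?I. \<integral>w. ?Y i w ^ k i \<partial>P)"
    proof (intro prod.cong refl)
      fix i assume i: "i \<in> ?I"
      have "(\<integral>w. ?Y i w ^ k i \<partial>P) = (\<integral>w. c i ^ k i * nexp (psum T X (d i) w) ^ k i \<partial>P)"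
      proof (rule integral_cong_AE)
        show "AE w in P. ?Y i w ^ k i = c i ^ k i * nexp (psum T X (d i) w) ^ k i"
          using Y[OF i] by (rule eventually_mono) (simp only: power_mult_distrib)
        show "(\<lambda>w. ?Y i w ^ k i) \<in> borel_measurable P"
          by (intro borel_measurable_power Ym i)
        show "(\<lambda>w. c i ^ k i * nexp (psum T X (d i) w) ^ k i) \<in> borel_measurable P"
          using dm[OF i] by measurable
      qed
      then show "c i ^ k i * (\<integral>w. nexp (psum T X (d i) w) ^ k i \<partial>P) = (\<integral>w. ?Y i w ^ k i \<partial>P)"
        by simp
    qed
    finally show "(\<integral>w. (\<Prod>i\<in>?I. ?Y i w ^ k i) \<partial>P) =
      (\<Prod>i\<in>?I. \<integral>w. ?Y i w ^ k i \<partial>P)" .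
  qed (simp, rule Ym)
  \<comment> \<open>Taking -ln leads back from the exponentials to the increments.\<close>
  from P.indep_vars_compose2[OF this, of "\<lambda>i y. - ln y" "\<lambda>_. borel"] show ?thesis by simp
qed

lemma independent_increments_\<Phi>: "independent_increments M \<Phi>"
  unfolding independent_increments_def
proof (intro allI impI, elim conjE)
  fix n :: nat and L :: "nat \<Rightarrow> 'a set"
  assume n: "2 \<le> n" and cb: "\<forall>i\<in>{1..n}. L i \<in> convex_bodies" and sub: "\<forall>i\<in>{1..<n}. L (Suc i) \<subseteq> L i" and e: "L (Suc n) = {}"
  let ?J = "L ` {1..Suc n}"
  have L: "L i \<in> convex_bodies" if "i \<in> {1..Suc n}" for i
    using cb e that by (cases "i = Suc n") auto
  \<comment> \<open>The closing empty set continues the nested sequence, so the last increment is of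
    the same kind as the others.\<close>
  have subL: "L (Suc i) \<subseteq> L i" if "i \<in> {1..n}" for i
    using sub e that by (cases "i = n") auto
  have J: "finite ?J" "?J \<subseteq> convex_bodies" using L by auto
  let ?S = "PiM ?J (\<lambda>_. borel :: real measure)"
  let ?g = "\<lambda>i y. y (L i) - y (L (Suc i)) :: real"
  have "indep_vars (\<lambda>_. borel) (\<lambda>i w. ?g i ((\<lambda>w. \<lambda>K\<in>?J. \<Phi> K w) w)) {1..n}"
  proof (rule indep_vars_transfer[where g="?g" and S="?S" and A="\<lambda>w. \<lambda>K\<in>?J. \<Phi> K w"
        and B="\<lambda>w. \<lambda>K\<in>?J. poisson_valuation \<phi> T X K w", OF prob_space_axioms prob_P])
    show "(\<lambda>w. \<lambda>K\<in>?J. \<Phi> K w) \<in> measurable M ?S" using J(2) by (intro measurable_restrict \<Phi>_measurable) auto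
    show "(\<lambda>w. \<lambda>K\<in>?J. poisson_valuation \<phi> T X K w) \<in> measurable P ?S"
      using J(2) by (intro measurable_restrict poisson_valuation_measurable) auto
    show "distr M ?S (\<lambda>w. \<lambda>K\<in>?J. \<Phi> K w) = distr P ?S (\<lambda>w. \<lambda>K\<in>?J. poisson_valuation \<phi> T X K w)"
      using same_fdd_poisson_valuation J unfolding same_fdd_def by blast
    show "?g i \<in> borel_measurable ?S" if "i \<in> {1..n}" for i
      using that by (intro borel_measurable_diff measurable_component_singleton) auto
    have "prob_space.indep_vars P (\<lambda>_. borel) (\<lambda>i w. poisson_valuation \<phi> T X (L i) w - poisson_valuation \<phi> T X (L (Suc i)) w) {1..n}"
      using L subL by (rule indep_increments_poisson_valuation)
    then show "prob_space.indep_vars P (\<lambda>_. borel) (\<lambda>i w. ?g i ((\<lambda>w. \<lambda>K\<in>?J. poisson_valuation \<phi> T X K w) w)) {1..n}"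
      by (subst prob_space.indep_vars_cong[OF prob_P refl _ refl]) auto
    show "{1..n} \<noteq> {}" using n by simp
  qed
  then show "indep_vars (\<lambda>_. borel) (\<lambda>i w. \<Phi> (L i) w - \<Phi> (L (Suc i)) w) {1..n}"
    by (subst indep_vars_cong[OF refl _ refl]) auto
qed

end

theorem theorem5p2:
  fixes M :: "'w measure"
    and \<Phi> :: "'a::euclidean_space set \<Rightarrow> 'w \<Rightarrow> real"
    and \<Lambda> :: "('a set \<Rightarrow> real) measure"
  assumes "ID_valuation M \<Phi>"
    and "monotone_paths M \<Phi>"
    and "sigma_continuous_paths M \<Phi>"
    and "levy_measure_of M \<Phi> \<Lambda>"
  shows "(independent_increments M \<Phi> \<longleftrightarrow>
            (\<exists>\<nu>. borel_measure_on_marked_sets \<nu> \<and> \<Lambda> = hit_pushforward \<nu>)) \<and>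
         (\<forall>\<nu>. borel_measure_on_marked_sets \<nu> \<and> \<Lambda> = hit_pushforward \<nu> \<longrightarrow>
            valuation (deterministic_part M \<Phi>) \<and>
            mono_on convex_bodies (deterministic_part M \<Phi>) \<and>
            sigma_continuous (deterministic_part M \<Phi>) \<and>
            (\<exists>(P :: (enat \<times> (nat \<Rightarrow> 'a set \<times> real)) measure) T X.
               poisson_point_process P \<nu> T X \<and>
               poisson_representation M \<Phi> (deterministic_part M \<Phi>) P T X) \<and>
            (\<forall>(P :: 'v measure) T X. poisson_point_process P \<nu> T X \<longrightarrow>
               poisson_representation M \<Phi> (deterministic_part M \<Phi>) P T X) \<and>
            (\<forall>K\<in>convex_bodies.
               (\<integral>\<^sup>+(F, r). ennreal (min 1 r) * of_bool (F \<inter> K \<noteq> {}) \<partial>\<nu>) < \<infinity>))"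
proof -
  have rv: "random_valuation M \<Phi>" using assms(1) by (simp add: ID_valuation_def)
  then interpret prob_space M by (simp add: random_valuation_def complete_prob_space_def)
  interpret monotone_levy M \<Phi> \<Lambda>
    using rv assms(2-4) unfolding random_valuation_def monotone_paths_def sigma_continuous_paths_def
    by unfold_locales auto
  \<comment> \<open>Independence of increments is a property of the law of \<open>\<Phi>\<close>, so
    a single Poisson process with intensity \<nu>, on whatever space, is enough to deduce
    it.\<close>
  have repr: "\<exists>(P :: (enat \<times> (nat \<Rightarrow> 'a set \<times> real)) measure) T X. poisson_point_process P \<nu> T X \<and>
      poisson_representation M \<Phi> \<phi> P T X \<and> independent_increments M \<Phi>"
    if "borel_measure_on_marked_sets \<nu>" "\<Lambda> = hit_pushforward \<nu>" for \<nu>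
  proof -
    interpret poisson_levy M \<Phi> \<Lambda> \<nu> using that by unfold_locales
    obtain P :: "(enat \<times> (nat \<Rightarrow> 'a set \<times> real)) measure" and T X where PP: "poisson_point_process P \<nu> T X"
      using poisson_process_exists[OF sigma_finite_\<nu> space_\<nu>_nonempty] .
    interpret poisson_levy_process M \<Phi> \<Lambda> \<nu> P T X using PP by unfold_locales
    show ?thesis using PP poisson_representation independent_increments_\<Phi> by blast
  qed
  show ?thesis
  proof (intro conjI allI impI iffI)
    assume "independent_increments M \<Phi>"
    then interpret indep_levy M \<Phi> \<Lambda> by unfold_locales
    show "\<exists>\<nu>. borel_measure_on_marked_sets \<nu> \<and> \<Lambda> = hit_pushforward \<nu>" by (rule levy_measure_pushforward)
  next
    assume "\<exists>\<nu>. borel_measure_on_marked_sets \<nu> \<and> \<Lambda> = hit_pushforward \<nu>"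
    then show "independent_increments M \<Phi>" using repr by blast
  next
    fix \<nu> assume \<nu>: "borel_measure_on_marked_sets \<nu> \<and> \<Lambda> = hit_pushforward \<nu>"
    then interpret poisson_levy M \<Phi> \<Lambda> \<nu> by unfold_locales auto
    show "valuation \<phi>" by (rule valuation_deterministic_part)
    show "mono_on convex_bodies \<phi>" by (rule mono_on_deterministic_part)
    show "sigma_continuous \<phi>" by (rule sigma_continuous_deterministic_part)
    show "\<exists>(P :: (enat \<times> (nat \<Rightarrow> 'a set \<times> real)) measure) T X.
        poisson_point_process P \<nu> T X \<and> poisson_representation M \<Phi> \<phi> P T X"
      using repr \<nu> by blast
    show "poisson_representation M \<Phi> \<phi> P T X" if "poisson_point_process P \<nu> T X"
      for P :: "'v measure" and T X
    proof -
      interpret poisson_levy_process M \<Phi> \<Lambda> \<nu> P T X using that by unfold_locales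
      show ?thesis by (rule poisson_representation)
    qed
    show "\<forall>K\<in>convex_bodies. (\<integral>\<^sup>+(F, r). ennreal (min 1 r) * of_bool (F \<inter> K \<noteq> {}) \<partial>\<nu>) < \<infinity>"
      using min_integral_finite by blast
  qed
qed
end
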